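(* Fix integers $r\ge 2$ and $t\ge r$. For all sufficiently large $n$, the unique (up to isomorphism) extremal $n$-vertex $\mathcal F_{r,t}$-free $r$-graph is $\mathcal J_{t-1}(n)$. In particular, \[ \mathrm{ex}(n,\mathcal F_{r,t})=|\mathcal J_{t-1}(n)|=\binom nr-\binom{n-t+1}{r}+t_r^{(r)}(n-t+1). \]
   Context: An $r$-graph is an $r$-uniform hypergraph, identified with its edge set; $|\mathcal H|$ is its number of edges. $\mathrm{ex}(n,\mathcal F)$ is the maximum number of edges of an $n$-vertex $r$-graph containing no (not necessarily induced) copy of $\mathcal F$; extremal means attaining this maximum. Fan $\mathcal F_r$ ($r\ge2$): vertex set $\{c,t_1,\dots,t_r\}\cup A_1\cup\dots\cup A_r$, where the $A_i$ are pairwise disjoint sets of new vertices, each of size $r-2$; edges: the transversal edge $\{t_1,\dots,t_r\}$ and the petals $P_i=\{c,t_i\}\cup A_i$, $i\in[r]$. Semi-blowup fan $\mathcal F_{r,t}$ ($t\ge r$): take $t$ vertex-disjoint copies $\mathcal F_r^1,\dots,\mathcal F_r^t$ of $\mathcal F_r$, the transversal vertices of the $i$th being $t_1^i,\dots,t_r^i$. The edges of $\mathcal F_{r,t}$ are all edges of $\mathcal F_r^1,\dots,\mathcal F_r^t$, together with all sets $\{t_1^{i_1},t_2^{i_2},\dots,t_r^{i_r}\}$ with $(i_1,\dots,i_r)\in[t]^r$ and $|\{i_1,\dots,i_r\}|\ge2$. $\mathcal T_r^{(r)}(m)$ is the complete balanced $r$-partite $r$-graph on $m$ vertices (part sizes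 differ by at most one, edges are all $r$-sets with one vertex in each part), and $t_r^{(r)}(m)$ is its number of edges. $\mathcal J_s(n)$ is the $n$-vertex $r$-graph obtained from $\mathcal T_r^{(r)}(n-s)$ by adding a set $S$ of $s$ new vertices and all $r$-subsets of the $n$ vertices that meet $S$. *)

theory Defs
  imports Complex_Main
begin

datatype 'a hypergraph = Hypergraph (verts: "'a set") (edges: "'a set set")

definition r_graph :: "nat \<Rightarrow> 'a hypergraph \<Rightarrow> bool" where
  "r_graph r H \<longleftrightarrow> finite (verts H) \<and> (\<forall>e\<in>edges H. e \<subseteq> verts H \<and> card e = r)"

text \<open>A copy need not be induced: only edges have to be mapped to edges.\<close>

definition contains_copy :: "'a hypergraph \<Rightarrow> 'b hypergraph \<Rightarrow> bool" where
  "contains_copy H F \<longleftrightarrow>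
     (\<exists>f. inj_on f (verts F) \<and> f ` verts F \<subseteq> verts H \<and> (\<forall>e\<in>edges F. f ` e \<in> edges H))"

definition hg_iso :: "'a hypergraph \<Rightarrow> 'b hypergraph \<Rightarrow> bool" where
  "hg_iso G H \<longleftrightarrow> (\<exists>f. bij_betw f (verts G) (verts H) \<and> (\<lambda>e. f ` e) ` edges G = edges H)"

definition free_graph :: "nat \<Rightarrow> nat \<Rightarrow> 'b hypergraph \<Rightarrow> 'a hypergraph \<Rightarrow> bool" where
  "free_graph r n F H \<longleftrightarrow> r_graph r H \<and> card (verts H) = n \<and> \<not> contains_copy H F"

text \<open>Every finite hypergraph is isomorphic to one on natural numbers, so natural numbers suffice
  as vertices here. The set is bounded by \<open>n choose r\<close>, and it is nonempty
  as soon as \<open>F\<close> has an edge.\<close>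

definition ex_number :: "nat \<Rightarrow> nat \<Rightarrow> 'b hypergraph \<Rightarrow> nat" where
  "ex_number r n F = Max {card (edges H) | H :: nat hypergraph. free_graph r n F H}"

definition extremal :: "nat \<Rightarrow> nat \<Rightarrow> 'b hypergraph \<Rightarrow> 'a hypergraph \<Rightarrow> bool" where
  "extremal r n F H \<longleftrightarrow> free_graph r n F H \<and> card (edges H) = ex_number r n F"

text \<open>The vertices of the fan: the centre \<open>c\<close>, the transversal vertices \<open>t\<^sub>i\<close>, and the elements
  \<open>Petal i k\<close> (\<open>k < r - 2\<close>) of \<open>A\<^sub>i\<close>. Indices start at 0.\<close>

datatype fan_vertex = Centre | Transv nat | Petal nat nat

definition petal_set :: "nat \<Rightarrow> nat \<Rightarrow> fan_vertex set" where
  "petal_set r i = Petal i ` {..<r - 2}"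

definition fan :: "nat \<Rightarrow> fan_vertex hypergraph" where
  "fan r = Hypergraph
     ({Centre} \<union> Transv ` {..<r} \<union> (\<Union>i<r. petal_set r i))
     (insert (Transv ` {..<r}) ((\<lambda>i. {Centre, Transv i} \<union> petal_set r i) ` {..<r}))"

text \<open>The vertex \<open>(i, v)\<close> is the vertex \<open>v\<close> of the \<open>i\<close>th copy of the fan; \<open>\<iota>\<close> selects
  for each \<open>j\<close> the copy from which the \<open>j\<close>th transversal vertex is taken.\<close>

definition semi_blowup_fan :: "nat \<Rightarrow> nat \<Rightarrow> (nat \<times> fan_vertex) hypergraph" where
  "semi_blowup_fan r t = Hypergraph
     ({..<t} \<times> verts (fan r))
     ({Pair i ` e | i e. i < t \<and> e \<in> edges (fan r)} \<union>
      {(\<lambda>j. (\<iota> j, Transv j)) ` {..<r} | \<iota>. \<iota> ` {..<r} \<subseteq> {..<t} \<and> 2 \<le> card (\<iota> ` {..<r})})"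

text \<open>The parts of the complete balanced \<open>r\<close>-partite \<open>r\<close>-graph on \<open>{..<m}\<close> are the residue
  classes modulo \<open>r\<close>.\<close>

definition part :: "nat \<Rightarrow> nat \<Rightarrow> nat \<Rightarrow> nat set" where
  "part r m i = {v. v < m \<and> v mod r = i}"

lemma part_balanced:
  assumes "i < r" "j < r"
  shows "card (part r m i) \<le> card (part r m j) + 1"
proof -
  have bounds: "m div r \<le> card (part r m k) \<and> card (part r m k) \<le> m div r + 1" if "k < r" for k
  proof -
    let ?f = "\<lambda>q. q * r + k"
    have inj: "inj ?f" using that by (auto simp: inj_on_def)
    have lower: "?f ` {..<m div r} \<subseteq> part r m k"
    proof clarify
      fix q assume "q < m div r"
      then have "(q + 1) * r \<le> m div r * r" by (intro mult_right_mono) auto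
      also have "\<dots> \<le> m" by simp
      finally show "q * r + k \<in> part r m k" using that by (auto simp: part_def)
    qed
    have upper: "part r m k \<subseteq> ?f ` {..m div r}"
    proof
      fix v assume "v \<in> part r m k"
      then have "v = ?f (v div r)" "v div r \<le> m div r"
        by (auto simp: part_def div_le_mono)
      then show "v \<in> ?f ` {..m div r}" by blast
    qed
    have fin: "finite (part r m k)" by (simp add: part_def)
    have "card (?f ` {..<m div r}) = m div r" "card (?f ` {..m div r}) = m div r + 1"
      using inj by (simp_all add: card_image inj_on_subset[OF inj])
    with card_mono[OF fin lower] card_mono[OF _ upper] show ?thesis by simp
  qed
  show ?thesis using bounds[OF assms(1)] bounds[OF assms(2)] by linarith
qed

definition turan_graph :: "nat \<Rightarrow> nat \<Rightarrow> nat hypergraph" where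
  "turan_graph r m = Hypergraph {..<m}
     {e. e \<subseteq> {..<m} \<and> card e = r \<and> (\<forall>i<r. card (e \<inter> part r m i) = 1)}"

definition turan_number :: "nat \<Rightarrow> nat \<Rightarrow> nat" where
  "turan_number r m = card (edges (turan_graph r m))"

text \<open>The added set \<open>S\<close> is \<open>{n - s..<n}\<close>; the definition is meaningful for \<open>s \<le> n\<close>.\<close>

definition joined_turan_graph :: "nat \<Rightarrow> nat \<Rightarrow> nat \<Rightarrow> nat hypergraph" where
  "joined_turan_graph r s n = Hypergraph {..<n}
     (edges (turan_graph r (n - s)) \<union>
      {e. e \<subseteq> {..<n} \<and> card e = r \<and> e \<inter> {n - s..<n} \<noteq> {}})"

end

theory Submission
  imports Defs "HOL-Library.FuncSet"
begin

text \<open>Call a pair of vertices robust if edges through it survive the deletion of any boundedly many other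
  vertices. By the partite theorem of Erdos, an \<open>\<F>\<^bsub>r,t\<^esub>\<close>-free graph has few configurations consisting of an
  edge and a further vertex forming robust pairs with all of its vertices. Choosing a vertex \<open>x\<close> of
  maximal degree and inducting on \<open>r\<close> in the link of \<open>x\<close> then yields both the asymptotic bound
  \<open>(n/r)\<^sup>r\<close> and, for dense graphs, an \<open>r\<close>-colouring for which almost all rainbow sets are edges; one takes
  such a colouring with the maximal number of rainbow edges.

  Call a vertex wild if it forms robust pairs with many vertices of every colour, or lies in many edges
  having two further vertices of the same colour. Every wild vertex, and every edge with two typical
  vertices of the same colour, can be completed greedily to a fan, and different fans can be kept disjoint with
  all mixed transversals being edges. Hence there are at most \<open>t - 1\<close> wild vertices, while each of the others contributes
  only few edges that are not rainbow. Comparing with \<open>\<J>\<^bsub>t-1\<^esub>(n)\<close> forces exactly \<open>t - 1\<close> wild vertices and no non-rainbow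
  edge that avoids them. The required minimum degree is obtained by deleting vertices of small degree.\<close>

section \<open>Complete partite families\<close>

text \<open>Freeness does not pass to links. The induction on \<open>r\<close> therefore runs for
  \<open>cliqued\<close> hypergraphs, where the only hypothesis is that few edges have a common
  neighbour of all their vertices; the link of a vertex lying in few such extensions inherits it.
  The exact part meets a circularity. A seed of a fan has to be good at a scale
  \<open>\<alpha>\<close> far below the threshold \<open>\<delta>\<close> of wildness, but a vertex
  not wild for \<open>\<delta>\<close> is only known to miss at most a constant times
  \<open>\<delta> * n ^ (r - 1)\<close> rainbow sets. Hence two thresholds, with
  \<open>\<delta>1\<close> far below \<open>\<alpha>2\<close> and \<open>\<alpha>2\<close> far below
  \<open>\<delta>2\<close>: vertices not wild for \<open>\<delta>1\<close> are good enough as seeds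
  for \<open>\<delta>2\<close>. The edges with a repeated colour that avoid the \<open>w\<close>
  vertices wild for \<open>\<delta>2\<close> must be bounded by a small multiple of
  \<open>(t - 1 - w) * n ^ (r - 1)\<close>, because the gain from enlarging the joined set from
  \<open>w\<close> to \<open>t - 1\<close> vertices carries exactly this factor; the gain has this
  order since \<open>(r - 1)! < r ^ (r - 1)\<close>. A family of edge seeds has one fixed repeated
  colour, so that the marked transversal vertices, being of one colour, form a coherent set at
  once.\<close>

text \<open>The theorem of Erdos in terms of lists: a dense set of \<open>k\<close>-tuples contains
  a box with sides of size \<open>t\<close>. Induction on \<open>k\<close>: keep constantly many
  popular first entries; a positive proportion of the tails is extended by at least \<open>t\<close>
  of them, and by pigeonhole many tails share the same \<open>t\<close> entries.\<close>

lemma kst: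
  fixes \<gamma> :: real
  assumes "\<gamma> > 0"
  shows "\<exists>N. \<forall>(V :: 'a set) A. finite V \<and> N \<le> card V \<and> A \<subseteq> {l. set l \<subseteq> V \<and> length l = k} \<and>
    \<gamma> * real (card V) ^ k \<le> real (card A) \<longrightarrow>
    (\<exists>Ts. length Ts = k \<and> (\<forall>T\<in>set Ts. T \<subseteq> V \<and> card T = t) \<and> listset Ts \<subseteq> A)"
  using assms
proof (induction k arbitrary: \<gamma>)
  case 0
  show ?case
  proof (intro exI[of _ 0] allI impI, elim conjE)
    fix V :: "'a set" and A assume "A \<subseteq> {l. set l \<subseteq> V \<and> length l = 0}" and c: "\<gamma> * real (card V) ^ 0 \<le> real (card A)"
    then have "A \<subseteq> {[]}" by auto
    moreover have "A \<noteq> {}" using c 0 by auto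
    ultimately have "A = {[]}" by blast
    then show "\<exists>Ts. length Ts = 0 \<and> (\<forall>T\<in>set Ts. T \<subseteq> V \<and> card T = t) \<and> listset Ts \<subseteq> A"
      by simp
  qed
next
  case (Suc k)
  \<comment> \<open>With \<open>m \<ge> 4 * t / \<gamma>\<close>, the tails that fewer than
    \<open>t\<close> of the \<open>m\<close> chosen entries extend account for at most half of the
    \<open>m * \<gamma> / 2 * n ^ k\<close> incidences.\<close>
  define m where "m = nat \<lceil>4 * real t / \<gamma>\<rceil> + 1"
  have m: "4 * real t / \<gamma> \<le> real m" "m > 0" unfolding m_def by linarith+
  define \<gamma>' where "\<gamma>' = \<gamma> / (4 * 2 ^ m)"
  have "\<gamma>' > 0" using Suc.prems by (simp add: \<gamma>'_def)
  from Suc.IH[OF this] obtain N' where N': "\<And>(V :: 'a set) A. finite V \<Longrightarrow> N' \<le> card V \<Longrightarrow>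
      A \<subseteq> {l. set l \<subseteq> V \<and> length l = k} \<Longrightarrow> \<gamma>' * real (card V) ^ k \<le> real (card A) \<Longrightarrow>
    (\<exists>Ts. length Ts = k \<and> (\<forall>T\<in>set Ts. T \<subseteq> V \<and> card T = t) \<and> listset Ts \<subseteq> A)"
    by meson
  define N where "N = max N' (nat \<lceil>2 * real m / \<gamma>\<rceil> + 1)"
  show ?case
  proof (intro exI[of _ N] allI impI, elim conjE)
    fix V :: "'a set" and A
    assume fV: "finite V" and NV: "N \<le> card V" and A: "A \<subseteq> {l. set l \<subseteq> V \<and> length l = Suc k}"
      and c: "\<gamma> * real (card V) ^ Suc k \<le> real (card A)"
    define n where "n = card V"
    have n: "N' \<le> n" "n > 0" "2 * real m / \<gamma> \<le> real n"
      using NV unfolding N_def n_def by linarith+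
    define L where "L = {l. set l \<subseteq> V \<and> length l = k}"
    have fL: "finite L" and cL: "card L = n ^ k"
      unfolding L_def n_def using fV by (auto simp: finite_lists_length_eq card_lists_length_eq)
    define D where "D a = {l\<in>L. a # l \<in> A}" for a
    have fD: "finite (D a)" for a using fL by (simp add: D_def)
    have cD: "real (card (D a)) \<le> real n ^ k" for a
      using card_mono[OF fL, of "D a"] cL by (auto simp: D_def simp flip: of_nat_power)
    have "A = (\<Union>a\<in>V. (#) a ` D a)"
    proof
      show "A \<subseteq> (\<Union>a\<in>V. (#) a ` D a)"
      proof
        fix l assume l: "l \<in> A"
        then obtain a l' where al: "l = a # l'" using A by (cases l) auto
        have "l \<in> {l. set l \<subseteq> V \<and> length l = Suc k}" using l A by blast
        then have "a \<in> V" "l' \<in> D a" using l al by (auto simp: D_def L_def)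
        then show "l \<in> (\<Union>a\<in>V. (#) a ` D a)" using al by blast
      qed
    qed (auto simp: D_def)
    then have "card A \<le> (\<Sum>a\<in>V. card ((#) a ` D a))" using card_UN_le[OF fV, of "\<lambda>a. (#) a ` D a"] by simp
    also have "\<dots> = (\<Sum>a\<in>V. card (D a))" by (intro sum.cong refl card_image) auto
    finally have cA: "real (card A) \<le> (\<Sum>a\<in>V. real (card (D a)))"
      by (metis of_nat_le_iff of_nat_sum)
    define B where "B = {a\<in>V. \<gamma> / 2 * real n ^ k \<le> real (card (D a))}"
    have fB: "finite B" using fV by (simp add: B_def)
    have "(\<Sum>a\<in>V. real (card (D a))) \<le> (\<Sum>a\<in>V. (if a \<in> B then real n ^ k else 0) + \<gamma> / 2 * real n ^ k)"
      using cD Suc.prems by (intro sum_mono) (auto simp: B_def add_increasing2)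
    also have "\<dots> = real (card B) * real n ^ k + real n * (\<gamma> / 2 * real n ^ k)"
      using fV by (simp add: sum.distrib n_def sum.If_cases) (simp add: B_def Int_def conj_commute)
    finally have "\<gamma> * real n * real n ^ k \<le> real (card B) * real n ^ k + \<gamma> / 2 * real n * real n ^ k"
      using c cA by (simp add: n_def field_simps)
    then have "(\<gamma> * real n) * real n ^ k \<le> (real (card B) + \<gamma> / 2 * real n) * real n ^ k"
      by (simp add: algebra_simps)
    then have "\<gamma> * real n \<le> real (card B) + \<gamma> / 2 * real n"
      using n by (simp only: mult_le_cancel_right) auto
    moreover have "real m \<le> \<gamma> / 2 * real n" using n(3) Suc.prems by (simp add: field_simps)
    ultimately have "m \<le> card B" by linarith
    \<comment> \<open>Linearly many popular entries exist, but only \<open>m\<close> are kept: the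
      number of their \<open>t\<close>-subsets then stays below \<open>2 ^ m\<close>, independently
      of \<open>n\<close>, which pays for the pigeonhole step.\<close>
    then obtain M where M: "M \<subseteq> B" "card M = m" by (meson obtain_subset_with_card_n)
    have fM: "finite M" using M fB finite_subset by blast
    define R where "R = {l\<in>L. t \<le> card {a\<in>M. a # l \<in> A}}"
    have fR: "finite R" using fL by (simp add: R_def)
    have "real m * (\<gamma> / 2 * real n ^ k) = (\<Sum>a\<in>M. \<gamma> / 2 * real n ^ k)" using M by simp
    also have "\<dots> \<le> (\<Sum>a\<in>M. real (card (D a)))" using M by (intro sum_mono) (auto simp: B_def)
    also have "\<dots> = (\<Sum>a\<in>M. \<Sum>l\<in>L. if a # l \<in> A then 1 else 0)"
      using fL by (intro sum.cong refl) (simp add: D_def sum.If_cases Int_def)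
    also have "\<dots> = (\<Sum>l\<in>L. \<Sum>a\<in>M. if a # l \<in> A then 1 else 0)" by (rule sum.swap)
    also have "\<dots> = (\<Sum>l\<in>L. real (card {a\<in>M. a # l \<in> A}))"
      using fM by (intro sum.cong refl) (simp add: sum.If_cases Int_def)
    also have "\<dots> \<le> (\<Sum>l\<in>L. (if l \<in> R then real m else 0) + real t)"
    proof (intro sum_mono)
      fix l assume l: "l \<in> L"
      have "card {a\<in>M. a # l \<in> A} \<le> m" using card_mono[OF fM, of "{a\<in>M. a # l \<in> A}"] M by auto
      then show "real (card {a\<in>M. a # l \<in> A}) \<le> (if l \<in> R then real m else 0) + real t"
        using l by (auto simp: R_def)
    qed
    also have "\<dots> = real m * real (card R) + real t * real n ^ k"
      using fL cL by (simp add: sum.distrib sum.If_cases) (simp add: R_def Int_def conj_commute)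
    finally have "real m * (\<gamma> / 2 * real n ^ k) \<le> real m * real (card R) + real t * real n ^ k" .
    moreover have "real t * real n ^ k \<le> (real m * \<gamma> / 4) * real n ^ k"
      using m(1) Suc.prems by (intro mult_right_mono) (auto simp: field_simps)
    ultimately have "real m * (\<gamma> / 4 * real n ^ k) \<le> real m * real (card R)" by (simp add: field_simps)
    then have cR: "\<gamma> / 4 * real n ^ k \<le> real (card R)" using m by simp
    define \<T> where "\<T> = {T. T \<subseteq> M \<and> card T = t}"
    have fT: "finite \<T>" using fM by (simp add: \<T>_def)
    have "\<T> \<subseteq> Pow M" by (auto simp: \<T>_def)
    then have cT: "card \<T> \<le> 2 ^ m" using card_mono[of "Pow M" \<T>] fM M by (simp add: card_Pow)
    define Q where "Q T = {l\<in>L. \<forall>a\<in>T. a # l \<in> A}" for T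
    have "R \<subseteq> (\<Union>T\<in>\<T>. Q T)"
    proof
      fix l assume l: "l \<in> R"
      then obtain T where "T \<subseteq> {a\<in>M. a # l \<in> A}" "card T = t"
        unfolding R_def by (metis (mono_tags, lifting) mem_Collect_eq obtain_subset_with_card_n)
      then have "T \<in> \<T>" "l \<in> Q T" using l by (auto simp: \<T>_def Q_def R_def)
      then show "l \<in> (\<Union>T\<in>\<T>. Q T)" by blast
    qed
    moreover have "finite (Q T)" for T using fL by (simp add: Q_def)
    ultimately have "card R \<le> card (\<Union>T\<in>\<T>. Q T)" using fT by (intro card_mono) auto
    also have "\<dots> \<le> (\<Sum>T\<in>\<T>. card (Q T))" using fT by (rule card_UN_le)
    finally have "card R \<le> (\<Sum>T\<in>\<T>. card (Q T))" .
    then have cRQ: "real (card R) \<le> (\<Sum>T\<in>\<T>. real (card (Q T)))" by (metis of_nat_le_iff of_nat_sum)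
    have "\<exists>T\<in>\<T>. \<gamma>' * real n ^ k \<le> real (card (Q T))"
    proof (rule ccontr)
      assume *: "\<not> ?thesis"
      have "0 < \<gamma> / 4 * real n ^ k" using Suc.prems n by simp
      then have "\<T> \<noteq> {}" using cRQ cR by auto
      then have "(\<Sum>T\<in>\<T>. real (card (Q T))) < (\<Sum>T\<in>\<T>. \<gamma>' * real n ^ k)"
        using * fT by (intro sum_strict_mono) auto
      also have "\<dots> = real (card \<T>) * (\<gamma>' * real n ^ k)" by simp
      also have "real (card \<T>) \<le> real (2 ^ m)" using cT by (simp only: of_nat_le_iff)
      then have "real (card \<T>) * (\<gamma>' * real n ^ k) \<le> 2 ^ m * (\<gamma>' * real n ^ k)" using \<open>\<gamma>' > 0\<close>
        by (intro mult_right_mono) auto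
      also have "\<dots> = \<gamma> / 4 * real n ^ k" by (simp add: \<gamma>'_def)
      finally show False using cR cRQ by linarith
    qed
    then obtain T where T: "T \<in> \<T>" "\<gamma>' * real n ^ k \<le> real (card (Q T))" by blast
    have "Q T \<subseteq> {l. set l \<subseteq> V \<and> length l = k}" by (auto simp: Q_def L_def)
    then obtain Ts where Ts: "length Ts = k" "\<forall>T\<in>set Ts. T \<subseteq> V \<and> card T = t" "listset Ts \<subseteq> Q T"
      using N'[OF fV _ _ , of "Q T", folded n_def] n(1) T(2) by blast
    have "listset (T # Ts) \<subseteq> A" using Ts(3) by (auto simp: set_Cons_def Q_def)
    moreover have "T \<subseteq> V" "card T = t" using T(1) M(1) by (auto simp: \<T>_def B_def)
    ultimately show "\<exists>Ts. length Ts = Suc k \<and> (\<forall>T\<in>set Ts. T \<subseteq> V \<and> card T = t) \<and> listset Ts \<subseteq> A"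
      using Ts by (intro exI[of _ "T # Ts"]) auto
  qed
qed

section \<open>Rainbow sets and clique hypergraphs\<close>

text \<open>AM-GM from \<open>1 + x \<le> exp x\<close> at \<open>x = a j / s - 1\<close> with
  \<open>s\<close> the mean: these exponents sum to zero.\<close>

lemma prod_le_mean_power:
  fixes a :: "'i \<Rightarrow> real"
  assumes "finite J" "J \<noteq> {}" "\<And>j. j \<in> J \<Longrightarrow> 0 \<le> a j"
  shows "prod a J \<le> (sum a J / card J) ^ card J"
proof (cases "sum a J = 0")
  case True
  then have "\<forall>j\<in>J. a j = 0" using assms by (simp add: sum_nonneg_eq_0_iff)
  then show ?thesis using assms True by (auto simp: card_gt_0_iff prod_zero_iff intro!: bexI)
next
  case False
  define s where "s = sum a J / card J"
  have "sum a J > 0" using False assms by (simp add: sum_nonneg order_less_le)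
  then have s: "s > 0" using assms by (simp add: s_def card_gt_0_iff)
  have "prod a J \<le> (\<Prod>j\<in>J. s * exp (a j / s - 1))"
  proof (intro prod_mono conjI)
    fix j assume j: "j \<in> J"
    have "a j / s \<le> exp (a j / s - 1)" using exp_ge_add_one_self[of "a j / s - 1"] by simp
    then show "a j \<le> s * exp (a j / s - 1)" using s by (simp add: field_simps)
  qed (use assms in auto)
  also have "\<dots> = s ^ card J * exp (\<Sum>j\<in>J. a j / s - 1)"
    using assms by (simp add: prod.distrib exp_sum)
  also have "(\<Sum>j\<in>J. a j / s - 1) = 0"
  proof -
    have "(\<Sum>j\<in>J. a j / s) = card J" using \<open>sum a J > 0\<close> by (simp add: s_def flip: sum_divide_distrib sum_distrib_right)
    then show ?thesis by (simp add: sum_subtractf)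
  qed
  finally show ?thesis by (simp add: s_def)
qed

lemma card_subsets_le: "finite V \<Longrightarrow> card {e. e \<subseteq> V \<and> card e = k} \<le> card V ^ k"
  by (cases "k \<le> card V") (simp_all add: n_subsets binomial_le_pow binomial_eq_0)

lemma card_edges_containing:
  assumes "finite V" "\<And>e. e \<in> E \<Longrightarrow> e \<subseteq> V \<and> card e = r" "S \<subseteq> V"
  shows "card {e \<in> E. S \<subseteq> e} \<le> card V ^ (r - card S)"
proof -
  have fS: "finite S" using assms finite_subset by blast
  have "card {e \<in> E. S \<subseteq> e} \<le> card {f. f \<subseteq> V \<and> card f = r - card S}"
  proof (rule card_inj_on_le)
    show "inj_on (\<lambda>e. e - S) {e \<in> E. S \<subseteq> e}" by (auto simp: inj_on_def)
    show "(\<lambda>e. e - S) ` {e \<in> E. S \<subseteq> e} \<subseteq> {f. f \<subseteq> V \<and> card f = r - card S}"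
      using assms fS by (auto simp: card_Diff_subset)
    show "finite {f. f \<subseteq> V \<and> card f = r - card S}" using assms by simp
  qed
  then show ?thesis using card_subsets_le[OF assms(1)] order_trans by blast
qed

text \<open>The colour set \<open>J\<close> is a parameter because removing a vertex from a rainbow
  set leaves one for \<open>J\<close> without its colour; counting goes by this recursion.\<close>

definition rainbow :: "'a set \<Rightarrow> ('a \<Rightarrow> 'c) \<Rightarrow> 'c set \<Rightarrow> 'a set set" where
  "rainbow V p J = {T. T \<subseteq> V \<and> inj_on p T \<and> p ` T = J}"

lemma finite_rainbow: "finite V \<Longrightarrow> finite (rainbow V p J)"
  by (rule finite_subset[of _ "Pow V"]) (auto simp: rainbow_def)

lemma rainbow_card: "T \<in> rainbow V p J \<Longrightarrow> card T = card J"
  by (auto simp: rainbow_def card_image)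

lemma rainbowI:
  assumes "T \<subseteq> V" "inj_on p T" "p ` T \<subseteq> J" "finite J" "card T = card J"
  shows "T \<in> rainbow V p J"
  using assms card_subset_eq[of J "p ` T"] by (auto simp: rainbow_def card_image)

lemma rainbow_containing_bij:
  assumes "v \<in> V" "p v \<in> J"
  shows "bij_betw (\<lambda>T. T - {v}) {T \<in> rainbow V p J. v \<in> T} (rainbow V p (J - {p v}))"
proof (rule bij_betwI[where g = "insert v"])
  show "(\<lambda>T. T - {v}) \<in> {T \<in> rainbow V p J. v \<in> T} \<rightarrow> rainbow V p (J - {p v})"
    by (auto simp: rainbow_def inj_on_def)
  show "insert v \<in> rainbow V p (J - {p v}) \<rightarrow> {T \<in> rainbow V p J. v \<in> T}"
  proof
    fix T assume "T \<in> rainbow V p (J - {p v})"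
    then have T: "T \<subseteq> V" "inj_on p T" "p ` T = J - {p v}" by (auto simp: rainbow_def)
    then have "p v \<notin> p ` T" by simp
    then show "insert v T \<in> {T \<in> rainbow V p J. v \<in> T}"
      using T assms by (auto simp: rainbow_def)
  qed
next
  fix T assume "T \<in> rainbow V p (J - {p v})"
  then have "v \<notin> T" by (auto simp: rainbow_def)
  then show "insert v T - {v} = T" by auto
qed auto

lemma card_rainbow:
  assumes "finite V" "finite J"
  shows "card (rainbow V p J) = (\<Prod>j\<in>J. card {v\<in>V. p v = j})"
  using assms(2)
proof (induction J)
  case empty
  have "rainbow V p {} = {{}}" by (auto simp: rainbow_def)
  then show ?case by simp
next
  case (insert j J)
  let ?C = "{v\<in>V. p v = j}"
  have "\<exists>v\<in>?C. v \<in> T" if "T \<in> rainbow V p (insert j J)" for T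
  proof -
    have "j \<in> p ` T" "T \<subseteq> V" using that by (auto simp: rainbow_def)
    then show ?thesis by auto
  qed
  then have "rainbow V p (insert j J) = (\<Union>v\<in>?C. {T \<in> rainbow V p (insert j J). v \<in> T})"
    by blast
  also have "card \<dots> = (\<Sum>v\<in>?C. card {T \<in> rainbow V p (insert j J). v \<in> T})"
    using assms(1) by (intro card_UN_disjoint) (auto simp: finite_rainbow, auto simp: rainbow_def inj_on_def)
  also have "\<dots> = (\<Sum>v\<in>?C. card (rainbow V p J))"
  proof (intro sum.cong refl)
    fix v assume v: "v \<in> ?C"
    then show "card {T \<in> rainbow V p (insert j J). v \<in> T} = card (rainbow V p J)"
      using bij_betw_same_card[OF rainbow_containing_bij[of v V p "insert j J"]] insert(2) by simp
  qed
  finally show ?case using insert by simp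
qed

lemma card_rainbow_containing:
  assumes "finite V" "finite J" "v \<in> V" "p v \<in> J"
  shows "card {T \<in> rainbow V p J. v \<in> T} = (\<Prod>j\<in>J - {p v}. card {v\<in>V. p v = j})"
  using bij_betw_same_card[OF rainbow_containing_bij[of v V p J]] assms by (simp add: card_rainbow)

text \<open>Every rainbow set has exactly one vertex in the class of \<open>v\<close>, and all
  vertices of that class lie in equally many of them.\<close>

lemma card_rainbow_split:
  assumes "finite V" "finite J" "v \<in> V" "p v \<in> J"
  shows "card {u\<in>V. p u = p v} * card {T \<in> rainbow V p J. v \<in> T} = card (rainbow V p J)"
  using assms by (simp add: card_rainbow_containing card_rainbow prod.remove[of J "p v"])

lemma card_rainbow_le:
  assumes "finite V" "k > 0" "\<And>v. v \<in> V \<Longrightarrow> p v < k"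
  shows "real (card (rainbow V p {..<k})) \<le> (real (card V) / k) ^ k"
proof -
  have "V = (\<Union>j<k. {v\<in>V. p v = j})" using assms by auto
  also have "card \<dots> = (\<Sum>j<k. card {v\<in>V. p v = j})"
    using assms by (intro card_UN_disjoint) auto
  finally have "real (card V) = (\<Sum>j<k. real (card {v\<in>V. p v = j}))" by (metis of_nat_sum)
  then show ?thesis
    using prod_le_mean_power[of "{..<k}" "\<lambda>j. real (card {v\<in>V. p v = j})"] assms
    by (simp add: card_rainbow lessThan_empty_iff)
qed

lemma sum_if_card: "finite A \<Longrightarrow> (\<Sum>a\<in>A. if P a then 1 else 0) = card {a\<in>A. P a}"
  by (simp add: sum.inter_filter[symmetric])

lemma sum_card_swap:
  assumes "finite A" "finite B"
  shows "(\<Sum>a\<in>A. card {b\<in>B. P a b}) = (\<Sum>b\<in>B. card {a\<in>A. P a b})"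
proof -
  have "(\<Sum>a\<in>A. card {b\<in>B. P a b}) = (\<Sum>a\<in>A. \<Sum>b\<in>B. if P a b then 1 else 0)"
    using assms by (simp add: sum_if_card)
  also have "\<dots> = (\<Sum>b\<in>B. \<Sum>a\<in>A. if P a b then 1 else 0)" by (rule sum.swap)
  also have "\<dots> = (\<Sum>b\<in>B. card {a\<in>A. P a b})"
    using assms by (simp add: sum_if_card)
  finally show ?thesis .
qed

section \<open>Hypergraphs of cliques, their extensions and their links\<close>

text \<open>Abstracts from robust pairs: in a link the graph \<open>G\<close> stays the same and is
  only restricted to a neighbourhood, so robustness never has to be re-established in a smaller
  hypergraph.\<close>

definition cliqued :: "nat \<Rightarrow> 'a set \<Rightarrow> ('a \<Rightarrow> 'a \<Rightarrow> bool) \<Rightarrow> 'a set set \<Rightarrow> bool" where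
  "cliqued k V G L \<longleftrightarrow> finite V \<and> (\<forall>x y. G x y \<longrightarrow> G y x) \<and> (\<forall>x. \<not> G x x) \<and>
     (\<forall>e\<in>L. e \<subseteq> V \<and> card e = k \<and> (\<forall>x\<in>e. \<forall>y\<in>e. x \<noteq> y \<longrightarrow> G x y))"

text \<open>The remnant of the fan: \<open>c\<close> plays the centre and \<open>e\<close> the
  transversal edge, with the petals replaced by adjacency in \<open>G\<close>.\<close>

definition extensions :: "'a set \<Rightarrow> ('a \<Rightarrow> 'a \<Rightarrow> bool) \<Rightarrow> 'a set set \<Rightarrow> ('a set \<times> 'a) set" where
  "extensions V G L = {(e, c). e \<in> L \<and> c \<in> V \<and> (\<forall>x\<in>e. G x c)}"

lemma cliquedD:
  assumes "cliqued k V G L"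
  shows "finite V" "G x y \<Longrightarrow> G y x" "\<not> G x x" "e \<in> L \<Longrightarrow> e \<subseteq> V" "e \<in> L \<Longrightarrow> card e = k"
    "e \<in> L \<Longrightarrow> x \<in> e \<Longrightarrow> y \<in> e \<Longrightarrow> x \<noteq> y \<Longrightarrow> G x y" "finite L" "finite (extensions V G L)"
proof -
  show f: "finite V" using assms by (simp add: cliqued_def)
  have "L \<subseteq> Pow V" using assms by (auto simp: cliqued_def)
  then show "finite L" using f finite_subset by blast
  with f show "finite (extensions V G L)"
    by (rule_tac finite_subset[of _ "L \<times> V"]) (auto simp: extensions_def)
qed (use assms in \<open>unfold cliqued_def, blast+\<close>)

definition nbhd :: "'a set \<Rightarrow> ('a \<Rightarrow> 'a \<Rightarrow> bool) \<Rightarrow> 'a \<Rightarrow> 'a set" where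
  "nbhd V G x = {y\<in>V. G x y}"

definition link :: "'a set set \<Rightarrow> 'a \<Rightarrow> 'a set set" where
  "link L x = {f. x \<notin> f \<and> insert x f \<in> L}"

lemma card_link: "card (link L x) = card {e\<in>L. x \<in> e}"
proof (rule bij_betw_same_card, rule bij_betwI[where g = "\<lambda>e. e - {x}"])
  show "insert x \<in> link L x \<rightarrow> {e\<in>L. x \<in> e}" by (auto simp: link_def)
  show "(\<lambda>e. e - {x}) \<in> {e\<in>L. x \<in> e} \<rightarrow> link L x" by (auto simp: link_def insert_absorb)
qed (auto simp: link_def)

lemma cliqued_link:
  assumes "cliqued (Suc k) V G L"
  shows "cliqued k (nbhd V G x) G (link L x)"
proof -
  note D = cliquedD[OF assms]
  have "f \<subseteq> nbhd V G x \<and> card f = k \<and> (\<forall>u\<in>f. \<forall>y\<in>f. u \<noteq> y \<longrightarrow> G u y)" if "f \<in> link L x" for f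
  proof -
    have i: "insert x f \<in> L" "x \<notin> f" using that by (auto simp: link_def)
    have f: "f \<subseteq> V" using D(4)[OF i(1)] by simp
    then have "finite f" using D(1) by (rule finite_subset)
    then have "card f = k" using D(5)[OF i(1)] i(2) by simp
    moreover have "G x u" if "u \<in> f" for u using D(6)[OF i(1), of x u] that i(2) by auto
    moreover have "G u y" if "u \<in> f" "y \<in> f" "u \<noteq> y" for u y using D(6)[OF i(1), of u y] that by auto
    ultimately show ?thesis using f by (auto simp: nbhd_def)
  qed
  moreover have "finite (nbhd V G x)" using D(1) by (simp add: nbhd_def)
  moreover have "\<forall>x y. G x y \<longrightarrow> G y x" "\<forall>x. \<not> G x x" using D(2,3) by blast+
  ultimately show ?thesis unfolding cliqued_def by blast
qed

text \<open>A common neighbour \<open>c\<close> of the link edge \<open>f\<close> that lies in the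
  neighbourhood of \<open>x\<close> is also adjacent to \<open>x\<close>, hence extends
  \<open>insert x f\<close>.\<close>

lemma card_extensions_link:
  assumes "cliqued (Suc k) V G L"
  shows "card (extensions (nbhd V G x) G (link L x)) \<le> card {(e, c)\<in>extensions V G L. x \<in> e}"
proof (rule card_inj_on_le)
  show "inj_on (\<lambda>(f, c). (insert x f, c)) (extensions (nbhd V G x) G (link L x))"
  proof (rule inj_on_inverseI[where g = "\<lambda>(e, c). (e - {x}, c)"])
    fix z assume z: "z \<in> extensions (nbhd V G x) G (link L x)"
    obtain f c where fc: "z = (f, c)" by (cases z)
    have "x \<notin> f" using z unfolding fc extensions_def link_def by blast
    then show "(\<lambda>(e, c). (e - {x}, c)) ((\<lambda>(f, c). (insert x f, c)) z) = z" by (simp add: fc)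
  qed
  show "(\<lambda>(f, c). (insert x f, c)) ` extensions (nbhd V G x) G (link L x) \<subseteq> {(e, c)\<in>extensions V G L. x \<in> e}"
    by (auto simp: extensions_def link_def nbhd_def)
  show "finite {(e, c)\<in>extensions V G L. x \<in> e}"
    using cliquedD(8)[OF assms] by (rule rev_finite_subset) auto
qed

text \<open>Each edge that avoids the non-neighbourhood of \<open>x\<close> extends by \<open>x\<close>.\<close>

lemma degree_sum_bound:
  assumes c: "cliqued k V G L" and x: "x \<in> V"
  shows "card L + card {e\<in>L. 2 \<le> card (e - nbhd V G x)} \<le>
    (\<Sum>y\<in>V - nbhd V G x. card {e\<in>L. y \<in> e}) + card {(e, c)\<in>extensions V G L. c = x}"
proof -
  note D = cliquedD[OF c]
  let ?B = "V - nbhd V G x"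
  have "card {e\<in>L. e - nbhd V G x = {}} \<le> card {(e, c)\<in>extensions V G L. c = x}"
  proof (rule card_inj_on_le[where f = "\<lambda>e. (e, x)"])
    show "(\<lambda>e. (e, x)) ` {e\<in>L. e - nbhd V G x = {}} \<subseteq> {(e, c)\<in>extensions V G L. c = x}"
    proof clarify
      fix e assume e: "e \<in> L" "e - nbhd V G x = {}"
      have "G u x" if "u \<in> e" for u
        using e that by (auto simp: nbhd_def intro!: D(2)[of x])
      then show "(e, x) \<in> extensions V G L \<and> x = x" using e x by (simp add: extensions_def)
    qed
    show "finite {(e, c)\<in>extensions V G L. c = x}" using D(8) by (rule rev_finite_subset) auto
  qed (auto simp: inj_on_def)
  moreover have "(\<Sum>y\<in>?B. card {e\<in>L. y \<in> e}) = (\<Sum>e\<in>L. card {y\<in>?B. y \<in> e})"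
    using D(1,7) by (intro sum_card_swap) auto
  \<comment> \<open>The degree sum over the non-neighbours counts an edge once per vertex outside
    the neighbourhood: not at all if it is extended by \<open>x\<close>, and at least twice if two
    vertices lie outside. The second kind is what the extra term on the left records.\<close>
  moreover have "(\<Sum>e\<in>L. (if 2 \<le> card (e - nbhd V G x) then 1 else 0) + (1::nat)) \<le>
      (\<Sum>e\<in>L. card {y\<in>?B. y \<in> e} + (if e - nbhd V G x = {} then 1 else 0))"
  proof (intro sum_mono)
    fix e assume e: "e \<in> L"
    define F where "F = e - nbhd V G x"
    have 1: "{y\<in>?B. y \<in> e} = F" using D(4)[OF e] by (auto simp: F_def)
    have 2: "finite F" using D(4)[OF e] D(1) finite_subset by (auto simp: F_def)
    show "(if 2 \<le> card (e - nbhd V G x) then 1 else 0) + (1::nat) \<le>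
      card {y\<in>?B. y \<in> e} + (if e - nbhd V G x = {} then 1 else 0)"
      unfolding 1 F_def[symmetric] using 2 by (cases "F = {}") (simp_all add: Suc_le_eq card_gt_0_iff)
  qed
  moreover have "(\<Sum>e\<in>L. (if 2 \<le> card (e - nbhd V G x) then 1 else 0) + (1::nat)) =
      card {e\<in>L. 2 \<le> card (e - nbhd V G x)} + card L"
    using D(7) by (simp only: sum.distrib sum_if_card) simp
  moreover have "(\<Sum>e\<in>L. card {y\<in>?B. y \<in> e} + (if e - nbhd V G x = {} then 1 else 0)) =
     (\<Sum>e\<in>L. card {y\<in>?B. y \<in> e}) + card {e\<in>L. e - nbhd V G x = {}}"
    using D(7) by (simp only: sum.distrib sum_if_card)
  ultimately show ?thesis by linarith
qed

text \<open>A swapping argument. For an adjacent pair \<open>z\<close>, \<open>z'\<close> of equal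
  colour and a rainbow \<open>f\<close> through \<open>z\<close>, replacing \<open>z\<close> by
  \<open>z'\<close> gives another rainbow set. If both are in the link, then \<open>z'\<close> is
  adjacent to every vertex of \<open>insert x f\<close>, which is an extension through
  \<open>x\<close>; otherwise a rainbow set is missing from the link. Both events are rare.\<close>

lemma monochromatic_pairs_bound:
  assumes cl: "cliqued (Suc k) V G L" and p: "\<And>v. v \<in> nbhd V G x \<Longrightarrow> p v < k"
  defines "U \<equiv> nbhd V G x"
  defines "E \<equiv> {(z, z'). z \<in> U \<and> z' \<in> U \<and> G z z' \<and> p z = p z'}"
  defines "F \<equiv> rainbow U p {..<k}"
  shows "card E * card F \<le>
    card U * (card {(e, c)\<in>extensions V G L. x \<in> e} + 2 * card U * card (F - link L x))"
proof -
  note D = cliquedD[OF cl]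
  have fU: "finite U" using D(1) by (simp add: U_def nbhd_def)
  have fE: "finite E" by (rule finite_subset[of _ "U \<times> U"]) (use fU in \<open>auto simp: E_def\<close>)
  have fF: "finite F" unfolding F_def by (rule finite_rainbow[OF fU])
  have FD: "f \<subseteq> U" "inj_on p f" "p ` f = {..<k}" if "f \<in> F" for f
    using that by (auto simp: F_def rainbow_def)
  have ED: "z \<in> U" "z' \<in> U" "G z z'" "p z = p z'" if "(z, z') \<in> E" for z z'
    using that by (auto simp: E_def)
  have inj: "z = w" if "f \<in> F" "z \<in> f" "w \<in> f" "p z = p w" for f z w
    using FD(2)[OF that(1)] that by (auto dest: inj_onD)
  define sw where "sw f z z' = insert z' (f - {z})" for f and z z' :: 'a
  have swF: "sw f z z' \<in> F" if "(z, z') \<in> E" "f \<in> F" "z \<in> f" for f z z'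
  proof -
    have n: "p z' \<notin> p ` (f - {z})" using inj[OF that(2) that(3)] ED[OF that(1)] by auto
    have "p ` sw f z z' = p ` f"
      using ED(4)[OF that(1)] that(3) unfolding sw_def by (metis image_insert insert_Diff)
    moreover have "inj_on p (sw f z z')"
      using FD(2)[OF that(2)] n by (auto simp: sw_def inj_on_insert inj_on_diff)
    ultimately show ?thesis
      using FD[OF that(2)] ED[OF that(1)] by (auto simp: F_def rainbow_def sw_def)
  qed
  define S where "S = Sigma E (\<lambda>(z, z'). {f\<in>F. z \<in> f})"
  have fS: "finite S" unfolding S_def using fE fF by (rule_tac finite_SigmaI) auto
  have SD: "(z, z') \<in> E" "f \<in> F" "z \<in> f" if "((z, z'), f) \<in> S" for z z' f
    using that by (auto simp: S_def)
  \<comment> \<open>The three cases: both \<open>f\<close> and its swap are in the link,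
    \<open>f\<close> is not, the swap is not.\<close>
  define S1 where "S1 = {((z, z'), f). ((z, z'), f) \<in> S \<and> f \<in> link L x \<and> sw f z z' \<in> link L x}"
  define S2 where "S2 = {((z, z'), f). ((z, z'), f) \<in> S \<and> f \<notin> link L x}"
  define S3 where "S3 = {((z, z'), f). ((z, z'), f) \<in> S \<and> sw f z z' \<notin> link L x}"
  have sub: "S1 \<subseteq> S" "S2 \<subseteq> S" "S3 \<subseteq> S" by (auto simp: S1_def S2_def S3_def)
  have cl': "cliqued k U G (link L x)" unfolding U_def by (rule cliqued_link[OF cl])
  note D' = cliquedD[OF cl']
  \<comment> \<open>Injective although \<open>z\<close> is forgotten: it is the only vertex of
    \<open>f\<close> with the colour of \<open>z'\<close>.\<close>
  have "card S1 \<le> card {(e, c)\<in>extensions V G L. x \<in> e}"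
  proof (rule card_inj_on_le[where f = "\<lambda>((z, z'), f). (insert x f, z')"])
    show "inj_on (\<lambda>((z, z'), f). (insert x f, z')) S1"
    proof (rule inj_onI)
      fix a b assume ab: "a \<in> S1" "b \<in> S1" "(\<lambda>((z, z'), f). (insert x f, z')) a = (\<lambda>((z, z'), f). (insert x f, z')) b"
      obtain z z' f where a': "a = ((z, z'), f)" by (metis surj_pair)
      obtain w w' g where b': "b = ((w, w'), g)" by (metis surj_pair)
      have a: "((z, z'), f) \<in> S1" "((w, w'), g) \<in> S1" "insert x f = insert x g" "z' = w'" using ab unfolding a' b' prod.case prod.inject by blast+
      then have "x \<notin> f" "x \<notin> g" by (auto simp: S1_def link_def)
      then have fg: "f = g" using a(3) by (simp add: insert_ident)
      have "((z, z'), f) \<in> S" "((w, w'), g) \<in> S" using a sub by auto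
      then have "z = w" using inj[of f z w] SD[of z z' f] SD[of w w' g] ED[of z z'] ED[of w w'] a(4) fg by simp
      then show "a = b" using a(4) fg a' b' by simp
    qed
    show "(\<lambda>((z, z'), f). (insert x f, z')) ` S1 \<subseteq> {(e, c)\<in>extensions V G L. x \<in> e}"
    proof clarify
      fix z z' f assume a: "((z, z'), f) \<in> S1"
      then have s: "(z, z') \<in> E" "f \<in> F" "z \<in> f" and l: "f \<in> link L x" "sw f z z' \<in> link L x"
        using SD[of z z' f] by (auto simp: S1_def)
      have "G u z'" if "u \<in> insert x f" for u
      proof (cases "u = x \<or> u = z")
        case True
        then show ?thesis using ED[OF s(1)] by (auto simp: U_def nbhd_def)
      next
        case False
        then have "u \<in> sw f z z'" "z' \<in> sw f z z'" using that by (auto simp: sw_def)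
        moreover have "u \<noteq> z'" using False inj[of f u z] s ED[OF s(1)] that by auto
        ultimately show ?thesis using D'(6)[OF l(2)] by blast
      qed
      then show "(insert x f, z') \<in> extensions V G L \<and> x \<in> insert x f"
        using l(1) ED[OF s(1)] by (simp add: extensions_def link_def U_def nbhd_def)
    qed
    show "finite {(e, c)\<in>extensions V G L. x \<in> e}"
      using cliquedD(8)[OF cl] by (rule rev_finite_subset) auto
  qed
  moreover have "card S2 \<le> card ((F - link L x) \<times> U)"
  proof (rule card_inj_on_le[where f = "\<lambda>((z, z'), f). (f, z')"])
    show "inj_on (\<lambda>((z, z'), f). (f, z')) S2"
    proof (rule inj_onI)
      fix a b assume ab: "a \<in> S2" "b \<in> S2" "(\<lambda>((z, z'), f). (f, z')) a = (\<lambda>((z, z'), f). (f, z')) b"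
      obtain z z' f where a': "a = ((z, z'), f)" by (metis surj_pair)
      obtain w w' g where b': "b = ((w, w'), g)" by (metis surj_pair)
      have a: "((z, z'), f) \<in> S2" "((w, w'), g) \<in> S2" "f = g" "z' = w'" using ab unfolding a' b' prod.case prod.inject by blast+
      then have "((z, z'), f) \<in> S" "((w, w'), f) \<in> S" using sub by auto
      then show "a = b" using inj[of f z w] SD[of z z' f] SD[of w w' f] ED[of z z'] ED[of w w'] a(3,4) a' b' by simp
    qed
    show "(\<lambda>((z, z'), f). (f, z')) ` S2 \<subseteq> (F - link L x) \<times> U"
      using SD ED by (fastforce simp: S2_def)
    show "finite ((F - link L x) \<times> U)" using fF fU by simp
  qed
  \<comment> \<open>Here \<open>z'\<close> is recovered as the only vertex of the swapped set with
    the colour of \<open>z\<close>, and undoing the swap gives \<open>f\<close>.\<close>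
  moreover have "card S3 \<le> card ((F - link L x) \<times> U)"
  proof (rule card_inj_on_le[where f = "\<lambda>((z, z'), f). (sw f z z', z)"])
    show "inj_on (\<lambda>((z, z'), f). (sw f z z', z)) S3"
    proof (rule inj_onI)
      fix a b assume ab: "a \<in> S3" "b \<in> S3" "(\<lambda>((z, z'), f). (sw f z z', z)) a = (\<lambda>((z, z'), f). (sw f z z', z)) b"
      obtain z z' f where a': "a = ((z, z'), f)" by (metis surj_pair)
      obtain w w' g where b': "b = ((w, w'), g)" by (metis surj_pair)
      have a: "((z, z'), f) \<in> S3" "((w, w'), g) \<in> S3" "sw f z z' = sw g w w'" "z = w" using ab unfolding a' b' prod.case prod.inject by blast+
      have s: "((z, z'), f) \<in> S" "((w, w'), g) \<in> S" using a sub by auto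
      note sd = SD[OF s(1)] SD[OF s(2)]
      have "z' \<in> sw f z z'" "w' \<in> sw g w w'" by (simp_all add: sw_def)
      then have 1: "z' \<in> sw f z z'" "w' \<in> sw f z z'" using a(3) by simp_all
      have zw: "z' = w'" using inj[OF swF[OF sd(1-3)] 1] ED[OF sd(1)] ED[OF sd(4)] a(4) by simp
      have "z' \<noteq> z" "w' \<noteq> w" using D(3) ED(3)[OF sd(1)] ED(3)[OF sd(4)] by auto
      moreover have "z' \<notin> f" using inj[of f z' z] sd ED[OF sd(1)] \<open>z' \<noteq> z\<close> by auto
      moreover have "w' \<notin> g" using inj[of g w' w] sd ED[OF sd(4)] \<open>w' \<noteq> w\<close> by auto
      ultimately have "f = insert z (sw f z z' - {z'})" "g = insert w (sw g w w' - {w'})"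
        using sd by (auto simp: sw_def)
      then show "a = b" using a(3,4) zw a' b' by simp
    qed
    show "(\<lambda>((z, z'), f). (sw f z z', z)) ` S3 \<subseteq> (F - link L x) \<times> U"
    proof clarify
      fix z z' f assume a: "((z, z'), f) \<in> S3"
      then have s: "(z, z') \<in> E" "f \<in> F" "z \<in> f" "sw f z z' \<notin> link L x"
        using SD[of z z' f] by (auto simp: S3_def)
      then show "sw f z z' \<in> F - link L x \<and> z \<in> U" using swF ED(1) by blast
    qed
    show "finite ((F - link L x) \<times> U)" using fF fU by simp
  qed
  moreover have "card S \<le> card S1 + card S2 + card S3"
  proof -
    have "S \<subseteq> S1 \<union> S2 \<union> S3" by (auto simp: S1_def S2_def S3_def)
    then have "card S \<le> card (S1 \<union> S2 \<union> S3)"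
      using fS sub by (meson card_mono finite_UnI finite_subset)
    also have "\<dots> \<le> card S1 + card S2 + card S3"
      by (intro order_trans[OF card_Un_le] add_right_mono) (rule order_refl)
    finally show ?thesis .
  qed
  ultimately have cS: "card S \<le> card {(e, c)\<in>extensions V G L. x \<in> e} + 2 * card U * card (F - link L x)"
    by (simp add: card_cartesian_product algebra_simps)
  \<comment> \<open>A colour class has at most \<open>card U\<close> vertices, so each
    \<open>z\<close> lies in at least \<open>card F / card U\<close> rainbow sets; this converts the
    bound on \<open>S\<close> into one on \<open>E\<close>.\<close>
  have "card E * card F = (\<Sum>(z, z')\<in>E. card F)" by (simp add: case_prod_beta)
  also have "\<dots> \<le> (\<Sum>(z, z')\<in>E. card U * card {f\<in>F. z \<in> f})"
  proof (rule sum_mono, clarify)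
    fix z z' assume zz: "(z, z') \<in> E"
    have "p z < k" using p ED(1)[OF zz] unfolding U_def .
    then have "card {u\<in>U. p u = p z} * card {f\<in>F. z \<in> f} = card F"
      unfolding F_def by (intro card_rainbow_split[OF fU _ ED(1)[OF zz]]) simp_all
    moreover have "card {u\<in>U. p u = p z} \<le> card U" using fU by (intro card_mono) auto
    then have "card {u\<in>U. p u = p z} * card {f\<in>F. z \<in> f} \<le> card U * card {f\<in>F. z \<in> f}"
      by (rule mult_le_mono1)
    ultimately show "card F \<le> card U * card {f\<in>F. z \<in> f}" by linarith
  qed
  also have "\<dots> = card U * (\<Sum>(z, z')\<in>E. card {f\<in>F. z \<in> f})" by (simp add: sum_distrib_left case_prod_beta)
  also have "(\<Sum>(z, z')\<in>E. card {f\<in>F. z \<in> f}) = card S"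
    unfolding S_def using fE fF by (subst card_SigmaI) (auto simp: case_prod_beta)
  also have "card U * card S \<le> card U * (card {(e, c)\<in>extensions V G L. x \<in> e} + 2 * card U * card (F - link L x))"
    using cS by (rule mult_le_mono2)
  finally show ?thesis .
qed

section \<open>Stability\<close>

text \<open>Markov's inequality, as an extension involves at most \<open>k + 1\<close> vertices. The
  square shares the smallness equally: one factor \<open>g\<close> becomes the threshold per vertex,
  the other the proportion of exceptional vertices.\<close>

lemma few_high_extension_vertices:
  fixes g N :: real
  assumes cl: "cliqued k V G L" and N: "0 < N" and g: "0 < g"
    and ext: "real (card (extensions V G L)) \<le> g\<^sup>2 * N ^ (k + 1)"
  shows "card {x\<in>V. g * N ^ k < card {(e, c)\<in>extensions V G L. x \<in> e \<or> x = c}} \<le> (k + 1) * g * N"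
proof -
  note D = cliquedD[OF cl]
  define h where "h x = card {z\<in>extensions V G L. x \<in> fst z \<or> x = snd z}" for x
  have h: "card {(e, c)\<in>extensions V G L. x \<in> e \<or> x = c} = h x" for x
  proof -
    have "{(e, c)\<in>extensions V G L. x \<in> e \<or> x = c} = {z\<in>extensions V G L. x \<in> fst z \<or> x = snd z}" by auto
    then show ?thesis by (simp add: h_def)
  qed
  define X where "X = {x\<in>V. g * N ^ k < h x}"
  have fX: "finite X" using D(1) by (simp add: X_def)
  have "(\<Sum>x\<in>V. h x) = (\<Sum>z\<in>extensions V G L. card {x\<in>V. x \<in> fst z \<or> x = snd z})"
    unfolding h_def using D(1,8) by (rule sum_card_swap)
  also have "\<dots> \<le> (\<Sum>z\<in>extensions V G L. k + 1)"
  proof (intro sum_mono)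
    fix z assume "z \<in> extensions V G L"
    then have e: "fst z \<in> L" by (auto simp: extensions_def)
    have f: "finite (fst z)" using D(4)[OF e] D(1) finite_subset by blast
    have "card {x\<in>V. x \<in> fst z \<or> x = snd z} \<le> card (insert (snd z) (fst z))"
      using f by (intro card_mono) auto
    also have "\<dots> \<le> k + 1" using card_insert_le_m1[of "k + 1" "fst z" "snd z"] D(5)[OF e] by simp
    finally show "card {x\<in>V. x \<in> fst z \<or> x = snd z} \<le> k + 1" .
  qed
  finally have "(\<Sum>x\<in>V. h x) \<le> card (extensions V G L) * (k + 1)" by simp
  then have 1: "real (\<Sum>x\<in>V. h x) \<le> real (card (extensions V G L)) * (k + 1)"
    by (metis of_nat_le_iff of_nat_mult)
  have "real (card X) * (g * N ^ k) = (\<Sum>x\<in>X. g * N ^ k)" by simp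
  also have "\<dots> \<le> (\<Sum>x\<in>X. real (h x))" by (intro sum_mono) (auto simp: X_def)
  also have "\<dots> \<le> (\<Sum>x\<in>V. real (h x))" using D(1) by (intro sum_mono2) (auto simp: X_def)
  also have "\<dots> \<le> real (card (extensions V G L)) * (k + 1)" using 1 by simp
  also have "\<dots> \<le> g\<^sup>2 * N ^ (k + 1) * (k + 1)" using ext by (intro mult_right_mono) auto
  also have "\<dots> = ((k + 1) * g * N) * (g * N ^ k)" by (simp add: power2_eq_square)
  finally have "real (card X) \<le> (k + 1) * g * N"
    using g N by (simp add: mult_le_cancel_right)
  then show ?thesis by (simp add: X_def h add.commute)
qed

text \<open>With \<open>x\<close> of maximal degree among vertices in few extensions and
  \<open>U\<close> its neighbourhood, the number of edges is at most about
  \<open>(card V - card U) * l\<close>, where \<open>l\<close> is the size of the link. The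
  induction hypothesis bounds \<open>l\<close>, and AM-GM optimises over \<open>card U\<close>. Near
  equality forces a near-extremal link, whose colouring of \<open>U\<close> is extended by one new
  colour outside \<open>U\<close>. Errors are measured in powers of the fixed \<open>N\<close> and
  not of \<open>card V\<close>, since \<open>U\<close> may be much smaller than
  \<open>V\<close>.\<close>

lemma stability_step:
  fixes V :: "'a set" and N g \<epsilon> \<epsilon>' \<kappa> \<gamma>' :: real
  assumes k: "1 \<le> k" and N: "0 < N" and cl: "cliqued (Suc k) V G L" and VN: "real (card V) \<le> N"
    and ext: "real (card (extensions V G L)) \<le> g\<^sup>2 * N ^ (Suc k + 1)"
    and IH: "\<And>(V' :: 'a set) L'. cliqued k V' G L' \<Longrightarrow> real (card V') \<le> N \<Longrightarrow>
      real (card (extensions V' G L')) \<le> g * N ^ (k + 1) \<Longrightarrow>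
      real (card L') \<le> (card V' / k) ^ k + \<epsilon>' * N ^ k \<and>
      ((card V' / k) ^ k - \<gamma>' * N ^ k \<le> card L' \<longrightarrow>
        (\<exists>p :: 'a \<Rightarrow> nat. (\<forall>v\<in>V'. p v < k) \<and> (card V' / k) ^ k - \<epsilon>' * N ^ k \<le> card (L' \<inter> rainbow V' p {..<k})))"
    and g: "0 < g" "g \<le> 1" and \<epsilon>: "0 < \<epsilon>" "\<epsilon> \<le> 1" and \<epsilon>': "\<epsilon>' = \<epsilon>\<^sup>2 / 64" and \<kappa>: "\<kappa> = (real k + 4) * g"
    and \<kappa>1: "\<kappa> \<le> \<epsilon>\<^sup>2 / 64" and \<kappa>2: "\<kappa> \<le> \<gamma>' * (\<epsilon> / 4)" and \<gamma>': "0 < \<gamma>'"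
  shows "real (card L) \<le> (card V / Suc k) ^ Suc k + \<epsilon> * N ^ Suc k \<and>
      ((card V / Suc k) ^ Suc k - g\<^sup>2 * N ^ Suc k \<le> card L \<longrightarrow>
        (\<exists>p :: 'a \<Rightarrow> nat. (\<forall>v\<in>V. p v < Suc k) \<and> (card V / Suc k) ^ Suc k - \<epsilon> * N ^ Suc k \<le> card (L \<inter> rainbow V p {..<Suc k})))"
proof -
  note D = cliquedD[OF cl]
  define P where "P = N ^ k"
  have P: "P > 0" and NP: "N ^ Suc k = N * P" using N by (auto simp: P_def)
  define s where "s = (card V / Suc k) ^ Suc k"
  have deg_le: "real (card {e\<in>L. y \<in> e}) \<le> P" if "y \<in> V" for y
  proof -
    have "card {e\<in>L. {y} \<subseteq> e} \<le> card V ^ (Suc k - card {y})"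
      using D(1,4,5) that by (intro card_edges_containing) auto
    then have "real (card {e\<in>L. y \<in> e}) \<le> real (card V) ^ k" by (simp flip: of_nat_power)
    also have "\<dots> \<le> P" unfolding P_def using VN by (intro power_mono) auto
    finally show ?thesis .
  qed
  have e2: "\<epsilon>\<^sup>2 \<le> \<epsilon>" "0 < \<epsilon>\<^sup>2" using \<epsilon> by (auto simp: power2_eq_square mult_left_le)
  have e3: "0 < \<epsilon>'" using e2(2) unfolding \<epsilon>' by simp
  have g2: "0 \<le> g\<^sup>2" "g\<^sup>2 \<le> g" using g by (auto simp: power2_eq_square mult_left_le)
  have kg: "(k + 3) * g + g = \<kappa>" "0 \<le> (k + 3) * g" using g by (auto simp: \<kappa> algebra_simps)
  have gk: "g \<le> \<kappa>" using kg by linarith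
  have s_le: "s \<le> card V * P"
  proof -
    have "s = (card V / Suc k) * (card V / Suc k) ^ k" by (simp add: s_def)
    also have "\<dots> \<le> card V * P"
    proof (intro mult_mono)
      have *: "card V / Suc k \<le> card V" by (simp add: divide_le_eq mult_le_cancel_left1)
      then show "card V / Suc k \<le> card V" .
      show "(card V / Suc k) ^ k \<le> P" unfolding P_def using order_trans[OF * VN] by (intro power_mono) auto
    qed auto
    finally show ?thesis .
  qed
  define X where "X = {x\<in>V. g * N ^ Suc k < card {(e, c)\<in>extensions V G L. x \<in> e \<or> x = c}}"
  have cX: "card X \<le> (k + 2) * g * N"
    using few_high_extension_vertices[OF cl N g(1) ext] by (simp add: X_def add.commute)
  have fX: "finite X" using D(1) by (simp add: X_def)
  show ?thesis
  proof (cases "V \<subseteq> X")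
    \<comment> \<open>If every vertex lies in many extensions, then \<open>V\<close> itself has at
      most \<open>\<kappa> * N\<close> vertices; both \<open>card L\<close> and \<open>s\<close>
      drop below the error term, and any colouring serves.\<close>
    case True
    then have "X = V" by (auto simp: X_def)
    then have vN: "card V \<le> \<kappa> * N"
      using cX g N order_trans[of "card V" "(k + 2) * g * N" "\<kappa> * N"] unfolding \<kappa>
      by (simp add: mult_right_mono)
    have vP: "card V * P \<le> \<epsilon> * (N * P)"
    proof -
      have "\<kappa> \<le> \<epsilon>" using \<kappa>1 e2 by linarith
      then have "card V \<le> \<epsilon> * N" using vN N order_trans by (meson less_imp_le mult_right_mono)
      then have "card V * P \<le> (\<epsilon> * N) * P" using P by (intro mult_right_mono) auto
      then show ?thesis by simp
    qed
    have "card L \<le> (\<Sum>y\<in>V. card {e\<in>L. y \<in> e})"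
    proof -
      have "card L \<le> (\<Sum>e\<in>L. card {y\<in>V. y \<in> e})"
      proof -
        have "1 \<le> card {y\<in>V. y \<in> e}" if "e \<in> L" for e
        proof -
          have "{y\<in>V. y \<in> e} = e" using D(4)[OF that] by auto
          then show ?thesis using D(5)[OF that] by simp
        qed
        then have "(\<Sum>e\<in>L. 1) \<le> (\<Sum>e\<in>L. card {y\<in>V. y \<in> e})" by (intro sum_mono) auto
        then show ?thesis by simp
      qed
      then show ?thesis using sum_card_swap[OF D(7) D(1), of "\<lambda>e y. y \<in> e"] by simp
    qed
    then have "real (card L) \<le> (\<Sum>y\<in>V. real (card {e\<in>L. y \<in> e}))"
      by (simp only: of_nat_sum[symmetric] of_nat_le_iff)
    also have "\<dots> \<le> (\<Sum>y\<in>V. P)" using deg_le by (intro sum_mono) auto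
    finally have "real (card L) \<le> card V * P" by simp
    moreover have "0 \<le> s" by (simp add: s_def)
    moreover have "s - \<epsilon> * (N * P) \<le> card (L \<inter> rainbow V (\<lambda>_. 0::nat) {..<Suc k})" using s_le vP by linarith
    ultimately show ?thesis
      unfolding NP s_def[symmetric] using vP by (auto intro!: exI[of _ "\<lambda>_. 0::nat"])
  next
    case False
    define d where "d y = card {e\<in>L. y \<in> e}" for y
    obtain x where x: "x \<in> V - X" and xmax: "\<And>y. y \<in> V - X \<Longrightarrow> d y \<le> d x"
    proof -
      have "finite (V - X)" "V - X \<noteq> {}" using D(1) False by auto
      then have "Max (d ` (V - X)) \<in> d ` (V - X)" by (intro Max_in) auto
      then obtain x where "x \<in> V - X" "d x = Max (d ` (V - X))" by auto
      moreover have "d y \<le> Max (d ` (V - X))" if "y \<in> V - X" for y using D(1) that by auto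
      ultimately show ?thesis using that by metis
    qed
    define U where "U = nbhd V G x"
    define l where "l = real (card (link L x))"
    have UV: "U \<subseteq> V" by (auto simp: U_def nbhd_def)
    have fU: "finite U" using UV D(1) finite_subset by blast
    have UN: "real (card U) \<le> N" using card_mono[OF D(1) UV] VN by linarith
    have ld: "l = d x" by (simp add: l_def card_link d_def)
    have lP: "l \<le> P" unfolding ld d_def using x deg_le by auto
    have extx: "card {(e, c)\<in>extensions V G L. x \<in> e \<or> x = c} \<le> g * (N * P)"
      using x unfolding X_def NP by auto
    have ext_sub: "card {(e, c)\<in>extensions V G L. x \<in> e} \<le> card {(e, c)\<in>extensions V G L. x \<in> e \<or> x = c}"
      "card {(e, c)\<in>extensions V G L. c = x} \<le> card {(e, c)\<in>extensions V G L. x \<in> e \<or> x = c}"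
      by (rule card_mono; use D(8) in \<open>auto intro: rev_finite_subset\<close>)+
    have extx1: "card {(e, c)\<in>extensions V G L. x \<in> e} \<le> g * (N * P)"
      "card {(e, c)\<in>extensions V G L. c = x} \<le> g * (N * P)"
      using extx ext_sub by linarith+
    define B2 where "B2 = card {e\<in>L. 2 \<le> card (e - U)}"
    \<comment> \<open>Vertices outside \<open>X\<close> have degree at most \<open>l\<close>. The at
      most \<open>(k + 2) * g * N\<close> vertices of \<open>X\<close> cost up to \<open>P\<close>
      each, and the edges extended by \<open>x\<close> cost another \<open>g * N * P\<close>, whence
      \<open>k + 3\<close>.\<close>
    have main: "card L + B2 \<le> (real (card V) - card U) * l + (k + 3) * g * (N * P)"
    proof -
      have "real (card L + B2) \<le> real ((\<Sum>y\<in>V - U. d y) + card {(e, c)\<in>extensions V G L. c = x})"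
        unfolding B2_def U_def d_def of_nat_le_iff using x by (intro degree_sum_bound[OF cl]) auto
      also have "\<dots> \<le> (\<Sum>y\<in>V - U. real (d y)) + g * (N * P)" using extx1 by simp
      also have "(\<Sum>y\<in>V - U. real (d y)) \<le> (\<Sum>y\<in>V - U. l + (if y \<in> X then P else 0))"
      proof (intro sum_mono)
        fix y assume y: "y \<in> V - U"
        show "real (d y) \<le> l + (if y \<in> X then P else 0)"
          using y xmax[of y] deg_le[of y] by (auto simp: ld) (auto simp: d_def)
      qed
      also have "\<dots> = real (card (V - U)) * l + real (card ((V - U) \<inter> X)) * P"
        using D(1) by (simp add: sum.distrib sum.If_cases Int_def)
      also have "real (card ((V - U) \<inter> X)) * P \<le> (k + 2) * g * N * P"
      proof (intro mult_right_mono)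
        have "card ((V - U) \<inter> X) \<le> card X" using fX by (intro card_mono) auto
        then show "card ((V - U) \<inter> X) \<le> (k + 2) * g * N" using cX by linarith
      qed (use P in simp)
      also have "real (card (V - U)) = real (card V) - card U"
        using UV D(1) fU by (simp add: card_Diff_subset card_mono of_nat_diff)
      finally show ?thesis by (simp add: algebra_simps)
    qed
    define A where "A = (card U / k) ^ k"
    \<comment> \<open>AM-GM for the \<open>k + 1\<close> numbers \<open>card V - card U\<close> and
      \<open>k\<close> copies of \<open>card U / k\<close>, whose sum is
      \<open>card V\<close>.\<close>
    have amgm: "(real (card V) - card U) * A \<le> s"
    proof -
      define a where "a i = (if i = 0 then real (card V) - card U else card U / k)" for i :: nat
      have "prod a {..k} \<le> (sum a {..k} / card {..k}) ^ card {..k}"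
        using card_mono[OF D(1) UV] by (intro prod_le_mean_power) (auto simp: a_def)
      moreover have "prod a {..k} = (real (card V) - card U) * A"
        using prod.atMost_Suc_shift[of a "k - 1"] k by (simp add: a_def A_def)
      moreover have "sum a {..k} = card V"
        using sum.atMost_Suc_shift[of a "k - 1"] k by (simp add: a_def)
      ultimately show ?thesis by (simp add: s_def)
    qed
    have cl': "cliqued k U G (link L x)" unfolding U_def by (rule cliqued_link[OF cl])
    have "card (extensions U G (link L x)) \<le> card {(e, c)\<in>extensions V G L. x \<in> e}"
      unfolding U_def by (rule card_extensions_link[OF cl])
    then have "real (card (extensions U G (link L x))) \<le> g * N ^ (k + 1)"
      using extx1(1) unfolding Suc_eq_plus1[symmetric] NP by linarith
    note IH' = IH[OF cl' UN this, folded A_def P_def l_def]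
    have VU: "0 \<le> real (card V) - card U" "real (card V) - card U \<le> N" using card_mono[OF D(1) UV] VN by auto
    have "(real (card V) - card U) * l \<le> (real (card V) - card U) * (A + \<epsilon>' * P)"
      using IH' VU by (intro mult_left_mono) auto
    also have "\<dots> \<le> s + N * (\<epsilon>' * P)"
      unfolding distrib_left using amgm VU P e3 by (intro add_mono mult_right_mono) auto
    finally have up: "(real (card V) - card U) * l \<le> s + \<epsilon>' * (N * P)" by (simp add: mult_ac)
    define Q where "Q = N * P"
    have Q: "Q > 0" using N P by (simp add: Q_def)
    have lin: "\<epsilon>' * Q + \<kappa> * Q \<le> \<epsilon> / 32 * Q" "0 \<le> g\<^sup>2 * Q" "g\<^sup>2 * Q \<le> g * Q" "(k + 3) * g * Q + g * Q = \<kappa> * Q"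
      "0 \<le> g * Q" "0 \<le> \<epsilon>' * Q" "0 \<le> \<epsilon> * Q" "0 \<le> (k + 3) * g * Q" "g * Q \<le> \<kappa> * Q"
    proof -
      have "\<epsilon>' + \<kappa> \<le> \<epsilon> / 32" using \<kappa>1 e2 \<epsilon>' by linarith
      then have "(\<epsilon>' + \<kappa>) * Q \<le> \<epsilon> / 32 * Q" using Q by (intro mult_right_mono) linarith+
      then show "\<epsilon>' * Q + \<kappa> * Q \<le> \<epsilon> / 32 * Q" by (simp only: distrib_right)
      have "((k + 3) * g + g) * Q = \<kappa> * Q" using kg(1) by simp
      then show "(k + 3) * g * Q + g * Q = \<kappa> * Q" by (simp only: distrib_right)
      show "0 \<le> g\<^sup>2 * Q" "0 \<le> g * Q" "0 \<le> \<epsilon>' * Q" "0 \<le> \<epsilon> * Q"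
        using Q g g2 e3 \<epsilon> by simp_all
      show "0 \<le> (k + 3) * g * Q" using mult_nonneg_nonneg[OF kg(2), of Q] Q by linarith
      show "g\<^sup>2 * Q \<le> g * Q" using g2(2) Q by (intro mult_right_mono) linarith+
      show "g * Q \<le> \<kappa> * Q" using gk Q by (intro mult_right_mono) linarith+
    qed
    have concl1: "real (card L) \<le> s + \<epsilon> * Q"
      using main up lin unfolding Q_def[symmetric] by linarith
    have concl2: "\<exists>p :: 'a \<Rightarrow> nat. (\<forall>v\<in>V. p v < Suc k) \<and> s - \<epsilon> * Q \<le> card (L \<inter> rainbow V p {..<Suc k})"
      if big: "s - g\<^sup>2 * Q \<le> card L"
    proof (cases "s \<le> \<epsilon> * Q")
      \<comment> \<open>The required number of rainbow edges is not positive, so any colouring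
        serves; in the other case both \<open>card V - card U\<close> and \<open>l\<close> are
        bounded below.\<close>
      case True
      then show ?thesis by (intro exI[of _ "\<lambda>_. 0"]) auto
    next
      case False
      have lo: "s - \<kappa> * Q \<le> (real (card V) - card U) * l"
        using main big lin unfolding Q_def[symmetric] by linarith
      have B2: "B2 \<le> \<epsilon>' * Q + \<kappa> * Q" using main up big lin unfolding Q_def[symmetric] by linarith
      have lo2: "\<epsilon> / 2 * Q \<le> (real (card V) - card U) * l" using lo False lin by linarith
      have "(real (card V) - card U) * l \<le> (real (card V) - card U) * P" using lP VU by (intro mult_left_mono)
      then have "\<epsilon> / 2 * N * P \<le> (real (card V) - card U) * P" using lo2 by (simp add: Q_def)
      then have vu: "\<epsilon> / 2 * N \<le> real (card V) - card U" using P by (simp only: mult_le_cancel_right_pos)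
      have "(real (card V) - card U) * l \<le> N * l" using VU by (intro mult_right_mono) (auto simp: l_def)
      moreover have "N * (\<epsilon> / 2 * P) = \<epsilon> / 2 * Q" by (simp add: Q_def)
      ultimately have "N * (\<epsilon> / 2 * P) \<le> N * l" using lo2 by linarith
      then have l: "\<epsilon> / 2 * P \<le> l" using N by (simp only: mult_le_cancel_left_pos)
      \<comment> \<open>A deficit \<open>\<gamma>' * P\<close> of the link is multiplied by
        \<open>card V - card U\<close>, which is at least \<open>\<epsilon> / 2 * N\<close>; this
        exceeds the total slack \<open>\<kappa> * Q\<close> because
        \<open>\<kappa> \<le> \<gamma>' * (\<epsilon> / 4)\<close>.\<close>
      have "A - \<gamma>' * P \<le> l"
      proof (rule ccontr)
        assume "\<not> ?thesis"
        then have "(real (card V) - card U) * l \<le> (real (card V) - card U) * (A - \<gamma>' * P)"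
          using VU by (intro mult_left_mono) auto
        also have "\<dots> \<le> s - (real (card V) - card U) * (\<gamma>' * P)" using amgm by (simp add: algebra_simps)
        finally have "s - \<kappa> * Q \<le> s - (real (card V) - card U) * (\<gamma>' * P)" using lo by linarith
        moreover have "\<epsilon> / 2 * N * (\<gamma>' * P) \<le> (real (card V) - card U) * (\<gamma>' * P)"
          using vu P \<gamma>' by (intro mult_right_mono) auto
        moreover have "\<epsilon> / 2 * N * (\<gamma>' * P) = \<gamma>' * (\<epsilon> / 2) * Q" by (simp add: Q_def)
        ultimately have "\<gamma>' * (\<epsilon> / 2) * Q \<le> \<kappa> * Q" by linarith
        then have "\<gamma>' * (\<epsilon> / 2) \<le> \<kappa>" using Q by simp
        moreover have "0 < \<gamma>' * \<epsilon>" using \<gamma>' \<epsilon> by simp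
        ultimately show False using \<kappa>2 by simp
      qed
      then obtain p where p: "\<And>v. v \<in> U \<Longrightarrow> p v < k" and pA: "A - \<epsilon>' * P \<le> card (link L x \<inter> rainbow U p {..<k})"
        using IH' by blast
      define F where "F = rainbow U p {..<k}"
      have fF: "finite F" unfolding F_def by (rule finite_rainbow[OF fU])
      have FA: "card F \<le> A" unfolding F_def A_def using fU k p by (intro card_rainbow_le) auto
      have "card F = card (link L x \<inter> F) + card (F - link L x)"
        using fF by (metis Int_commute card_Diff_subset_Int card_mono finite_Int inf_le1 le_add_diff_inverse)
      \<comment> \<open>There are at most \<open>A\<close> rainbow sets in all, and the link
        contains nearly \<open>A\<close> of them.\<close>
      then have miss: "card (F - link L x) \<le> \<epsilon>' * P" using pA FA unfolding F_def[symmetric] by linarith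
      have e4: "\<epsilon>' \<le> \<epsilon> / 64" using e2 \<epsilon>' by simp
      have Pe: "\<epsilon>' * P \<le> \<epsilon> / 64 * P" using e4 P by (intro mult_right_mono) auto
      have "\<epsilon> / 4 * P \<le> card F"
      proof -
        have "card (link L x \<inter> F) \<le> card F" using fF by (intro card_mono) auto
        then have "A - \<epsilon>' * P \<le> card F" using pA unfolding F_def[symmetric] by linarith
        moreover have "l \<le> A + \<epsilon>' * P" using IH' by blast
        moreover have "0 \<le> \<epsilon> * P" using \<epsilon> P by simp
        ultimately show ?thesis using l Pe by linarith
      qed
      define E where "E = {(z, z'). z \<in> U \<and> z' \<in> U \<and> G z z' \<and> p z = p z'}"
      have "card E * card F \<le> card U * (card {(e, c)\<in>extensions V G L. x \<in> e} + 2 * card U * card (F - link L x))"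
        unfolding E_def F_def U_def by (intro monochromatic_pairs_bound[OF cl] p) (simp add: U_def)
      then have "real (card E * card F) \<le> real (card U * (card {(e, c)\<in>extensions V G L. x \<in> e} + 2 * card U * card (F - link L x)))"
        by (simp only: of_nat_le_iff)
      then have "real (card E) * card F \<le> card U * (card {(e, c)\<in>extensions V G L. x \<in> e} + 2 * card U * real (card (F - link L x)))"
        by simp
      also have "\<dots> \<le> N * (g * (N * P) + 2 * N * (\<epsilon>' * P))"
        using UN extx1(1) miss N by (intro mult_mono add_mono) auto
      also have "\<dots> = (g + 2 * \<epsilon>') * (N * N * P)" by (simp add: algebra_simps)
      also have "\<dots> \<le> (3 * \<epsilon>\<^sup>2 / 64) * (N * N * P)" using gk \<kappa>1 \<epsilon>' N P by (intro mult_right_mono) auto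
      finally have "real (card E) * card F \<le> (3 * \<epsilon>\<^sup>2 / 64) * (N * N * P)" .
      moreover have "real (card E) * (\<epsilon> / 4 * P) \<le> real (card E) * card F"
        using \<open>\<epsilon> / 4 * P \<le> card F\<close> by (intro mult_left_mono) auto
      ultimately have "(\<epsilon> / 4 * P) * real (card E) \<le> (\<epsilon> / 4 * P) * (3 * \<epsilon> / 16 * (N * N))"
        by (simp add: power2_eq_square algebra_simps)
      then have cE: "real (card E) \<le> 3 * \<epsilon> / 16 * (N * N)" using \<epsilon> P by (simp add: mult_le_cancel_left_pos)
      \<comment> \<open>Colours \<open>0\<close> to \<open>k - 1\<close> come from the link; the
        non-neighbours of \<open>x\<close> form the new class \<open>k\<close>.\<close>
      define q where "q v = (if v \<in> U then p v else k)" for v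
      define L0 where "L0 = {e\<in>L. e \<subseteq> U}"
      define L2 where "L2 = {e\<in>L. 2 \<le> card (e - U)}"
      define LE where "LE = (\<Union>z\<in>E. {e\<in>L. {fst z, snd z} \<subseteq> e})"
      \<comment> \<open>An edge is not rainbow for three reasons only: it lies inside
        \<open>U\<close> and is extended by \<open>x\<close>, it has two vertices outside
        \<open>U\<close> and was counted twice in the degree sum, or it contains an adjacent pair of
        equal colour in \<open>U\<close>.\<close>
      have "L \<subseteq> (L \<inter> rainbow V q {..<Suc k}) \<union> L0 \<union> L2 \<union> LE"
      proof
        fix e assume e: "e \<in> L"
        have fe: "finite e" using D(4)[OF e] D(1) finite_subset by blast
        show "e \<in> (L \<inter> rainbow V q {..<Suc k}) \<union> L0 \<union> L2 \<union> LE"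
        proof (rule ccontr)
          assume n: "\<not> ?thesis"
          have c1: "card (e - U) \<le> 1" using n e by (auto simp: L2_def)
          have "inj_on q e"
          proof (rule inj_onI, rule ccontr)
            fix z w assume zw: "z \<in> e" "w \<in> e" "q z = q w" "z \<noteq> w"
            have "z \<in> U \<or> w \<in> U"
            proof (rule ccontr)
              assume "\<not> (z \<in> U \<or> w \<in> U)"
              then have "card {z, w} \<le> card (e - U)" using zw fe by (intro card_mono) auto
              then show False using c1 zw(4) by simp
            qed
            then have "z \<in> U" "w \<in> U" using zw(3) p[of z] p[of w] by (auto simp: q_def split: if_splits)
            then have "(z, w) \<in> E" using zw D(6)[OF e zw(1,2,4)] by (auto simp: E_def q_def)
            then have "e \<in> LE" using e zw by (force simp: LE_def)
            then show False using n by blast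
          qed
          moreover have "q ` e \<subseteq> {..<Suc k}" using p by (auto simp: q_def less_Suc_eq)
          ultimately have "e \<in> rainbow V q {..<Suc k}" using D(4,5)[OF e] by (intro rainbowI) auto
          then show False using n e by blast
        qed
      qed
      moreover have fins: "finite (L \<inter> rainbow V q {..<Suc k})" "finite L0" "finite L2" "finite LE"
        using D(7) by (auto simp: L0_def L2_def LE_def intro: rev_finite_subset[OF D(7)])
      ultimately have "card L \<le> card ((L \<inter> rainbow V q {..<Suc k}) \<union> L0 \<union> L2 \<union> LE)"
        by (intro card_mono) auto
      also have "\<dots> \<le> card (L \<inter> rainbow V q {..<Suc k}) + card L0 + card L2 + card LE"
        by (intro order_trans[OF card_Un_le] add_right_mono) (rule order_refl)
      finally have "real (card L) \<le> card (L \<inter> rainbow V q {..<Suc k}) + card L0 + card L2 + card LE"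
        by linarith
      moreover have "card L0 \<le> g * Q"
      proof -
        have "card L0 \<le> card {(e, c)\<in>extensions V G L. c = x}"
        proof (rule card_inj_on_le[where f = "\<lambda>e. (e, x)"])
          show "(\<lambda>e. (e, x)) ` L0 \<subseteq> {(e, c)\<in>extensions V G L. c = x}"
          proof
            fix z assume "z \<in> (\<lambda>e. (e, x)) ` L0"
            then obtain e where e: "z = (e, x)" "e \<in> L" "e \<subseteq> U" by (auto simp: L0_def)
            have "G u x" if "u \<in> e" for u using e(3) that D(2)[of x u] by (auto simp: U_def nbhd_def)
            then show "z \<in> {(e, c)\<in>extensions V G L. c = x}" using e(1,2) x by (simp add: extensions_def)
          qed
          show "finite {(e, c)\<in>extensions V G L. c = x}" using D(8) by (rule rev_finite_subset) auto
        qed (auto simp: inj_on_def)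
        then show ?thesis using extx1(2) unfolding Q_def by linarith
      qed
      moreover have "card LE \<le> 3 * \<epsilon> / 16 * Q"
      proof -
        have fE: "finite E" by (rule finite_subset[of _ "U \<times> U"]) (use fU in \<open>auto simp: E_def\<close>)
        have ce: "card {e\<in>L. {fst z, snd z} \<subseteq> e} \<le> card V ^ (k - 1)" if "z \<in> E" for z
        proof -
          have "fst z \<noteq> snd z" "fst z \<in> V" "snd z \<in> V" using that D(3) UV by (auto simp: E_def)
          then have "card {e\<in>L. {fst z, snd z} \<subseteq> e} \<le> card V ^ (Suc k - card {fst z, snd z})"
            using D(1,4,5) by (intro card_edges_containing) auto
          then show ?thesis using \<open>fst z \<noteq> snd z\<close> by simp
        qed
        have "card LE \<le> (\<Sum>z\<in>E. card {e\<in>L. {fst z, snd z} \<subseteq> e})"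
          unfolding LE_def using fE by (rule card_UN_le)
        also have "\<dots> \<le> (\<Sum>z\<in>E. card V ^ (k - 1))" using ce by (rule sum_mono)
        finally have "card LE \<le> card E * card V ^ (k - 1)" by simp
        then have "real (card LE) \<le> card E * real (card V) ^ (k - 1)"
          by (metis of_nat_le_iff of_nat_mult of_nat_power)
        also have "\<dots> \<le> 3 * \<epsilon> / 16 * (N * N) * N ^ (k - 1)"
          using cE VN \<epsilon> N by (intro mult_mono power_mono) auto
        also have "\<dots> = 3 * \<epsilon> / 16 * Q"
          using k by (simp add: Q_def P_def power_eq_if)
        finally show ?thesis .
      qed
      moreover have "real (card L2) \<le> \<epsilon>' * Q + \<kappa> * Q" using B2 unfolding B2_def L2_def .
      ultimately have "s - \<epsilon> * Q \<le> card (L \<inter> rainbow V q {..<Suc k})"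
        using big lin by linarith
      moreover have "q v < Suc k" for v using p[of v] by (auto simp: q_def less_Suc_eq)
      ultimately show ?thesis by blast
    qed
    show ?thesis unfolding NP s_def[symmetric] Q_def[symmetric] using concl1 concl2 by blast
  qed
qed

text \<open>The upper bound and the colouring are proved together: passing from \<open>k\<close> to
  \<open>k + 1\<close> uses the bound for the link as well as its colouring.\<close>

lemma stability:
  assumes "1 \<le> k"
  shows "\<forall>\<epsilon>>0. \<exists>\<gamma>>0. \<forall>N (V :: 'a set) G L. 0 < N \<longrightarrow> cliqued k V G L \<longrightarrow> real (card V) \<le> N \<longrightarrow>
      real (card (extensions V G L)) \<le> \<gamma> * N ^ (k + 1) \<longrightarrow>
      real (card L) \<le> (card V / k) ^ k + \<epsilon> * N ^ k \<and>
      ((card V / k) ^ k - \<gamma> * N ^ k \<le> card L \<longrightarrow>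
        (\<exists>p :: 'a \<Rightarrow> nat. (\<forall>v\<in>V. p v < k) \<and> (card V / k) ^ k - \<epsilon> * N ^ k \<le> card (L \<inter> rainbow V p {..<k})))"
  using assms
proof (induction k rule: dec_induct)
  case base
  show ?case
  proof (intro allI impI)
    fix \<epsilon> :: real assume "\<epsilon> > 0"
    show "\<exists>\<gamma>>0. \<forall>N (V :: 'a set) G L. 0 < N \<longrightarrow> cliqued 1 V G L \<longrightarrow> real (card V) \<le> N \<longrightarrow>
      real (card (extensions V G L)) \<le> \<gamma> * N ^ (1 + 1) \<longrightarrow>
      real (card L) \<le> (card V / real 1) ^ 1 + \<epsilon> * N ^ 1 \<and>
      ((card V / real 1) ^ 1 - \<gamma> * N ^ 1 \<le> card L \<longrightarrow>
        (\<exists>p :: 'a \<Rightarrow> nat. (\<forall>v\<in>V. p v < 1) \<and> (card V / real 1) ^ 1 - \<epsilon> * N ^ 1 \<le> card (L \<inter> rainbow V p {..<1})))"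
    proof (rule exI[of _ \<epsilon>], intro conjI allI impI)
      fix N :: real and V :: "'a set" and G L
      assume N: "0 < N" and cl: "cliqued 1 V G L"
      note D = cliquedD[OF cl]
      have "card L \<le> card {e. e \<subseteq> V \<and> card e = 1}"
        using D(1,4,5) by (intro card_mono) auto
      also have "\<dots> \<le> card V" using card_subsets_le[OF D(1), of 1] by simp
      finally show "real (card L) \<le> (card V / real 1) ^ 1 + \<epsilon> * N ^ 1"
        using N \<open>\<epsilon> > 0\<close> by (simp add: add_increasing2)
      assume c: "(card V / real 1) ^ 1 - \<epsilon> * N ^ 1 \<le> card L"
      have "e \<in> rainbow V (\<lambda>_. 0::nat) {..<1}" if e: "e \<in> L" for e
        using D(4)[OF e] D(5)[OF e] by (intro rainbowI) (auto simp: card_1_singleton_iff)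
      then have "L \<inter> rainbow V (\<lambda>_. 0::nat) {..<1} = L" by blast
      then show "\<exists>p :: 'a \<Rightarrow> nat. (\<forall>v\<in>V. p v < 1) \<and> (card V / real 1) ^ 1 - \<epsilon> * N ^ 1 \<le> card (L \<inter> rainbow V p {..<1})"
        using c by (intro exI[of _ "\<lambda>_. 0"]) (simp del: One_nat_def)
    qed fact
  qed
next
  case (step k)
  show ?case
  proof (intro allI impI)
    fix \<epsilon>0 :: real assume \<epsilon>0: "\<epsilon>0 > 0"
    define \<epsilon> where "\<epsilon> = min \<epsilon>0 1"
    have \<epsilon>: "\<epsilon> > 0" "\<epsilon> \<le> 1" "\<epsilon> \<le> \<epsilon>0" using \<epsilon>0 by (auto simp: \<epsilon>_def)
    define \<epsilon>' where "\<epsilon>' = \<epsilon>\<^sup>2 / 64"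
    have \<epsilon>': "\<epsilon>' > 0" using \<epsilon> by (simp add: \<epsilon>'_def)
    from step(3)[THEN spec, THEN mp, OF \<epsilon>'] obtain \<gamma>0
      where \<gamma>0_IH: "0 < \<gamma>0 \<and> (\<forall>N (V :: 'a set) G L. 0 < N \<longrightarrow> cliqued k V G L \<longrightarrow> real (card V) \<le> N \<longrightarrow>
      real (card (extensions V G L)) \<le> \<gamma>0 * N ^ (k + 1) \<longrightarrow>
      real (card L) \<le> (card V / k) ^ k + \<epsilon>' * N ^ k \<and>
      ((card V / k) ^ k - \<gamma>0 * N ^ k \<le> card L \<longrightarrow>
        (\<exists>p :: 'a \<Rightarrow> nat. (\<forall>v\<in>V. p v < k) \<and> (card V / k) ^ k - \<epsilon>' * N ^ k \<le> card (L \<inter> rainbow V p {..<k}))))"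
      by (rule exE)
    note \<gamma>0 = \<gamma>0_IH[THEN conjunct1]
      and IH = \<gamma>0_IH[THEN conjunct2, THEN spec, THEN spec, THEN spec, THEN spec, THEN mp, THEN mp, THEN mp, THEN mp]
    define \<gamma>' where "\<gamma>' = min \<gamma>0 1"
    have \<gamma>': "\<gamma>' > 0" "\<gamma>' \<le> 1" "\<gamma>' \<le> \<gamma>0" using \<gamma>0 by (auto simp: \<gamma>'_def)
    \<comment> \<open>Makes
      \<open>(k + 4) * \<gamma>1 = \<gamma>' * \<epsilon>\<^sup>2 / 64\<close>, which meets both
      requirements on \<open>\<kappa>\<close>. The constant finally supplied is
      \<open>\<gamma>1\<^sup>2\<close>, because the passage to a vertex in few extensions takes a
      square root.\<close>
    define \<gamma>1 where "\<gamma>1 = \<gamma>' * \<epsilon>\<^sup>2 / (64 * (k + 4))"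
    have e2: "\<epsilon>\<^sup>2 \<le> \<epsilon>" "\<epsilon>\<^sup>2 > 0" using \<epsilon> by (auto simp: power2_eq_square mult_left_le)
    have \<gamma>1pos: "\<gamma>1 > 0" using \<gamma>' e2 by (simp add: \<gamma>1_def)
    have g64: "(real k + 4) * \<gamma>1 = \<gamma>' * \<epsilon>\<^sup>2 / 64" by (simp add: \<gamma>1_def field_simps)
    have \<gamma>e: "\<gamma>' * \<epsilon>\<^sup>2 \<le> \<epsilon>\<^sup>2" "\<gamma>' * \<epsilon>\<^sup>2 \<le> \<gamma>'"
      using \<gamma>' e2 \<epsilon> by (auto simp: mult_left_le mult_left_le_one_le)
    have "1 * \<gamma>1 \<le> (real k + 4) * \<gamma>1" using \<gamma>1pos by (intro mult_right_mono) auto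
    then have \<gamma>1: "\<gamma>1 \<le> 1" "\<gamma>1 \<le> \<gamma>0" "\<gamma>1 \<le> \<epsilon>\<^sup>2 / 64" using g64 \<gamma>e \<gamma>' e2 \<epsilon> by linarith+
    define \<kappa> where "\<kappa> = (real k + 4) * \<gamma>1"
    show "\<exists>\<gamma>>0. \<forall>N (V :: 'a set) G L. 0 < N \<longrightarrow> cliqued (Suc k) V G L \<longrightarrow> real (card V) \<le> N \<longrightarrow>
      real (card (extensions V G L)) \<le> \<gamma> * N ^ (Suc k + 1) \<longrightarrow>
      real (card L) \<le> (card V / Suc k) ^ Suc k + \<epsilon>0 * N ^ Suc k \<and>
      ((card V / Suc k) ^ Suc k - \<gamma> * N ^ Suc k \<le> card L \<longrightarrow>
        (\<exists>p :: 'a \<Rightarrow> nat. (\<forall>v\<in>V. p v < Suc k) \<and> (card V / Suc k) ^ Suc k - \<epsilon>0 * N ^ Suc k \<le> card (L \<inter> rainbow V p {..<Suc k})))"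
    proof (rule exI[of _ "\<gamma>1\<^sup>2"], intro conjI[of "0 < \<gamma>1\<^sup>2"] allI impI)
      show "0 < \<gamma>1\<^sup>2" using \<gamma>1pos by simp
      fix N :: real and V :: "'a set" and G L
      assume N: "0 < N" and cl: "cliqued (Suc k) V G L" and VN: "real (card V) \<le> N"
        and ext: "real (card (extensions V G L)) \<le> \<gamma>1\<^sup>2 * N ^ (Suc k + 1)"
      show "real (card L) \<le> (card V / Suc k) ^ Suc k + \<epsilon>0 * N ^ Suc k \<and>
      ((card V / Suc k) ^ Suc k - \<gamma>1\<^sup>2 * N ^ Suc k \<le> card L \<longrightarrow>
        (\<exists>p :: 'a \<Rightarrow> nat. (\<forall>v\<in>V. p v < Suc k) \<and> (card V / Suc k) ^ Suc k - \<epsilon>0 * N ^ Suc k \<le> card (L \<inter> rainbow V p {..<Suc k})))"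
      proof -
        have IH2: "real (card L') \<le> (card V' / k) ^ k + \<epsilon>' * N ^ k \<and>
          ((card V' / k) ^ k - \<gamma>0 * N ^ k \<le> card L' \<longrightarrow>
            (\<exists>p :: 'a \<Rightarrow> nat. (\<forall>v\<in>V'. p v < k) \<and> (card V' / k) ^ k - \<epsilon>' * N ^ k \<le> card (L' \<inter> rainbow V' p {..<k})))"
          if "cliqued k V' G L'" "real (card V') \<le> N" "real (card (extensions V' G L')) \<le> \<gamma>1 * N ^ (k + 1)"
          for V' :: "'a set" and L'
        proof (rule IH[OF N that(1,2)])
          have "\<gamma>1 * N ^ (k + 1) \<le> \<gamma>0 * N ^ (k + 1)" using \<gamma>1(2) N by (intro mult_right_mono) auto
          then show "real (card (extensions V' G L')) \<le> \<gamma>0 * N ^ (k + 1)" using that(3) by linarith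
        qed
        have \<kappa>12: "\<kappa> \<le> \<epsilon>\<^sup>2 / 64" "\<kappa> \<le> \<gamma>0 * (\<epsilon> / 4)"
        proof -
          show "\<kappa> \<le> \<epsilon>\<^sup>2 / 64" using g64 \<gamma>e by (simp add: \<kappa>_def)
          have "\<gamma>' * \<epsilon>\<^sup>2 \<le> \<gamma>0 * \<epsilon>" using \<gamma>' e2 \<epsilon> by (intro mult_mono) auto
          moreover have "0 \<le> \<gamma>0 * \<epsilon>" using \<gamma>0 \<epsilon> by simp
          ultimately show "\<kappa> \<le> \<gamma>0 * (\<epsilon> / 4)" using g64 by (simp add: \<kappa>_def)
        qed
        have le: "\<epsilon> * N ^ Suc k \<le> \<epsilon>0 * N ^ Suc k" using \<epsilon> N by (intro mult_right_mono) auto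
        then have le': "a \<le> b + \<epsilon> * N ^ Suc k \<Longrightarrow> a \<le> b + \<epsilon>0 * N ^ Suc k"
          "b - \<epsilon> * N ^ Suc k \<le> a \<Longrightarrow> b - \<epsilon>0 * N ^ Suc k \<le> a" for a b by linarith+
        from stability_step[OF step(1) N cl VN ext IH2 \<gamma>1pos \<gamma>1(1) \<epsilon>(1,2) \<epsilon>'_def \<kappa>_def \<kappa>12 \<gamma>0]
        show ?thesis using le' by blast
      qed
    qed
  qed
qed

section \<open>Embedding fans\<close>

definition fan_embedding :: "nat \<Rightarrow> 'a set \<Rightarrow> 'a set set \<Rightarrow> (fan_vertex \<Rightarrow> 'a) \<Rightarrow> bool" where
  "fan_embedding r V E g \<longleftrightarrow> inj_on g (verts (fan r)) \<and> g ` verts (fan r) \<subseteq> V \<and> (\<forall>e\<in>edges (fan r). g ` e \<in> E)"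

lemma verts_fan: "verts (fan r) = insert Centre (Transv ` {..<r} \<union> (\<Union>i<r. Petal i ` {..<r - 2}))"
  by (auto simp: fan_def petal_set_def)

lemma edges_fan: "edges (fan r) = insert (Transv ` {..<r})
    ((\<lambda>i. insert Centre (insert (Transv i) (Petal i ` {..<r - 2}))) ` {..<r})"
  by (simp add: fan_def petal_set_def)

lemma finite_verts_fan: "finite (verts (fan r))"
  by (simp add: verts_fan)

lemma card_verts_fan_le:
  assumes "2 \<le> r"
  shows "card (verts (fan r)) \<le> r * r"
proof -
  have "card (\<Union>i<r. Petal i ` {..<r - 2}) \<le> (\<Sum>i<r. card (Petal i ` {..<r - 2}))"
    by (rule card_UN_le) simp
  also have "\<dots> \<le> (\<Sum>i<r. r - 2)" by (intro sum_mono) (use card_image_le[of "{..<r - 2}"] in fastforce)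
  finally have "card (\<Union>i<r. Petal i ` {..<r - 2}) \<le> r * (r - 2)" by simp
  moreover have "card (Transv ` {..<r}) \<le> r" using card_image_le[of "{..<r}" Transv] by simp
  ultimately have "card (Transv ` {..<r} \<union> (\<Union>i<r. Petal i ` {..<r - 2})) \<le> r + r * (r - 2)"
    using card_Un_le[of "Transv ` {..<r}" "\<Union>i<r. Petal i ` {..<r - 2}"] by linarith
  then have "card (verts (fan r)) \<le> 1 + r + r * (r - 2)"
    unfolding verts_fan by (simp add: card_insert_if)
  moreover obtain s where "r = s + 2" using assms by (metis add.commute le_Suc_ex)
  ultimately show ?thesis by simp
qed

lemma fan_embedding_card_le:
  assumes "2 \<le> r"
  shows "finite (g ` verts (fan r))" "card (g ` verts (fan r)) \<le> r * r"
  using card_image_le[OF finite_verts_fan[of r], of g] card_verts_fan_le[OF assms] finite_verts_fan[of r]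
  by simp_all

lemma contains_copy_if_fans:
  assumes g: "\<And>i. i < t \<Longrightarrow> fan_embedding r V E (g i)"
    and dis: "\<And>i i'. i < i' \<Longrightarrow> i' < t \<Longrightarrow> g i ` verts (fan r) \<inter> g i' ` verts (fan r) = {}"
    and tr: "\<And>\<iota>. \<iota> ` {..<r} \<subseteq> {..<t} \<Longrightarrow> (\<lambda>j. g (\<iota> j) (Transv j)) ` {..<r} \<in> E"
  shows "contains_copy (Hypergraph V E) (semi_blowup_fan r t)"
proof -
  define f where "f = (\<lambda>(i, v). g i v)"
  have f: "f (i, v) = g i v" for i v by (simp add: f_def)
  have vs: "verts (semi_blowup_fan r t) = {..<t} \<times> verts (fan r)" by (simp add: semi_blowup_fan_def)
  have "inj_on f (verts (semi_blowup_fan r t))"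
  proof (rule inj_onI)
    fix a b assume a: "a \<in> verts (semi_blowup_fan r t)" "b \<in> verts (semi_blowup_fan r t)" "f a = f b"
    obtain i v where iv: "a = (i, v)" by (cases a)
    obtain j w where jw: "b = (j, w)" by (cases b)
    have m: "i < t" "j < t" "v \<in> verts (fan r)" "w \<in> verts (fan r)" "g i v = g j w"
      using a by (simp_all add: iv jw vs f)
    have "i = j" using dis[of i j] dis[of j i] m by (metis disjoint_iff imageI linorder_neqE_nat)
    moreover have "v = w" using g[OF m(1)] m \<open>i = j\<close> by (auto simp: fan_embedding_def dest: inj_onD)
    ultimately show "a = b" by (simp add: iv jw)
  qed
  moreover have "f ` verts (semi_blowup_fan r t) \<subseteq> V"
  proof
    fix y assume "y \<in> f ` verts (semi_blowup_fan r t)"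
    then obtain i v where "i < t" "v \<in> verts (fan r)" "y = g i v" by (auto simp: vs f)
    then show "y \<in> V" using g by (auto simp: fan_embedding_def)
  qed
  moreover have "f ` e \<in> E" if e: "e \<in> edges (semi_blowup_fan r t)" for e
  proof -
    have "(\<exists>i e'. e = Pair i ` e' \<and> i < t \<and> e' \<in> edges (fan r)) \<or>
      (\<exists>\<iota>. e = (\<lambda>j. (\<iota> j, Transv j)) ` {..<r} \<and> \<iota> ` {..<r} \<subseteq> {..<t})"
      using e by (auto simp: semi_blowup_fan_def)
    then show ?thesis
    proof (elim disjE exE conjE)
      fix i e' assume "e = Pair i ` e'" "i < t" "e' \<in> edges (fan r)"
      then show ?thesis using g[of i] by (simp add: fan_embedding_def image_image f)
    next
      fix \<iota> assume "e = (\<lambda>j. (\<iota> j, Transv j)) ` {..<r}" "\<iota> ` {..<r} \<subseteq> {..<t}"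
      then show ?thesis using tr[of \<iota>] by (simp add: image_image f)
    qed
  qed
  ultimately show ?thesis by (auto simp: contains_copy_def)
qed

section \<open>Robust pairs and the greedy choice of petals\<close>

text \<open>\<open>K\<close> will exceed the number of vertices of everything built, so a robust
  pair is as good as a petal whose remaining vertices are chosen last.\<close>

definition robust_pair :: "nat \<Rightarrow> 'a set set \<Rightarrow> 'a \<Rightarrow> 'a \<Rightarrow> bool" where
  "robust_pair K E x y \<longleftrightarrow> x \<noteq> y \<and>
     (\<forall>U. finite U \<and> card U \<le> K \<and> x \<notin> U \<and> y \<notin> U \<longrightarrow> (\<exists>e\<in>E. x \<in> e \<and> y \<in> e \<and> e \<inter> U = {}))"

lemma robust_pair_sym: "robust_pair K E x y \<Longrightarrow> robust_pair K E y x"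
  unfolding robust_pair_def by blast

text \<open>Greedy choice: each petal adds \<open>r - 2\<close> vertices to the set that the next
  one avoids, and \<open>K\<close> covers the final size of that set.\<close>

lemma petals_exist:
  assumes "finite J" "\<And>j. j \<in> J \<Longrightarrow> robust_pair K E c (\<tau> j)" "finite B" "card B + card J * (r - 2) \<le> K"
    and E: "\<And>e. e \<in> E \<Longrightarrow> finite e \<and> card e = r"
  shows "\<exists>P. (\<forall>j\<in>J. insert c (insert (\<tau> j) (P j)) \<in> E \<and> P j \<inter> insert c (insert (\<tau> j) B) = {} \<and>
      finite (P j) \<and> card (P j) = r - 2) \<and> (\<forall>i\<in>J. \<forall>j\<in>J. i \<noteq> j \<longrightarrow> P i \<inter> P j = {})"
  using assms(1,2,4)
proof (induction J)
  case empty
  then show ?case by simp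
next
  case (insert j J)
  have "card B + card J * (r - 2) \<le> K" using insert by simp
  then have "\<exists>P. (\<forall>j\<in>J. insert c (insert (\<tau> j) (P j)) \<in> E \<and> P j \<inter> insert c (insert (\<tau> j) B) = {} \<and>
      finite (P j) \<and> card (P j) = r - 2) \<and> (\<forall>i\<in>J. \<forall>j\<in>J. i \<noteq> j \<longrightarrow> P i \<inter> P j = {})"
    using insert.IH insert.prems(1) by blast
  then obtain P where P: "\<And>i. i \<in> J \<Longrightarrow> insert c (insert (\<tau> i) (P i)) \<in> E \<and> P i \<inter> insert c (insert (\<tau> i) B) = {} \<and>
      finite (P i) \<and> card (P i) = r - 2" "\<And>i k. i \<in> J \<Longrightarrow> k \<in> J \<Longrightarrow> i \<noteq> k \<Longrightarrow> P i \<inter> P k = {}"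
    by (elim exE) (simp, blast)
  \<comment> \<open>Robustness speaks only of sets avoiding the pair, while the \<open>B\<close> of
    the application contains the centre and all transversal vertices; hence \<open>c\<close> and
    \<open>\<tau> j\<close> are removed.\<close>
  define U where "U = (B \<union> (\<Union>i\<in>J. P i)) - {c, \<tau> j}"
  have "card U \<le> card (B \<union> (\<Union>i\<in>J. P i))" unfolding U_def using P assms insert by (intro card_mono) auto
  also have "\<dots> \<le> card B + card (\<Union>i\<in>J. P i)" by (rule card_Un_le)
  also have "card (\<Union>i\<in>J. P i) \<le> (\<Sum>i\<in>J. card (P i))" using insert by (intro card_UN_le)
  also have "\<dots> = card J * (r - 2)" using P by simp
  also have "card B + \<dots> \<le> K" by fact
  finally have "card U \<le> K" by simp
  moreover have "finite U" "c \<notin> U" "\<tau> j \<notin> U" using P assms insert by (auto simp: U_def)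
  moreover have rp: "robust_pair K E c (\<tau> j)" using insert by simp
  ultimately obtain e where e: "e \<in> E" "c \<in> e" "\<tau> j \<in> e" "e \<inter> U = {}" "c \<noteq> \<tau> j"
    unfolding robust_pair_def by blast
  define A where "A = e - {c, \<tau> j}"
  have A1: "insert c (insert (\<tau> j) A) = e" using e by (auto simp: A_def)
  have A2: "A \<inter> (B \<union> (\<Union>i\<in>J. P i)) = {}" using e(4) by (auto simp: A_def U_def)
  have A3: "finite A" "card A = r - 2" using E[OF e(1)] e by (auto simp: A_def card_Diff_subset)
  have A4: "c \<notin> A" "\<tau> j \<notin> A" by (auto simp: A_def)
  have Pj: "(P(j := A)) i = P i" if "i \<in> J" for i using that insert by auto
  show ?case
  proof (rule exI[of _ "P(j := A)"], intro conjI ballI impI)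
    fix i assume i: "i \<in> insert j J"
    consider "i = j" | "i \<in> J" "i \<noteq> j" using i by blast
    then show "insert c (insert (\<tau> i) ((P(j := A)) i)) \<in> E" "(P(j := A)) i \<inter> insert c (insert (\<tau> i) B) = {}"
      "finite ((P(j := A)) i)" "card ((P(j := A)) i) = r - 2"
      using A1 A2 A3 A4 e P(1)[of i] by (cases; auto)+
    fix k assume k: "k \<in> insert j J" "i \<noteq> k"
    consider "i = j" "k \<in> J" | "i \<in> J" "k = j" | "i \<in> J" "k \<in> J" using i k by blast
    then show "(P(j := A)) i \<inter> (P(j := A)) k = {}"
    proof cases
      case 1
      then show ?thesis using A2 k by auto
    next
      case 2
      then show ?thesis using A2 k by auto
    next
      case 3
      then show ?thesis using P(2)[of i k] k Pj by simp
    qed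
  qed
qed

lemma fan_from_petals:
  assumes \<tau>: "inj_on \<tau> {..<r}" "c \<notin> \<tau> ` {..<r}" "\<tau> ` {..<r} \<in> E"
    and P: "\<And>j. j < r \<Longrightarrow> insert c (insert (\<tau> j) (P j)) \<in> E" "\<And>j. j < r \<Longrightarrow> P j \<inter> insert c (\<tau> ` {..<r}) = {}"
      "\<And>j. j < r \<Longrightarrow> finite (P j) \<and> card (P j) = r - 2"
      "\<And>i j. i < r \<Longrightarrow> j < r \<Longrightarrow> i \<noteq> j \<Longrightarrow> P i \<inter> P j = {}"
    and EV: "\<And>e. e \<in> E \<Longrightarrow> e \<subseteq> V" and r: "0 < r"
  shows "\<exists>g. fan_embedding r V E g \<and> g Centre = c \<and> (\<forall>j<r. g (Transv j) = \<tau> j) \<and>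
    g ` verts (fan r) = insert c (\<tau> ` {..<r} \<union> (\<Union>j<r. P j))"
proof -
  have "\<forall>j. \<exists>h. j < r \<longrightarrow> bij_betw h {..<r - 2} (P j)"
    using P(3) ex_bij_betw_nat_finite[of "P _"] by (metis atLeast0LessThan)
  then obtain h where h: "\<And>j. j < r \<Longrightarrow> bij_betw (h j) {..<r - 2} (P j)" by metis
  define g where "g v = (case v of Centre \<Rightarrow> c | Transv j \<Rightarrow> \<tau> j | Petal j k \<Rightarrow> h j k)" for v
  have gP: "g ` Petal j ` {..<r - 2} = P j" if "j < r" for j
    using h[OF that] by (simp add: g_def image_image bij_betw_def)
  have gT: "g ` Transv ` {..<r} = \<tau> ` {..<r}" by (simp add: g_def image_image)
  have gv: "g ` verts (fan r) = insert c (\<tau> ` {..<r} \<union> (\<Union>j<r. P j))"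
    using gP gT by (simp add: verts_fan image_Un image_UN) (simp add: g_def)
  have hP: "h j k \<in> P j" if "j < r" "k < r - 2" for j k using h[OF that(1)] that by (auto simp: bij_betw_def)
  have "inj_on g (verts (fan r))"
  proof (rule inj_onI)
    fix x y assume xy: "x \<in> verts (fan r)" "y \<in> verts (fan r)" "g x = g y"
    have "h i k = h j l \<Longrightarrow> i = j \<and> k = l" if "i < r" "j < r" "k < r - 2" "l < r - 2" for i j k l
    proof -
      assume eq: "h i k = h j l"
      have "i = j" using P(4)[OF that(1,2)] hP[OF that(1,3)] hP[OF that(2,4)] eq by auto
      then show ?thesis using h[OF that(1)] that eq by (auto simp: bij_betw_def dest: inj_onD)
    qed
    moreover have "h i k \<noteq> c" "h i k \<noteq> \<tau> j" if "i < r" "j < r" "k < r - 2" for i j k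
      using P(2)[OF that(1)] hP[OF that(1,3)] that by auto
    moreover have "c \<noteq> \<tau> j" if "j < r" for j using \<tau>(2) that by auto
    moreover have "\<tau> i = \<tau> j \<Longrightarrow> i = j" if "i < r" "j < r" for i j using \<tau>(1) that by (auto dest: inj_onD)
    ultimately show "x = y" using xy unfolding verts_fan by (auto simp: g_def) metis+
  qed
  moreover have "g ` verts (fan r) \<subseteq> V"
    unfolding gv using EV[OF \<tau>(3)] EV[OF P(1)] r by auto
  moreover have "g ` e \<in> E" if "e \<in> edges (fan r)" for e
  proof -
    have "e = Transv ` {..<r} \<or> (\<exists>i<r. e = insert Centre (insert (Transv i) (Petal i ` {..<r - 2})))"
      using that by (auto simp: edges_fan)
    then show ?thesis
    proof (elim disjE exE conjE)
      assume "e = Transv ` {..<r}"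
      then show ?thesis using gT \<tau>(3) by simp
    next
      fix i assume "i < r" "e = insert Centre (insert (Transv i) (Petal i ` {..<r - 2}))"
      then show ?thesis using gP[of i] P(1)[of i] by simp (simp add: g_def)
    qed
  qed
  ultimately show ?thesis using gv by (intro exI[of _ g]) (auto simp: fan_embedding_def, auto simp: g_def)
qed

text \<open>All petals come from robust pairs except possibly one, at index \<open>j0\<close>, which
  is a given edge \<open>e0\<close>. The exception exists for edges with two vertices of the same
  colour: the centre need not have any robust neighbour of its own colour there, and the edge itself
  supplies that petal.\<close>

lemma fan_exists:
  assumes r: "2 \<le> r" and E: "\<And>e. e \<in> E \<Longrightarrow> e \<subseteq> V \<and> finite e \<and> card e = r"
    and \<tau>: "inj_on \<tau> {..<r}" "c \<notin> \<tau> ` {..<r}" "\<tau> ` {..<r} \<in> E"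
    and J: "J \<subseteq> {..<r}" "\<And>j. j \<in> J \<Longrightarrow> robust_pair K E c (\<tau> j)" "\<And>j. j < r \<Longrightarrow> j \<notin> J \<Longrightarrow> j = j0"
    and e0: "J \<noteq> {..<r} \<Longrightarrow> e0 \<in> E \<and> c \<in> e0 \<and> \<tau> j0 \<in> e0 \<and> e0 \<inter> \<tau> ` ({..<r} - {j0}) = {} \<and> e0 \<inter> B = {}"
    and B: "finite B" "insert c (\<tau> ` {..<r}) \<inter> B = {}" "card B + r * r + 1 \<le> K"
  shows "\<exists>g. fan_embedding r V E g \<and> g Centre = c \<and> (\<forall>j<r. g (Transv j) = \<tau> j) \<and> g ` verts (fan r) \<inter> B = {}"
proof -
  define e1 where "e1 = (if J = {..<r} then {} else e0)"
  define B' where "B' = B \<union> insert c (\<tau> ` {..<r}) \<union> e1"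
  have e1: "finite e1" "card e1 \<le> r" "e1 \<inter> B = {}" using e0 E by (auto simp: e1_def)
  have fJ: "finite J" using J finite_subset by blast
  \<comment> \<open>The centre and transversal vertices contribute \<open>1 + r\<close>, the given
    petal \<open>r\<close>, and the chosen petals at most \<open>r * (r - 2)\<close>; together this
    is the \<open>r * r + 1\<close> of the hypothesis.\<close>
  have "card B' \<le> card B + (1 + r) + r"
  proof -
    have "card (\<tau> ` {..<r}) \<le> r" using card_image_le[of "{..<r}" \<tau>] by simp
    then have "card (insert c (\<tau> ` {..<r})) \<le> 1 + r" by (simp add: card_insert_if)
    then show ?thesis unfolding B'_def
      using card_Un_le[of "B \<union> insert c (\<tau> ` {..<r})" e1] card_Un_le[of B "insert c (\<tau> ` {..<r})"] e1(2) by linarith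
  qed
  moreover have "card J * (r - 2) \<le> r * (r - 2)" using card_mono[OF _ J(1)] by simp
  moreover have "r * (r - 2) + r + r = r * r"
  proof -
    obtain s where "r = s + 2" using r by (metis add.commute le_Suc_ex)
    then show ?thesis by simp
  qed
  ultimately have "card B' + card J * (r - 2) \<le> K" using B(3) by linarith
  moreover have "finite B'" using B e1 by (simp add: B'_def)
  ultimately obtain P where P: "\<And>j. j \<in> J \<Longrightarrow> insert c (insert (\<tau> j) (P j)) \<in> E"
      "\<And>j. j \<in> J \<Longrightarrow> P j \<inter> B' = {}" "\<And>j. j \<in> J \<Longrightarrow> finite (P j) \<and> card (P j) = r - 2"
      "\<And>i j. i \<in> J \<Longrightarrow> j \<in> J \<Longrightarrow> i \<noteq> j \<Longrightarrow> P i \<inter> P j = {}"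
  proof -
    assume "card B' + card J * (r - 2) \<le> K" "finite B'"
    then have "\<exists>P. (\<forall>j\<in>J. insert c (insert (\<tau> j) (P j)) \<in> E \<and> P j \<inter> insert c (insert (\<tau> j) B') = {} \<and>
      finite (P j) \<and> card (P j) = r - 2) \<and> (\<forall>i\<in>J. \<forall>j\<in>J. i \<noteq> j \<longrightarrow> P i \<inter> P j = {})"
      using E J(2) by (intro petals_exist[OF fJ]) auto
    then show ?thesis using that by (elim exE) (simp, blast)
  qed
  define P' where "P' j = (if j \<in> J then P j else e0 - {c, \<tau> j0})" for j
  have nJ: "e0 \<in> E" "c \<in> e0" "\<tau> j0 \<in> e0" "e0 \<inter> \<tau> ` ({..<r} - {j0}) = {}" "e0 \<inter> B = {}" "e1 = e0" "j = j0"
    if "j < r" "j \<notin> J" for j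
    using e0 that J(3) by (auto simp: e1_def)
  have "insert c (insert (\<tau> j) (P' j)) \<in> E \<and> P' j \<inter> insert c (\<tau> ` {..<r}) = {} \<and> finite (P' j) \<and> card (P' j) = r - 2 \<and> P' j \<inter> B = {}"
    if j: "j < r" for j
  proof (cases "j \<in> J")
    case True
    then show ?thesis using P(1,2,3)[of j] by (auto simp: P'_def B'_def)
  next
    case False
    note n = nJ[OF j False]
    have "insert c (insert (\<tau> j) (P' j)) = e0" using n False by (auto simp: P'_def)
    moreover have "P' j \<inter> insert c (\<tau> ` {..<r}) = {}" using n(4) False by (auto simp: P'_def)
    moreover have "c \<noteq> \<tau> j0" using \<tau>(2) j n(7) by auto
    moreover have "finite (P' j)" "card (P' j) = r - 2"
      using E[OF n(1)] n False \<open>c \<noteq> \<tau> j0\<close> by (auto simp: P'_def card_Diff_subset)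
    moreover have "P' j \<inter> B = {}" using n(5) False by (auto simp: P'_def)
    ultimately show ?thesis using n(1) by simp
  qed
  note P'1 = this
  have P'2: "P' i \<inter> P' j = {}" if ij: "i < r" "j < r" "i \<noteq> j" for i j
  proof -
    consider "i \<in> J" "j \<in> J" | "i \<in> J" "j \<notin> J" | "i \<notin> J" "j \<in> J" using J(3)[of i] J(3)[of j] ij by blast
    then show ?thesis
    proof cases
      case 1
      then show ?thesis using P(4)[of i j] ij by (simp add: P'_def)
    next
      case 2
      then show ?thesis using P(2)[of i] nJ[OF ij(2)] by (auto simp: P'_def B'_def)
    next
      case 3
      then show ?thesis using P(2)[of j] nJ[OF ij(1)] by (auto simp: P'_def B'_def)
    qed
  qed
  have "\<exists>g. fan_embedding r V E g \<and> g Centre = c \<and> (\<forall>j<r. g (Transv j) = \<tau> j) \<and>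
    g ` verts (fan r) = insert c (\<tau> ` {..<r} \<union> (\<Union>j<r. P' j))"
    using P'1 P'2 E r by (intro fan_from_petals \<tau>) auto
  then obtain g where "fan_embedding r V E g" "g Centre = c" "\<forall>j<r. g (Transv j) = \<tau> j"
    "g ` verts (fan r) = insert c (\<tau> ` {..<r} \<union> (\<Union>j<r. P' j))" by blast
  moreover have "insert c (\<tau> ` {..<r} \<union> (\<Union>j<r. P' j)) \<inter> B = {}" using B(2) P'1 by auto
  ultimately show ?thesis by (intro exI[of _ g] conjI) simp_all
qed

lemma r_graphD:
  assumes "r_graph r (Hypergraph V E)"
  shows "finite V" "e \<in> E \<Longrightarrow> e \<subseteq> V" "e \<in> E \<Longrightarrow> card e = r" "e \<in> E \<Longrightarrow> finite e" "finite E"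
proof -
  show f: "finite V" and s: "e \<in> E \<Longrightarrow> e \<subseteq> V" and "e \<in> E \<Longrightarrow> card e = r" for e
    using assms by (auto simp: r_graph_def)
  then show "e \<in> E \<Longrightarrow> finite e" using finite_subset by blast
  have "E \<subseteq> Pow V" using s by blast
  then show "finite E" using f finite_subset by blast
qed

text \<open>All edges through such a pair meet one set of at most \<open>K\<close> vertices, so
  there are about \<open>K * card V ^ (r - 3)\<close> of them. Multiplying by \<open>card V\<close>
  gives a form that is also right for \<open>r = 2\<close>.\<close>

lemma nonrobust_codegree:
  assumes H: "r_graph r (Hypergraph V E)" and r: "2 \<le> r" and xy: "x \<in> V" "y \<in> V" "x \<noteq> y"
    and nr: "\<not> robust_pair K E x y"
  shows "card {e\<in>E. x \<in> e \<and> y \<in> e} * card V \<le> K * card V ^ (r - 2)"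
proof -
  note D = r_graphD[OF H]
  obtain U where U: "finite U" "card U \<le> K" "x \<notin> U" "y \<notin> U" and hit: "\<And>e. e \<in> E \<Longrightarrow> x \<in> e \<Longrightarrow> y \<in> e \<Longrightarrow> e \<inter> U \<noteq> {}"
    using nr xy unfolding robust_pair_def by blast
  show ?thesis
  proof (cases "r = 2")
    \<comment> \<open>The only candidate for an edge is the pair itself, which avoids
      \<open>U\<close>; so there is none.\<close>
    case True
    have none: "{e\<in>E. x \<in> e \<and> y \<in> e} = {}"
    proof (rule ccontr)
      assume "\<not> ?thesis"
      then obtain e where e: "e \<in> E" "x \<in> e" "y \<in> e" by blast
      then have "{x, y} = e" using D(3,4)[of e] True xy by (intro card_subset_eq) auto
      then show False using hit[OF e] U by auto
    qed
    show ?thesis unfolding none by simp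
  next
    case False
    have "{e\<in>E. x \<in> e \<and> y \<in> e} \<subseteq> (\<Union>u\<in>U \<inter> V. {e\<in>E. {x, y, u} \<subseteq> e})"
      using hit D(2) by fastforce
    then have "card {e\<in>E. x \<in> e \<and> y \<in> e} \<le> card (\<Union>u\<in>U \<inter> V. {e\<in>E. {x, y, u} \<subseteq> e})"
      using U D(5) by (intro card_mono) auto
    also have "\<dots> \<le> (\<Sum>u\<in>U \<inter> V. card {e\<in>E. {x, y, u} \<subseteq> e})" using U by (intro card_UN_le) auto
    also have "\<dots> \<le> (\<Sum>u\<in>U \<inter> V. card V ^ (r - 3))"
    proof (rule sum_mono)
      fix u assume u: "u \<in> U \<inter> V"
      then have "card {x, y, u} = 3" using xy U by (auto simp: card_insert_if)
      moreover have "card {e\<in>E. {x, y, u} \<subseteq> e} \<le> card V ^ (r - card {x, y, u})"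
        using D(2,3) xy u by (intro card_edges_containing[OF D(1)]) auto
      ultimately show "card {e\<in>E. {x, y, u} \<subseteq> e} \<le> card V ^ (r - 3)" by simp
    qed
    also have "\<dots> \<le> K * card V ^ (r - 3)"
      using U card_mono[of U "U \<inter> V"] by (simp add: le_trans)
    finally have "card {e\<in>E. x \<in> e \<and> y \<in> e} * card V \<le> K * card V ^ (r - 3) * card V" by (rule mult_le_mono1)
    also have "\<dots> = K * card V ^ (r - 2)"
    proof -
      have "r - 2 = Suc (r - 3)" using r False by simp
      then show ?thesis by simp
    qed
    finally show ?thesis .
  qed
qed

lemma nonrobust_degree:
  assumes H: "r_graph r (Hypergraph V E)" and r: "2 \<le> r" and v: "v \<in> V"
  shows "card {e\<in>E. v \<in> e \<and> (\<exists>u\<in>e. u \<noteq> v \<and> \<not> robust_pair K E v u)} \<le> K * card V ^ (r - 2)"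
proof -
  note D = r_graphD[OF H]
  let ?B = "{e\<in>E. v \<in> e \<and> (\<exists>u\<in>e. u \<noteq> v \<and> \<not> robust_pair K E v u)}"
  let ?W = "{u\<in>V. u \<noteq> v \<and> \<not> robust_pair K E v u}"
  have "?B \<subseteq> (\<Union>u\<in>?W. {e\<in>E. v \<in> e \<and> u \<in> e})" using D(2) by blast
  then have "card ?B \<le> card (\<Union>u\<in>?W. {e\<in>E. v \<in> e \<and> u \<in> e})"
    using D by (intro card_mono) auto
  also have "\<dots> \<le> (\<Sum>u\<in>?W. card {e\<in>E. v \<in> e \<and> u \<in> e})" using D by (intro card_UN_le) auto
  finally have "card ?B * card V \<le> (\<Sum>u\<in>?W. card {e\<in>E. v \<in> e \<and> u \<in> e}) * card V" by (rule mult_le_mono1)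
  also have "\<dots> = (\<Sum>u\<in>?W. card {e\<in>E. v \<in> e \<and> u \<in> e} * card V)" by (simp add: sum_distrib_right)
  also have "\<dots> \<le> (\<Sum>u\<in>?W. K * card V ^ (r - 2))"
    by (rule sum_mono) (rule nonrobust_codegree[OF H r v], auto)
  also have "\<dots> = card ?W * (K * card V ^ (r - 2))" by simp
  also have "\<dots> \<le> card V * (K * card V ^ (r - 2))" using D by (intro mult_le_mono1 card_mono) auto
  finally have "card V * card ?B \<le> card V * (K * card V ^ (r - 2))" by (simp add: mult.commute)
  moreover have "card V > 0" using v D(1) by (auto simp: card_gt_0_iff)
  ultimately show ?thesis by simp
qed

lemma nonrobust_edges:
  assumes H: "r_graph r (Hypergraph V E)" and r: "2 \<le> r"
  shows "card {e\<in>E. \<exists>x\<in>e. \<exists>y\<in>e. x \<noteq> y \<and> \<not> robust_pair K E x y} \<le> K * card V ^ (r - 1)"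
proof -
  note D = r_graphD[OF H]
  let ?B = "\<lambda>v. {e\<in>E. v \<in> e \<and> (\<exists>u\<in>e. u \<noteq> v \<and> \<not> robust_pair K E v u)}"
  have "{e\<in>E. \<exists>x\<in>e. \<exists>y\<in>e. x \<noteq> y \<and> \<not> robust_pair K E x y} \<subseteq> (\<Union>v\<in>V. ?B v)"
  proof
    fix e assume "e \<in> {e\<in>E. \<exists>x\<in>e. \<exists>y\<in>e. x \<noteq> y \<and> \<not> robust_pair K E x y}"
    then obtain x y where "e \<in> E" "x \<in> e" "y \<in> e" "x \<noteq> y" "\<not> robust_pair K E x y" by blast
    then show "e \<in> (\<Union>v\<in>V. ?B v)" using D(2)[of e] by (intro UN_I[of x]) auto
  qed
  then have "card {e\<in>E. \<exists>x\<in>e. \<exists>y\<in>e. x \<noteq> y \<and> \<not> robust_pair K E x y} \<le> card (\<Union>v\<in>V. ?B v)"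
    using D by (intro card_mono) auto
  also have "\<dots> \<le> (\<Sum>v\<in>V. card (?B v))" using D by (intro card_UN_le)
  also have "\<dots> \<le> (\<Sum>v\<in>V. K * card V ^ (r - 2))" by (intro sum_mono nonrobust_degree[OF H r])
  also have "\<dots> = K * card V ^ (r - 1)"
  proof -
    have "r - 1 = Suc (r - 2)" using r by simp
    then show ?thesis by simp
  qed
  finally show ?thesis .
qed

lemma in_listset_iff: "l \<in> listset Ts \<longleftrightarrow> list_all2 (\<in>) l Ts"
proof (induction Ts arbitrary: l)
  case (Cons T Ts)
  then show ?case by (cases l) (auto simp: set_Cons_def)
qed simp

definition robust_edges :: "nat \<Rightarrow> 'a set set \<Rightarrow> 'a set set" where
  "robust_edges K E = {e\<in>E. \<forall>x\<in>e. \<forall>y\<in>e. x \<noteq> y \<longrightarrow> robust_pair K E x y}"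

text \<open>The sides of the box are a set of centres and one set for each transversal position. The
  \<open>i\<close>th fan takes the \<open>i\<close>th element of every side. The box makes all mixed
  transversals edges, and robustness adds the petals. In the bound on \<open>K\<close>,
  \<open>t * (r + 1)\<close> counts the vertices of the box and \<open>t * (r * r)\<close> the fans
  already built.\<close>

lemma copy_from_complete_extensions:
  assumes H: "r_graph r (Hypergraph V E)" and r: "2 \<le> r"
    and K: "t * (r + 1) + t * (r * r) + r * r + 1 \<le> K"
    and Ts: "length Ts = r + 1" "\<And>T. T \<in> set Ts \<Longrightarrow> T \<subseteq> V \<and> card T = t"
    and ls: "\<And>c l. c # l \<in> listset Ts \<Longrightarrow> distinct (c # l) \<and> set l \<in> E \<and> (\<forall>x\<in>set l. robust_pair K E c x)"
  shows "contains_copy (Hypergraph V E) (semi_blowup_fan r t)"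
proof -
  note D = r_graphD[OF H]
  have fT: "finite (Ts ! j)" "card (Ts ! j) = t" if "j \<le> r" for j
    using Ts that D(1) finite_subset by (metis Suc_eq_plus1 le_imp_less_Suc nth_mem)+
  then have "\<forall>j. \<exists>h. j \<le> r \<longrightarrow> bij_betw h {..<t} (Ts ! j)"
    using ex_bij_betw_nat_finite by (metis atLeast0LessThan)
  then obtain h where h: "\<And>j. j \<le> r \<Longrightarrow> bij_betw (h j) {..<t} (Ts ! j)" by metis
  have hT: "h j i \<in> Ts ! j" if "j \<le> r" "i < t" for i j using h[OF that(1)] that(2) by (auto simp: bij_betw_def)
  define c where "c = h 0"
  define \<tau> where "\<tau> i j = h (Suc j) i" for i j
  have tup: "c i # map (\<lambda>j. \<tau> (\<iota> j) j) [0..<r] \<in> listset Ts" if "i < t" "\<And>j. j < r \<Longrightarrow> \<iota> j < t" for i \<iota>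
    unfolding in_listset_iff list_all2_conv_all_nth
  proof (intro conjI allI impI)
    fix m assume m: "m < length (c i # map (\<lambda>j. \<tau> (\<iota> j) j) [0..<r])"
    show "(c i # map (\<lambda>j. \<tau> (\<iota> j) j) [0..<r]) ! m \<in> Ts ! m"
    proof (cases m)
      case 0
      then show ?thesis using hT[of 0 i] that by (simp add: c_def)
    next
      case (Suc j)
      then show ?thesis using hT[of "Suc j" "\<iota> j"] that m by (simp add: \<tau>_def)
    qed
  qed (use Ts in simp)
  have set_tup: "set (map (\<lambda>j. \<tau> (\<iota> j) j) [0..<r]) = (\<lambda>j. \<tau> (\<iota> j) j) ` {..<r}" for \<iota> :: "nat \<Rightarrow> nat"
    by (simp add: atLeast0LessThan)
  have edge: "(\<lambda>j. \<tau> (\<iota> j) j) ` {..<r} \<in> E" if "\<And>j. j < r \<Longrightarrow> \<iota> j < t" "0 < t" for \<iota>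
    using ls[OF tup[of 0 \<iota>]] that set_tup[of \<iota>] by simp
  have c\<tau>: "c i \<noteq> \<tau> i' j" "robust_pair K E (c i) (\<tau> i' j)" if "i < t" "i' < t" "j < r" for i i' j
    using ls[OF tup[of i "\<lambda>_. i'"]] that by auto
  have \<tau>\<tau>: "\<tau> i j \<noteq> \<tau> i' j'" if "i < t" "i' < t" "j < r" "j' < r" "j \<noteq> j'" for i i' j j'
  proof -
    \<comment> \<open>The tuple that takes the \<open>i\<close>th element at position
      \<open>j\<close> and the \<open>i'\<close>th elsewhere also belongs to the box, so its entries
      differ.\<close>
    have "distinct (map (\<lambda>k. \<tau> (if k = j then i else i') k) [0..<r])"
      using ls[OF tup[of i "\<lambda>k. if k = j then i else i'"]] that by simp
    then have "inj_on (\<lambda>k. \<tau> (if k = j then i else i') k) {0..<r}" by (simp add: distinct_map)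
    then show ?thesis using that inj_onD[of "\<lambda>k. \<tau> (if k = j then i else i') k" "{0..<r}" j j'] by auto
  qed
  have inj1: "i = i'" if "i < t" "i' < t" "j \<le> r" "h j i = h j i'" for i i' j
    using h[OF that(3)] that by (auto simp: bij_betw_def dest: inj_onD)
  have \<tau>inj: "i = i' \<and> j = j'" if "i < t" "i' < t" "j < r" "j' < r" "\<tau> i j = \<tau> i' j'" for i i' j j'
  proof -
    have "j = j'" using \<tau>\<tau> that by metis
    then show ?thesis using inj1[of i i' "Suc j"] that by (simp add: \<tau>_def)
  qed
  have cinj: "i = i'" if "i < t" "i' < t" "c i = c i'" for i i' using inj1[of i i' 0] that by (simp add: c_def)
  define own where "own i = insert (c i) (\<tau> i ` {..<r})" for i
  define R where "R = (\<Union>i<t. own i)"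
  have fR: "finite R" by (simp add: R_def own_def)
  have cown: "card (own i) \<le> r + 1" for i
    using card_image_le[of "{..<r}" "\<tau> i"] by (simp add: own_def card_insert_if)
  have cR: "card R \<le> t * (r + 1)"
  proof -
    have "card R \<le> (\<Sum>i<t. card (own i))" unfolding R_def by (rule card_UN_le) simp
    also have "\<dots> \<le> (\<Sum>i<t. r + 1)" by (intro sum_mono cown)
    finally show ?thesis by simp
  qed
  have own_disj: "own i \<inter> own i' = {}" if "i < t" "i' < t" "i \<noteq> i'" for i i'
  proof -
    have "x \<noteq> y" if "x \<in> own i" "y \<in> own i'" for x y
      using that \<open>i < t\<close> \<open>i' < t\<close> \<open>i \<noteq> i'\<close> cinj \<tau>inj c\<tau>(1) unfolding own_def by (elim insertE imageE; metis lessThan_iff)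
    then show ?thesis by blast
  qed
  have "\<exists>g. \<forall>i<m. fan_embedding r V E (g i) \<and> (\<forall>j<r. g i (Transv j) = \<tau> i j) \<and>
      g i ` verts (fan r) \<inter> (R - own i) = {} \<and>
      (\<forall>i'<i. g i' ` verts (fan r) \<inter> g i ` verts (fan r) = {})" if "m \<le> t" for m
    using that
  proof (induction m)
    case 0
    then show ?case by simp
  next
    case (Suc m)
    then obtain g where g: "\<And>i. i < m \<Longrightarrow> fan_embedding r V E (g i) \<and> (\<forall>j<r. g i (Transv j) = \<tau> i j) \<and>
      g i ` verts (fan r) \<inter> (R - own i) = {} \<and>
      (\<forall>i'<i. g i' ` verts (fan r) \<inter> g i ` verts (fan r) = {})" by auto
    \<comment> \<open>The box vertices of the other fans are avoided too, including those of fans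
      still to be built.\<close>
    define B where "B = (R - own m) \<union> (\<Union>i<m. g i ` verts (fan r))"
    have m: "m < t" using Suc by simp
    have "card (\<Union>i<m. g i ` verts (fan r)) \<le> (\<Sum>i<m. card (g i ` verts (fan r)))" by (rule card_UN_le) simp
    also have "\<dots> \<le> (\<Sum>i<m. r * r)" by (intro sum_mono fan_embedding_card_le r)
    also have "\<dots> \<le> t * (r * r)" using m by simp
    finally have "card B \<le> t * (r + 1) + t * (r * r)"
      unfolding B_def using card_Un_le[of "R - own m" "\<Union>i<m. g i ` verts (fan r)"] cR card_mono[OF fR, of "R - own m"]
      by fastforce
    then have cB: "card B + r * r + 1 \<le> K" using K by linarith
    have fB: "finite B" using fR finite_verts_fan by (simp add: B_def)
    have "own m \<inter> g i ` verts (fan r) = {}" if "i < m" for i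
    proof -
      have "own m \<subseteq> R - own i" using own_disj[of m i] m that by (auto simp: R_def)
      then show ?thesis using g[OF that] by blast
    qed
    then have oB: "insert (c m) (\<tau> m ` {..<r}) \<inter> B = {}" unfolding B_def own_def[symmetric] by blast
    have "\<exists>g'. fan_embedding r V E g' \<and> g' Centre = c m \<and> (\<forall>j<r. g' (Transv j) = \<tau> m j) \<and> g' ` verts (fan r) \<inter> B = {}"
    proof (rule fan_exists[OF r, where J = "{..<r}" and K = K and ?e0.0 = "{}" and ?j0.0 = 0])
      show "\<And>e. e \<in> E \<Longrightarrow> e \<subseteq> V \<and> finite e \<and> card e = r" using D by blast
      show "inj_on (\<tau> m) {..<r}" using \<tau>inj m by (auto simp: inj_on_def)
      show "c m \<notin> \<tau> m ` {..<r}" using c\<tau>(1) m by auto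
      show "\<tau> m ` {..<r} \<in> E" using edge[of "\<lambda>_. m"] m by simp
      show "robust_pair K E (c m) (\<tau> m j)" if "j \<in> {..<r}" for j using c\<tau>(2) m that by simp
    qed (use fB oB cB in auto)
    then obtain g' where g': "fan_embedding r V E g'" "\<forall>j<r. g' (Transv j) = \<tau> m j" "g' ` verts (fan r) \<inter> B = {}" by blast
    show ?case
    proof (rule exI[of _ "g(m := g')"], intro allI impI)
      fix i assume "i < Suc m"
      then consider "i < m" | "i = m" by linarith
      then show "fan_embedding r V E ((g(m := g')) i) \<and> (\<forall>j<r. (g(m := g')) i (Transv j) = \<tau> i j) \<and>
        (g(m := g')) i ` verts (fan r) \<inter> (R - own i) = {} \<and>
        (\<forall>i'<i. (g(m := g')) i' ` verts (fan r) \<inter> (g(m := g')) i ` verts (fan r) = {})"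
      proof cases
        case 1
        then show ?thesis using g[OF 1] by simp
      next
        case 2
        have "g' ` verts (fan r) \<inter> (R - own m) = {}" using g'(3) unfolding B_def by blast
        moreover have "g i' ` verts (fan r) \<inter> g' ` verts (fan r) = {}" if "i' < m" for i'
          using g'(3) that unfolding B_def by blast
        ultimately show ?thesis using g' 2 by simp
      qed
    qed
  qed
  from this[of t] obtain g where g0: "\<forall>i<t. fan_embedding r V E (g i) \<and> (\<forall>j<r. g i (Transv j) = \<tau> i j) \<and>
      g i ` verts (fan r) \<inter> (R - own i) = {} \<and>
      (\<forall>i'<i. g i' ` verts (fan r) \<inter> g i ` verts (fan r) = {})" by blast
  have g: "\<And>i. i < t \<Longrightarrow> fan_embedding r V E (g i)"
      "\<And>i j. i < t \<Longrightarrow> j < r \<Longrightarrow> g i (Transv j) = \<tau> i j"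
      "\<And>i i'. i' < i \<Longrightarrow> i < t \<Longrightarrow> g i' ` verts (fan r) \<inter> g i ` verts (fan r) = {}" using g0 by blast+
  show ?thesis
  proof (rule contains_copy_if_fans[OF g(1,3)])
    fix \<iota> :: "nat \<Rightarrow> nat" assume i: "\<iota> ` {..<r} \<subseteq> {..<t}"
    then have "\<And>j. j < r \<Longrightarrow> \<iota> j < t" by auto
    moreover have "0 < t" using i r by (cases "t = 0") (auto simp: lessThan_empty_iff)
    ultimately show "(\<lambda>j. g (\<iota> j) (Transv j)) ` {..<r} \<in> E" using edge[of \<iota>] g(2) by (simp cong: image_cong_simp)
  qed auto
qed

lemma cliqued_robust_edges:
  assumes H: "r_graph r (Hypergraph V E)"
  shows "cliqued r V (robust_pair K E) (robust_edges K E)"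
  unfolding cliqued_def
proof (intro conjI allI impI ballI)
  show "finite V" by (rule r_graphD[OF H])
  show "robust_pair K E y x" if "robust_pair K E x y" for x y using that by (rule robust_pair_sym)
  show "\<not> robust_pair K E x x" for x by (simp add: robust_pair_def)
  fix e assume "e \<in> robust_edges K E"
  then have e: "e \<in> E" "\<And>x y. x \<in> e \<Longrightarrow> y \<in> e \<Longrightarrow> x \<noteq> y \<Longrightarrow> robust_pair K E x y" by (auto simp: robust_edges_def)
  show "e \<subseteq> V" "card e = r" using r_graphD(2,3)[OF H e(1)] by auto
  show "robust_pair K E x y" if "x \<in> e" "y \<in> e" "x \<noteq> y" for x y using e(2) that by blast
qed

text \<open>Otherwise the extensions, listed as tuples with the common neighbour in front, are dense
  enough for \<open>kst\<close> with \<open>r + 1\<close> coordinates.\<close>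

lemma few_extensions:
  fixes \<gamma> :: real
  assumes r: "2 \<le> r" and K: "t * (r + 1) + t * (r * r) + r * r + 1 \<le> K" and \<gamma>: "0 < \<gamma>"
  shows "\<exists>N. \<forall>(V :: 'a set) E. r_graph r (Hypergraph V E) \<and> N \<le> card V \<and>
    \<not> contains_copy (Hypergraph V E) (semi_blowup_fan r t) \<longrightarrow>
    real (card (extensions V (robust_pair K E) (robust_edges K E))) \<le> \<gamma> * real (card V) ^ (r + 1)"
proof -
  obtain N where N: "\<And>(V :: 'a set) A. finite V \<and> N \<le> card V \<and> A \<subseteq> {l. set l \<subseteq> V \<and> length l = r + 1} \<and>
    \<gamma> * real (card V) ^ (r + 1) \<le> real (card A) \<Longrightarrow>
    (\<exists>Ts. length Ts = r + 1 \<and> (\<forall>T\<in>set Ts. T \<subseteq> V \<and> card T = t) \<and> listset Ts \<subseteq> A)"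
    using kst[OF \<gamma>, where k = "r + 1" and t = t and 'a = 'a] by blast
  show ?thesis
  proof (rule exI[of _ N], intro allI impI, elim conjE, rule ccontr)
    fix V :: "'a set" and E
    assume H: "r_graph r (Hypergraph V E)" and n: "N \<le> card V"
      and free: "\<not> contains_copy (Hypergraph V E) (semi_blowup_fan r t)"
      and many: "\<not> real (card (extensions V (robust_pair K E) (robust_edges K E))) \<le> \<gamma> * real (card V) ^ (r + 1)"
    note D = r_graphD[OF H]
    let ?X = "extensions V (robust_pair K E) (robust_edges K E)"
    have "\<forall>e. \<exists>l. finite e \<longrightarrow> set l = e \<and> distinct l" using finite_distinct_list by blast
    then obtain enum where enum: "\<And>e :: 'a set. finite e \<Longrightarrow> set (enum e) = e \<and> distinct (enum e)" by metis
    have X: "e \<in> E" "c \<in> V" "\<And>x. x \<in> e \<Longrightarrow> robust_pair K E c x" if "(e, c) \<in> ?X" for e c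
    proof -
      show "e \<in> E" "c \<in> V" using that by (auto simp: extensions_def robust_edges_def)
      show "robust_pair K E c x" if "x \<in> e" for x
        using \<open>(e, c) \<in> ?X\<close> that by (intro robust_pair_sym[of K E x c]) (auto simp: extensions_def)
    qed
    \<comment> \<open>One ordering per edge is enough: the box theorem applies to an arbitrary dense
      set of tuples, and loses nothing but a constant.\<close>
    define A where "A = (\<lambda>(e, c). c # enum e) ` ?X"
    have "inj_on (\<lambda>(e, c). c # enum e) ?X"
    proof (rule inj_onI)
      fix a b assume ab: "a \<in> ?X" "b \<in> ?X" "(\<lambda>(e, c). c # enum e) a = (\<lambda>(e, c). c # enum e) b"
      obtain e c where ec: "a = (e, c)" by (cases a)
      obtain f d where fd: "b = (f, d)" by (cases b)
      have "finite e" "finite f" using X(1)[of e c] X(1)[of f d] ab D(4) by (auto simp: ec fd)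
      moreover have "c = d" "enum e = enum f" using ab(3) by (simp_all add: ec fd)
      moreover have "set (enum e) = e" "set (enum f) = f" using enum \<open>finite e\<close> \<open>finite f\<close> by blast+
      ultimately have "e = f" by metis
      then show "a = b" using \<open>c = d\<close> by (simp add: ec fd)
    qed
    then have "card A = card ?X" by (simp add: A_def card_image)
    moreover have "A \<subseteq> {l. set l \<subseteq> V \<and> length l = r + 1}"
    proof
      fix l assume "l \<in> A"
      then obtain e c where l: "(e, c) \<in> ?X" "l = c # enum e" by (auto simp: A_def)
      then have "length (enum e) = r" using enum[of e] D(3,4)[OF X(1)[OF l(1)]] by (metis distinct_card)
      then show "l \<in> {l. set l \<subseteq> V \<and> length l = r + 1}"
        using l X(1,2)[OF l(1)] D(2,4)[OF X(1)[OF l(1)]] enum[of e] by auto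
    qed
    ultimately have "\<exists>Ts. length Ts = r + 1 \<and> (\<forall>T\<in>set Ts. T \<subseteq> V \<and> card T = t) \<and> listset Ts \<subseteq> A"
      using n D(1) many by (intro N) (simp only: not_le less_imp_le)
    then obtain Ts where Ts: "length Ts = r + 1" "\<forall>T\<in>set Ts. T \<subseteq> V \<and> card T = t" "listset Ts \<subseteq> A"
      by blast
    have "contains_copy (Hypergraph V E) (semi_blowup_fan r t)"
    proof (rule copy_from_complete_extensions[OF H r K Ts(1)])
      fix c l assume "c # l \<in> listset Ts"
      then have "c # l \<in> A" using Ts(3) by blast
      then obtain e where e: "(e, c) \<in> ?X" "l = enum e" by (auto simp: A_def)
      note e' = enum[OF D(4)[OF X(1)[OF e(1)]]]
      have "c \<notin> e" using X(3)[OF e(1)] by (auto simp: robust_pair_def)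
      then show "distinct (c # l) \<and> set l \<in> E \<and> (\<forall>x\<in>set l. robust_pair K E c x)"
        using e' e(2) X(1,3)[OF e(1)] by auto
    qed (use Ts(2) in blast)
    then show False using free by blast
  qed
qed

text \<open>\<open>stability\<close> is applied to the edges all of whose pairs are robust. The
  discarded edges number \<open>O(n ^ (r - 1))\<close>; half of \<open>\<gamma>\<close> is set aside
  for them.\<close>

lemma near_extremal_colouring:
  fixes \<epsilon> :: real
  assumes r: "2 \<le> r" and \<epsilon>: "0 < \<epsilon>"
  shows "\<exists>\<gamma>>0. \<exists>N. \<forall>(V :: 'a set) E. r_graph r (Hypergraph V E) \<and> N \<le> card V \<and>
    \<not> contains_copy (Hypergraph V E) (semi_blowup_fan r t) \<and>
    (card V / r) ^ r - \<gamma> * real (card V) ^ r \<le> card E \<longrightarrow>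
    (\<exists>p :: 'a \<Rightarrow> nat. (\<forall>v\<in>V. p v < r) \<and> (card V / r) ^ r - \<epsilon> * real (card V) ^ r \<le> card (E \<inter> rainbow V p {..<r}))"
proof -
  define K where "K = t * (r + 1) + t * (r * r) + r * r + 1"
  have r1: "1 \<le> r" using r by simp
  obtain \<gamma> where \<gamma>: "\<gamma> > 0" and st: "\<And>N (V :: 'a set) G L. 0 < N \<Longrightarrow> cliqued r V G L \<Longrightarrow> real (card V) \<le> N \<Longrightarrow>
      real (card (extensions V G L)) \<le> \<gamma> * N ^ (r + 1) \<Longrightarrow> (card V / r) ^ r - \<gamma> * N ^ r \<le> card L \<Longrightarrow>
      (\<exists>p :: 'a \<Rightarrow> nat. (\<forall>v\<in>V. p v < r) \<and> (card V / r) ^ r - \<epsilon> * N ^ r \<le> card (L \<inter> rainbow V p {..<r}))"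
    using stability[OF r1, where 'a = 'a, THEN spec, THEN mp, OF \<epsilon>] by (elim exE conjE) blast
  obtain N where N: "\<And>(V :: 'a set) E. r_graph r (Hypergraph V E) \<Longrightarrow> N \<le> card V \<Longrightarrow>
    \<not> contains_copy (Hypergraph V E) (semi_blowup_fan r t) \<Longrightarrow>
    real (card (extensions V (robust_pair K E) (robust_edges K E))) \<le> \<gamma> * real (card V) ^ (r + 1)"
    using few_extensions[OF r, of t K, OF _ \<gamma>, where 'a = 'a] unfolding K_def by blast
  define N' where "N' = max N (nat \<lceil>2 * real K / \<gamma>\<rceil> + 1)"
  show ?thesis
  proof (rule exI[of _ "\<gamma> / 2"], intro conjI, use \<gamma> in simp, rule exI[of _ N'], intro allI impI, elim conjE)
    fix V :: "'a set" and E
    assume H: "r_graph r (Hypergraph V E)" and n: "N' \<le> card V"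
      and free: "\<not> contains_copy (Hypergraph V E) (semi_blowup_fan r t)"
      and big: "(card V / r) ^ r - \<gamma> / 2 * real (card V) ^ r \<le> card E"
    note D = r_graphD[OF H]
    have n1: "N \<le> card V" "2 * real K / \<gamma> \<le> real (card V)" "0 < card V" using n unfolding N'_def by linarith+
    have "E \<subseteq> robust_edges K E \<union> {e\<in>E. \<exists>x\<in>e. \<exists>y\<in>e. x \<noteq> y \<and> \<not> robust_pair K E x y}"
      by (auto simp: robust_edges_def)
    then have "card E \<le> card (robust_edges K E \<union> {e\<in>E. \<exists>x\<in>e. \<exists>y\<in>e. x \<noteq> y \<and> \<not> robust_pair K E x y})"
      using D(5) by (intro card_mono) (auto simp: robust_edges_def)
    also have "\<dots> \<le> card (robust_edges K E) + K * card V ^ (r - 1)"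
      using card_Un_le nonrobust_edges[OF H r, of K] by (meson add_left_mono order_trans)
    finally have "real (card E) \<le> card (robust_edges K E) + real K * real (card V) ^ (r - 1)"
      by (metis of_nat_add of_nat_le_iff of_nat_mult of_nat_power)
    moreover have "real K * real (card V) ^ (r - 1) \<le> \<gamma> / 2 * real (card V) ^ r"
    proof -
      have "real K \<le> \<gamma> / 2 * real (card V)" using n1(2) \<gamma> by (simp add: field_simps)
      then have "real K * real (card V) ^ (r - 1) \<le> \<gamma> / 2 * real (card V) * real (card V) ^ (r - 1)"
        by (intro mult_right_mono) auto
      also have "\<dots> = \<gamma> / 2 * real (card V) ^ r" using r by (simp add: power_eq_if)
      finally show ?thesis .
    qed
    ultimately have "(card V / r) ^ r - \<gamma> * real (card V) ^ r \<le> card (robust_edges K E)"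
      using big by linarith
    then obtain p :: "'a \<Rightarrow> nat" where p: "\<forall>v\<in>V. p v < r"
      "(card V / r) ^ r - \<epsilon> * real (card V) ^ r \<le> card (robust_edges K E \<inter> rainbow V p {..<r})"
      using st[of "real (card V)", OF _ cliqued_robust_edges[OF H] _ N[OF H n1(1) free]] n1(3) by auto
    moreover have "card (robust_edges K E \<inter> rainbow V p {..<r}) \<le> card (E \<inter> rainbow V p {..<r})"
      using D(5) by (intro card_mono) (auto simp: robust_edges_def)
    ultimately show "\<exists>p :: 'a \<Rightarrow> nat. (\<forall>v\<in>V. p v < r) \<and>
      (card V / r) ^ r - \<epsilon> * real (card V) ^ r \<le> card (E \<inter> rainbow V p {..<r})"
      by (intro exI[of _ p]) linarith
  qed
qed

section \<open>Coherent sets and greedy embedding\<close>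

locale coloured_graph =
  fixes r :: nat and V :: "'a set" and E :: "'a set set" and p :: "'a \<Rightarrow> nat"
  assumes r2: "2 \<le> r" and H: "r_graph r (Hypergraph V E)" and p_less: "\<And>v. v \<in> V \<Longrightarrow> p v < r"
    and V_ne: "V \<noteq> {}"
begin

lemmas D = r_graphD[OF H]

abbreviation n :: real where "n \<equiv> real (card V)"

lemma n_pos: "0 < n"
  using D(1) V_ne by (simp add: card_gt_0_iff)

definition missing :: "'a set \<Rightarrow> 'a set set" where
  "missing S = {T \<in> rainbow V p {..<r} - E. S \<subseteq> T}"

text \<open>The threshold makes a good rainbow set of size \<open>r\<close> an edge, while all but a small proportion of the
  vertices extend a good set to a good one.\<close>

definition good :: "real \<Rightarrow> 'a set \<Rightarrow> bool" where
  "good \<alpha> S \<longleftrightarrow> real (card (missing S)) \<le> (\<alpha> * n) ^ (r - card S) / 2"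

text \<open>\<open>Z\<close> may contain many vertices of each colour. Goodness is demanded of all
  its multicoloured subsets, also those smaller than \<open>r\<close>: the full ones give the mixed
  transversal edges, the small ones allow \<open>Z\<close> to grow.\<close>

definition coherent :: "real \<Rightarrow> 'a set \<Rightarrow> bool" where
  "coherent \<alpha> Z \<longleftrightarrow> Z \<subseteq> V \<and> (\<forall>S\<subseteq>Z. card S \<le> r \<longrightarrow> inj_on p S \<longrightarrow> good \<alpha> S)"

lemma finite_missing: "finite (missing S)"
  unfolding missing_def by (rule finite_subset[OF _ finite_rainbow[OF D(1)]]) auto

lemma missingD: "T \<in> missing S \<Longrightarrow> T \<subseteq> V \<and> finite T \<and> card T = r"
  using rainbow_card[of T V p "{..<r}"] D(1) finite_subset by (auto simp: missing_def rainbow_def)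

lemma coherent_finite: "coherent \<alpha> Z \<Longrightarrow> finite Z"
  using D(1) finite_subset by (auto simp: coherent_def)

lemma coherent_subset: "coherent \<alpha> Z \<Longrightarrow> Z' \<subseteq> Z \<Longrightarrow> coherent \<alpha> Z'"
  unfolding coherent_def by (meson subset_trans)

text \<open>For \<open>card T = r\<close> the threshold of \<open>good\<close> is
  \<open>1/2\<close>, whereas a non-edge \<open>T\<close> would itself be counted once.\<close>

lemma coherent_edge:
  assumes "coherent \<alpha> Z" "T \<subseteq> Z" "inj_on p T" "p ` T = {..<r}"
  shows "T \<in> E"
proof (rule ccontr)
  assume n: "T \<notin> E"
  have T: "T \<in> rainbow V p {..<r}" using assms by (auto simp: rainbow_def coherent_def)
  then have cT: "card T = r" using rainbow_card[OF T] by simp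
  then have "good \<alpha> T" using assms by (auto simp: coherent_def)
  moreover have "T \<in> missing T" using n T by (simp add: missing_def)
  then have "card (missing T) \<noteq> 0" using finite_missing[of T] by auto
  ultimately show False using cT by (simp add: good_def)
qed

text \<open>Averaging: each bad \<open>z\<close> lies in more than
  \<open>(\<alpha> * n) ^ m / 2\<close> of the missing sets through \<open>S\<close>, each missing
  set has \<open>r\<close> vertices, and there are at most \<open>(\<alpha> * n) ^ Suc m / 2\<close>
  of them.\<close>

lemma bad_extensions_of_set:
  fixes \<alpha> :: real
  assumes \<alpha>: "0 < \<alpha>" and S: "good \<alpha> S" "finite S" "card S < r"
  shows "real (card {z\<in>V - S. \<not> good \<alpha> (insert z S)}) \<le> r * \<alpha> * n"
proof -
  let ?B = "{z\<in>V - S. \<not> good \<alpha> (insert z S)}"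
  define m where "m = r - card S - 1"
  have m: "r - card S = Suc m" using S by (simp add: m_def)
  have fB: "finite ?B" using D(1) by simp
  have an: "0 < (\<alpha> * n) ^ m" using \<alpha> n_pos by simp
  have "card ?B * ((\<alpha> * n) ^ m / 2) = (\<Sum>z\<in>?B. (\<alpha> * n) ^ m / 2)" by simp
  also have "\<dots> \<le> (\<Sum>z\<in>?B. real (card {T\<in>missing S. z \<in> T}))"
  proof (intro sum_mono)
    fix z assume z: "z \<in> ?B"
    have "missing (insert z S) = {T\<in>missing S. z \<in> T}" by (auto simp: missing_def)
    moreover have "r - card (insert z S) = m" using z S by (simp add: m_def)
    ultimately show "(\<alpha> * n) ^ m / 2 \<le> real (card {T\<in>missing S. z \<in> T})" using z by (simp add: good_def)
  qed
  also have "\<dots> \<le> (\<Sum>z\<in>V. real (card {T\<in>missing S. z \<in> T}))" using D(1) by (intro sum_mono2) auto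
  also have "\<dots> = real (\<Sum>T\<in>missing S. card {z\<in>V. z \<in> T})"
    by (simp only: of_nat_sum[symmetric] sum_card_swap[OF D(1) finite_missing[of S], of "\<lambda>z T. z \<in> T"])
  also have "(\<Sum>T\<in>missing S. card {z\<in>V. z \<in> T}) = (\<Sum>T\<in>missing S. r)"
  proof (intro sum.cong refl)
    fix T assume "T \<in> missing S"
    then have "T \<subseteq> V" "card T = r" using missingD by blast+
    then show "card {z\<in>V. z \<in> T} = r" by (metis Collect_mem_eq Int_absorb1 Int_def inf_commute)
  qed
  also have "real \<dots> = real r * card (missing S)" by simp
  also have "\<dots> \<le> real r * ((\<alpha> * n) ^ Suc m / 2)" using S(1) by (intro mult_left_mono) (auto simp: good_def m)
  also have "\<dots> = (r * \<alpha> * n) * ((\<alpha> * n) ^ m / 2)" by simp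
  finally show ?thesis using an by (simp only: mult_le_cancel_right_pos)
qed

text \<open>A violation must come from adding \<open>z\<close> to one of the at most
  \<open>2 ^ M\<close> subsets of \<open>Z\<close>.\<close>

lemma incoherent_extensions:
  fixes \<alpha> :: real
  assumes \<alpha>: "0 < \<alpha>" and Z: "coherent \<alpha> Z" "card Z \<le> M"
  shows "real (card {z\<in>V. \<not> coherent \<alpha> (insert z Z)}) \<le> 2 ^ M * (r * \<alpha> * n)"
proof -
  have fZ: "finite Z" using coherent_finite[OF Z(1)] .
  define \<S> where "\<S> = {S. S \<subseteq> Z \<and> card S < r \<and> inj_on p S}"
  have f\<S>: "finite \<S>" "\<S> \<subseteq> Pow Z" using fZ by (auto simp: \<S>_def)
  have c\<S>: "card \<S> \<le> 2 ^ M"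
  proof -
    have "card \<S> \<le> 2 ^ card Z" using card_mono[OF _ f\<S>(2)] fZ by (simp add: card_Pow)
    also have "\<dots> \<le> (2 :: nat) ^ M" using Z(2) by (intro power_increasing) auto
    finally show ?thesis .
  qed
  have "{z\<in>V. \<not> coherent \<alpha> (insert z Z)} \<subseteq> (\<Union>S\<in>\<S>. {z\<in>V - S. \<not> good \<alpha> (insert z S)})"
  proof
    fix z assume z: "z \<in> {z\<in>V. \<not> coherent \<alpha> (insert z Z)}"
    then obtain S where S: "S \<subseteq> insert z Z" "card S \<le> r" "inj_on p S" "\<not> good \<alpha> S"
      using Z(1) by (auto simp: coherent_def)
    have zS: "z \<in> S"
    proof (rule ccontr)
      assume "z \<notin> S"
      then have "S \<subseteq> Z" using S by blast
      then show False using S Z(1) by (auto simp: coherent_def)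
    qed
    have "finite S" using S(1) fZ finite_subset by blast
    then have "S - {z} \<in> \<S>" using S zS card_Diff1_less[of S z] by (auto simp: \<S>_def intro: inj_on_diff)
    moreover have "insert z (S - {z}) = S" using zS by blast
    ultimately show "z \<in> (\<Union>S\<in>\<S>. {z\<in>V - S. \<not> good \<alpha> (insert z S)})"
      using z S(4) by (intro UN_I[of "S - {z}"]) auto
  qed
  then have "card {z\<in>V. \<not> coherent \<alpha> (insert z Z)} \<le> card (\<Union>S\<in>\<S>. {z\<in>V - S. \<not> good \<alpha> (insert z S)})"
    using f\<S>(1) D(1) by (intro card_mono) auto
  also have "\<dots> \<le> (\<Sum>S\<in>\<S>. card {z\<in>V - S. \<not> good \<alpha> (insert z S)})" using f\<S>(1) by (rule card_UN_le)
  finally have "real (card {z\<in>V. \<not> coherent \<alpha> (insert z Z)}) \<le> (\<Sum>S\<in>\<S>. real (card {z\<in>V - S. \<not> good \<alpha> (insert z S)}))"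
    by (simp only: of_nat_sum[symmetric] of_nat_le_iff)
  also have "\<dots> \<le> (\<Sum>S\<in>\<S>. r * \<alpha> * n)"
  proof (intro sum_mono bad_extensions_of_set \<alpha>)
    fix S assume S: "S \<in> \<S>"
    then show "good \<alpha> S" using Z(1) by (auto simp: \<S>_def coherent_def)
    show "finite S" using S fZ finite_subset by (auto simp: \<S>_def)
    show "card S < r" using S by (auto simp: \<S>_def)
  qed
  also have "\<dots> = real (card \<S>) * (r * \<alpha> * n)" by simp
  also have "\<dots> \<le> 2 ^ M * (r * \<alpha> * n)"
  proof (intro mult_right_mono)
    have "real (card \<S>) \<le> real (2 ^ M)" using c\<S> by (simp only: of_nat_le_iff)
    then show "real (card \<S>) \<le> 2 ^ M" by simp
  qed (use \<alpha> n_pos in simp)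
  finally show ?thesis .
qed

definition nbrs :: "nat \<Rightarrow> 'a \<Rightarrow> nat \<Rightarrow> 'a set" where
  "nbrs K v j = {u\<in>V. robust_pair K E v u \<and> p u = j}"

text \<open>In each step the candidates of colour \<open>j\<close> outnumber the forbidden vertices
  and those that would destroy coherence.\<close>

lemma choose_transversal:
  fixes \<alpha> :: real
  assumes \<alpha>: "0 < \<alpha>" and J: "finite J" and Z: "coherent \<alpha> Z" and M: "card Z + card J \<le> M" and B: "finite B"
    and big: "\<And>j. j \<in> J \<Longrightarrow> 2 ^ M * (r * \<alpha> * n) + card B < card (nbrs K c j)"
  shows "\<exists>\<tau>. (\<forall>j\<in>J. \<tau> j \<in> nbrs K c j - B) \<and> coherent \<alpha> (Z \<union> \<tau> ` J)"
  using J M big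
proof (induction J)
  case empty
  then show ?case using Z by simp
next
  case (insert j J)
  then obtain \<tau> where \<tau>: "\<forall>j\<in>J. \<tau> j \<in> nbrs K c j - B" "coherent \<alpha> (Z \<union> \<tau> ` J)" by auto
  have "card (Z \<union> \<tau> ` J) \<le> card Z + card J"
    using card_Un_le[of Z "\<tau> ` J"] card_image_le[OF insert(1), of \<tau>] by linarith
  then have "card (Z \<union> \<tau> ` J) \<le> M" using insert by simp
  note inc = incoherent_extensions[OF \<alpha> \<tau>(2) this]
  let ?I = "{z\<in>V. \<not> coherent \<alpha> (insert z (Z \<union> \<tau> ` J))}"
  have "card (?I \<union> B) \<le> card ?I + card B" by (rule card_Un_le)
  then have "card (?I \<union> B) < card (nbrs K c j)" using inc insert(5)[of j] by simp
  moreover have "finite (?I \<union> B)" using D(1) B by simp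
  ultimately have "\<not> nbrs K c j \<subseteq> ?I \<union> B" using card_mono by (metis leD)
  then obtain z where z: "z \<in> nbrs K c j" "z \<notin> ?I" "z \<notin> B" by blast
  then have "coherent \<alpha> (insert z (Z \<union> \<tau> ` J))" by (auto simp: nbrs_def)
  moreover have "Z \<union> (\<tau>(j := z)) ` insert j J = insert z (Z \<union> \<tau> ` J)" using insert(2) by auto
  moreover have "\<forall>i\<in>insert j J. (\<tau>(j := z)) i \<in> nbrs K c i - B" using \<tau>(1) z insert(2) by auto
  ultimately show ?case by metis
qed

text \<open>\<open>A\<close> is reserved for the fan to be built, \<open>Z\<close> collects the transversal vertices of all fans, and \<open>U\<close> is
  to be avoided.\<close>

definition extendable :: "real \<Rightarrow> nat \<Rightarrow> nat \<Rightarrow> 'a set \<Rightarrow> 'a set \<Rightarrow> bool" where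
  "extendable \<alpha> M L A Z0 \<longleftrightarrow> (\<forall>Z U. coherent \<alpha> Z \<and> Z0 \<subseteq> Z \<and> card Z + r \<le> M \<and> finite U \<and> card U \<le> L \<and> A \<inter> U = {} \<longrightarrow>
     (\<exists>g. fan_embedding r V E g \<and> g ` verts (fan r) \<inter> U = {} \<and> coherent \<alpha> (Z \<union> g ` Transv ` {..<r}) \<and>
       (\<forall>j<r. p (g (Transv j)) = j)))"

text \<open>The fans are built one after another around a common coherent set, which starts with all
  vertices prescribed by the seeds and absorbs each new transversal. In the bounds,
  \<open>t + t * r\<close> is the final size of this set, while \<open>t * (r * r) + t * r\<close>
  covers the fans already built and the seeds still reserved.\<close>

lemma many_extendable:
  fixes \<alpha> :: real
  assumes A: "\<And>i. i < t \<Longrightarrow> finite (A i) \<and> card (A i) \<le> r" "\<And>i i'. i < t \<Longrightarrow> i' < t \<Longrightarrow> i \<noteq> i' \<Longrightarrow> A i \<inter> A i' = {}"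
    and ext: "\<And>i. i < t \<Longrightarrow> extendable \<alpha> M L (A i) (Z0 i)"
    and Z0: "coherent \<alpha> (\<Union>i<t. Z0 i)" "card (\<Union>i<t. Z0 i) \<le> t"
    and M: "t + t * r \<le> M" and L: "t * (r * r) + t * r \<le> L"
  shows "contains_copy (Hypergraph V E) (semi_blowup_fan r t)"
proof -
  have "\<exists>g Z. coherent \<alpha> Z \<and> card Z \<le> t + m * r \<and> (\<Union>i<t. Z0 i) \<subseteq> Z \<and>
     (\<forall>i<m. fan_embedding r V E (g i) \<and> (\<forall>j<r. p (g i (Transv j)) = j) \<and> g i ` Transv ` {..<r} \<subseteq> Z \<and>
       (\<forall>i'. m \<le> i' \<and> i' < t \<longrightarrow> g i ` verts (fan r) \<inter> A i' = {}) \<and>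
       (\<forall>i'<i. g i' ` verts (fan r) \<inter> g i ` verts (fan r) = {}))" if "m \<le> t" for m
    using that
  proof (induction m)
    case 0
    then show ?case using Z0 by (intro exI[of _ "\<lambda>_ _. undefined"] exI[of _ "\<Union>i<t. Z0 i"]) auto
  next
    case (Suc m)
    then have m: "m < t" by simp
    obtain g Z where gZ: "coherent \<alpha> Z \<and> card Z \<le> t + m * r \<and> (\<Union>i<t. Z0 i) \<subseteq> Z \<and>
      (\<forall>i<m. fan_embedding r V E (g i) \<and> (\<forall>j<r. p (g i (Transv j)) = j) \<and> g i ` Transv ` {..<r} \<subseteq> Z \<and>
       (\<forall>i'. m \<le> i' \<and> i' < t \<longrightarrow> g i ` verts (fan r) \<inter> A i' = {}) \<and>
       (\<forall>i'<i. g i' ` verts (fan r) \<inter> g i ` verts (fan r) = {}))"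
    proof -
      from Suc.IH[OF Suc_leD[OF Suc.prems]] show thesis by (elim exE) (rule that)
    qed
    note Z = gZ[THEN conjunct1] gZ[THEN conjunct2, THEN conjunct1] gZ[THEN conjunct2, THEN conjunct2, THEN conjunct1]
      and g = gZ[THEN conjunct2, THEN conjunct2, THEN conjunct2]
    have gD: "fan_embedding r V E (g i)" "\<forall>j<r. p (g i (Transv j)) = j" "g i ` Transv ` {..<r} \<subseteq> Z"
      "\<And>i'. m \<le> i' \<Longrightarrow> i' < t \<Longrightarrow> g i ` verts (fan r) \<inter> A i' = {}"
      "\<And>i'. i' < i \<Longrightarrow> g i' ` verts (fan r) \<inter> g i ` verts (fan r) = {}" if "i < m" for i
      using g[THEN spec, THEN mp, OF that] by simp_all
    \<comment> \<open>Seeds of later fans are avoided as well, so that their vertices are still free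
      when their turn comes.\<close>
    define U where "U = (\<Union>i<m. g i ` verts (fan r)) \<union> (\<Union>i\<in>{Suc m..<t}. A i)"
    have fU: "finite U" using A(1) finite_verts_fan by (auto simp: U_def)
    have "card (\<Union>i<m. g i ` verts (fan r)) \<le> (\<Sum>i<m. card (g i ` verts (fan r)))" by (rule card_UN_le) simp
    also have "\<dots> \<le> (\<Sum>i<m. r * r)" by (intro sum_mono fan_embedding_card_le r2)
    also have "\<dots> \<le> t * (r * r)" using m by simp
    finally have U1: "card (\<Union>i<m. g i ` verts (fan r)) \<le> t * (r * r)" .
    have "card (\<Union>i\<in>{Suc m..<t}. A i) \<le> (\<Sum>i\<in>{Suc m..<t}. card (A i))" by (rule card_UN_le) simp
    also have "\<dots> \<le> (\<Sum>i\<in>{Suc m..<t}. r)" using A(1) by (intro sum_mono) auto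
    also have "\<dots> \<le> t * r" by simp
    finally have "card U \<le> L" using U1 L card_Un_le[of "\<Union>i<m. g i ` verts (fan r)" "\<Union>i\<in>{Suc m..<t}. A i"]
      unfolding U_def by linarith
    moreover have "A m \<inter> U = {}"
    proof -
      have "A m \<inter> A i = {}" if "i \<in> {Suc m..<t}" for i using A(2)[of m i] m that by simp
      moreover have "A m \<inter> g i ` verts (fan r) = {}" if "i < m" for i using gD(4)[OF that order_refl m] by blast
      ultimately show ?thesis unfolding U_def by blast
    qed
    moreover have "card Z + r \<le> M"
    proof -
      have "m * r + r \<le> t * r" using m mult_le_mono1[of "Suc m" t r] by simp
      then show ?thesis using Z(2) M by linarith
    qed
    moreover have "Z0 m \<subseteq> Z" using Z(3) m by blast
    ultimately obtain g' where g': "fan_embedding r V E g'" "g' ` verts (fan r) \<inter> U = {}"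
      "coherent \<alpha> (Z \<union> g' ` Transv ` {..<r})" "\<forall>j<r. p (g' (Transv j)) = j"
      using ext[OF m] Z(1) fU unfolding extendable_def by blast
    define Z' where "Z' = Z \<union> g' ` Transv ` {..<r}"
    have "card (g' ` Transv ` {..<r}) \<le> r"
      using card_image_le[of "{..<r}" "\<lambda>j. g' (Transv j)"] by (simp add: image_image)
    then have "card Z' \<le> t + Suc m * r" using card_Un_le[of Z "g' ` Transv ` {..<r}"] Z(2) by (simp add: Z'_def)
    moreover have "fan_embedding r V E ((g(m := g')) i) \<and> (\<forall>j<r. p ((g(m := g')) i (Transv j)) = j) \<and>
        (g(m := g')) i ` Transv ` {..<r} \<subseteq> Z' \<and>
        (\<forall>i'. Suc m \<le> i' \<and> i' < t \<longrightarrow> (g(m := g')) i ` verts (fan r) \<inter> A i' = {}) \<and>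
        (\<forall>i'<i. (g(m := g')) i' ` verts (fan r) \<inter> (g(m := g')) i ` verts (fan r) = {})" if im: "i < Suc m" for i
    proof -
      consider "i < m" | "i = m" using im by linarith
      then show ?thesis
      proof cases
        case 1
        then have "g i ` Transv ` {..<r} \<subseteq> Z'" using gD(3)[OF 1] unfolding Z'_def by blast
        then show ?thesis using gD[OF 1] 1 by simp
      next
        case 2
        have "g' ` verts (fan r) \<inter> A i' = {}" if "Suc m \<le> i'" "i' < t" for i'
        proof -
          have "A i' \<subseteq> U" using that by (auto simp: U_def)
          then show ?thesis using g'(2) by blast
        qed
        moreover have "g i' ` verts (fan r) \<inter> g' ` verts (fan r) = {}" if "i' < m" for i'
        proof -
          have "g i' ` verts (fan r) \<subseteq> U" using that by (auto simp: U_def)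
          then show ?thesis using g'(2) by blast
        qed
        ultimately show ?thesis using 2 g' by (simp add: Z'_def)
      qed
    qed
    moreover have "coherent \<alpha> Z'" "(\<Union>i<t. Z0 i) \<subseteq> Z'" using g'(3) Z(3) by (auto simp: Z'_def)
    ultimately show ?case by (intro exI[of _ "g(m := g')"] exI[of _ Z']) blast
  qed
  note fans = this[OF order_refl]
  obtain g Z where gZ: "coherent \<alpha> Z \<and> card Z \<le> t + t * r \<and> (\<Union>i<t. Z0 i) \<subseteq> Z \<and>
      (\<forall>i<t. fan_embedding r V E (g i) \<and> (\<forall>j<r. p (g i (Transv j)) = j) \<and> g i ` Transv ` {..<r} \<subseteq> Z \<and>
       (\<forall>i'. t \<le> i' \<and> i' < t \<longrightarrow> g i ` verts (fan r) \<inter> A i' = {}) \<and>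
       (\<forall>i'<i. g i' ` verts (fan r) \<inter> g i ` verts (fan r) = {}))"
  proof -
    from fans show thesis by (elim exE) (rule that)
  qed
  note Z = gZ[THEN conjunct1]
  have gD: "fan_embedding r V E (g i)" "\<forall>j<r. p (g i (Transv j)) = j" "g i ` Transv ` {..<r} \<subseteq> Z"
      "\<And>i'. i' < i \<Longrightarrow> g i' ` verts (fan r) \<inter> g i ` verts (fan r) = {}" if "i < t" for i
    using gZ[THEN conjunct2, THEN conjunct2, THEN conjunct2, THEN spec, THEN mp, OF that] by simp_all
  show ?thesis
  proof (rule contains_copy_if_fans)
    show "fan_embedding r V E (g i)" if "i < t" for i using gD(1) that .
    show "g i ` verts (fan r) \<inter> g i' ` verts (fan r) = {}" if "i < i'" "i' < t" for i i' using gD(4) that by blast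
    fix \<iota> :: "nat \<Rightarrow> nat" assume i: "\<iota> ` {..<r} \<subseteq> {..<t}"
    \<comment> \<open>Whatever copies \<open>\<iota>\<close> selects, the chosen vertices lie in the
      one coherent set and carry the colours \<open>0\<close> to \<open>r - 1\<close>; this alone
      makes them an edge.\<close>
    define f where "f j = g (\<iota> j) (Transv j)" for j
    have f: "p (f j) = j" "f j \<in> Z" if "j < r" for j
    proof -
      have "\<iota> j < t" using i that by auto
      then show "p (f j) = j" "f j \<in> Z" using gD(2,3)[of "\<iota> j"] that by (auto simp: f_def)
    qed
    have "f ` {..<r} \<in> E"
    proof (rule coherent_edge[OF Z])
      show "f ` {..<r} \<subseteq> Z" using f(2) by auto
      show "inj_on p (f ` {..<r})" using f(1) by (auto simp: inj_on_def)
      show "p ` f ` {..<r} = {..<r}" using f(1) by (simp add: image_image)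
    qed
    then show "(\<lambda>j. g (\<iota> j) (Transv j)) ` {..<r} \<in> E" by (simp add: f_def)
  qed
qed

text \<open>Covers both kinds of centre: either \<open>c\<close> has many robust neighbours in every
  colour, or all colours but that of \<open>z\<close> are provided in this way and a given edge
  through \<open>c\<close> and \<open>z\<close> is the remaining petal.\<close>

lemma fan_at_centre:
  fixes \<alpha> :: real
  assumes \<alpha>: "0 < \<alpha>" and K: "L + r * r + 1 \<le> K" and c: "c \<in> V"
    and J: "J \<subseteq> {..<r}" "\<And>j. j < r \<Longrightarrow> j \<notin> J \<Longrightarrow> j = p z"
    and e: "J \<noteq> {..<r} \<Longrightarrow> e \<in> E \<and> c \<in> e \<and> z \<in> e \<and> c \<noteq> z \<and> z \<in> Z \<and> e \<inter> U = {}"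
    and big: "\<And>j. j \<in> J \<Longrightarrow> 2 ^ M * (r * \<alpha> * n) + L + r < card (nbrs K c j)"
    and Z: "coherent \<alpha> Z" "card Z + card J \<le> M" and U: "finite U" "card U \<le> L" "c \<notin> U"
  shows "\<exists>g. fan_embedding r V E g \<and> g ` verts (fan r) \<inter> U = {} \<and> coherent \<alpha> (Z \<union> g ` Transv ` {..<r}) \<and>
       (\<forall>j<r. p (g (Transv j)) = j)"
proof -
  \<comment> \<open>The new transversal vertices have to avoid the given petal, hence the
    \<open>L + r\<close> in the hypothesis on the neighbourhoods.\<close>
  define e' where "e' = (if J = {..<r} then {} else e)"
  have e': "finite e'" "card e' \<le> r" using e D(3,4) by (auto simp: e'_def)
  have fJ: "finite J" using J(1) finite_subset by blast
  have "card (U \<union> e') \<le> L + r" using card_Un_le[of U e'] U e' by linarith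
  then have "2 ^ M * (r * \<alpha> * n) + card (U \<union> e') < card (nbrs K c j)" if "j \<in> J" for j
    using big[OF that] by linarith
  then obtain \<tau>0 where \<tau>0: "\<And>j. j \<in> J \<Longrightarrow> \<tau>0 j \<in> nbrs K c j - (U \<union> e')" "coherent \<alpha> (Z \<union> \<tau>0 ` J)"
    using choose_transversal[OF \<alpha> fJ Z, of "U \<union> e'" K c] U(1) e'(1) by blast
  define \<tau> where "\<tau> j = (if j \<in> J then \<tau>0 j else z)" for j
  have pz: "J \<noteq> {..<r} \<Longrightarrow> p z < r" using e D(2) p_less by blast
  have \<tau>p: "p (\<tau> j) = j" if "j < r" for j
  proof (cases "j \<in> J")
    case True
    then show ?thesis using \<tau>0(1) by (auto simp: \<tau>_def nbrs_def)
  next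
    case False
    then show ?thesis using J(2)[OF that] by (simp add: \<tau>_def)
  qed
  have \<tau>Z: "\<tau> ` {..<r} \<subseteq> Z \<union> \<tau>0 ` J" using e J(1) by (auto simp: \<tau>_def)
  have edge: "\<tau> ` {..<r} \<in> E"
  proof (rule coherent_edge[OF \<tau>0(2) \<tau>Z])
    show "inj_on p (\<tau> ` {..<r})" using \<tau>p by (auto simp: inj_on_def)
    show "p ` \<tau> ` {..<r} = {..<r}" using \<tau>p by (simp add: image_image)
  qed
  have cz: "c \<noteq> \<tau> j \<and> \<tau> j \<notin> U" if "j < r" for j
  proof (cases "j \<in> J")
    case True
    then show ?thesis using \<tau>0(1)[OF True] by (auto simp: \<tau>_def nbrs_def robust_pair_def)
  next
    case False
    then have "J \<noteq> {..<r}" using that by blast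
    then show ?thesis using e False by (auto simp: \<tau>_def)
  qed
  have "\<exists>g. fan_embedding r V E g \<and> g Centre = c \<and> (\<forall>j<r. g (Transv j) = \<tau> j) \<and> g ` verts (fan r) \<inter> U = {}"
  proof (rule fan_exists[OF r2, where J = J and K = K and ?e0.0 = e and ?j0.0 = "p z"])
    show "\<And>f. f \<in> E \<Longrightarrow> f \<subseteq> V \<and> finite f \<and> card f = r" using D by blast
    show "inj_on \<tau> {..<r}" using \<tau>p by (metis inj_on_def lessThan_iff)
    show "c \<notin> \<tau> ` {..<r}" using cz by blast
    show "\<tau> ` {..<r} \<in> E" by (rule edge)
    show "J \<subseteq> {..<r}" by (rule J(1))
    show "robust_pair K E c (\<tau> j)" if "j \<in> J" for j using \<tau>0(1)[OF that] that by (auto simp: \<tau>_def nbrs_def)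
    show "j = p z" if "j < r" "j \<notin> J" for j using J(2) that .
    show "e \<in> E \<and> c \<in> e \<and> \<tau> (p z) \<in> e \<and> e \<inter> \<tau> ` ({..<r} - {p z}) = {} \<and> e \<inter> U = {}" if "J \<noteq> {..<r}"
    proof -
      have "e' = e" using that by (simp add: e'_def)
      have "j \<in> J \<and> j \<noteq> p z" if "j \<in> {..<r} - {p z}" for j using that J(2) by blast
      then have "\<tau> j \<notin> e" if "j \<in> {..<r} - {p z}" for j using that \<tau>0(1) \<open>e' = e\<close> by (auto simp: \<tau>_def)
      moreover have "p z \<notin> J"
      proof
        assume "p z \<in> J"
        then have "{..<r} \<subseteq> J" using J(2) by blast
        then show False using J(1) that by blast
      qed
      then have "\<tau> (p z) \<in> e" using e that by (simp add: \<tau>_def)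
      ultimately show ?thesis using e that by blast
    qed
    show "finite U" "card U + r * r + 1 \<le> K" using U K by auto
    show "insert c (\<tau> ` {..<r}) \<inter> U = {}" using U(3) cz by auto
  qed
  then obtain g where g: "fan_embedding r V E g" "\<forall>j<r. g (Transv j) = \<tau> j" "g ` verts (fan r) \<inter> U = {}" by blast
  have "Z \<union> g ` Transv ` {..<r} \<subseteq> Z \<union> \<tau>0 ` J"
    using \<tau>Z g(2) by (auto simp: image_image)
  then have "coherent \<alpha> (Z \<union> g ` Transv ` {..<r})" by (rule coherent_subset[OF \<tau>0(2)])
  then show ?thesis using g \<tau>p by auto
qed

text \<open>\<open>y\<close> is the centre, \<open>z\<close> the transversal vertex of their common
  colour, and \<open>e\<close> the petal joining them; for the other colours \<open>y\<close> has
  robust neighbours. As \<open>z\<close> is already in \<open>Z\<close>, only \<open>r - 1\<close>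
  vertices are added, which explains \<open>Suc M\<close>.\<close>

lemma extendable_bad_edge:
  fixes \<alpha> :: real
  assumes \<alpha>: "0 < \<alpha>" and K: "L + r * r + 1 \<le> K" and e: "e \<in> E" "y \<in> e" "z \<in> e" "y \<noteq> z" "p y = p z"
    and big: "\<And>j. j < r \<Longrightarrow> j \<noteq> p y \<Longrightarrow> 2 ^ M * (r * \<alpha> * n) + L + r < card (nbrs K y j)"
    and Z: "coherent \<alpha> Z" "z \<in> Z" "card Z + r \<le> Suc M" and U: "finite U" "card U \<le> L" "e \<inter> U = {}"
  shows "\<exists>g. fan_embedding r V E g \<and> g ` verts (fan r) \<inter> U = {} \<and> coherent \<alpha> (Z \<union> g ` Transv ` {..<r}) \<and>
       (\<forall>j<r. p (g (Transv j)) = j)"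
proof (rule fan_at_centre[OF \<alpha> K, where J = "{..<r} - {p z}" and e = e and z = z and c = y])
  show "y \<in> V" using e D(2) by blast
  have "p z < r" using e D(2) p_less by blast
  then show "card Z + card ({..<r} - {p z}) \<le> M" using Z(3) by simp
qed (use e big Z U in auto)

section \<open>Bad edges, low vertices and wild vertices\<close>

text \<open>The repetition must occur among the other vertices of the edge: then \<open>v\<close>
  can be an inner vertex of the petal that this edge provides, and its own colour is
  irrelevant.\<close>

definition bad_at :: "'a \<Rightarrow> 'a set set" where
  "bad_at v = {e\<in>E. v \<in> e \<and> \<not> inj_on p (e - {v})}"

text \<open>The vertices unfit to be the centre \<open>y\<close> of a fan grown from an edge with a
  repeated colour.\<close>

definition low :: "nat \<Rightarrow> real \<Rightarrow> 'a set" where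
  "low K \<delta> = {y\<in>V. \<exists>j<r. j \<noteq> p y \<and> card (nbrs K y j) < \<delta> * n}"

definition wild :: "nat \<Rightarrow> real \<Rightarrow> 'a set" where
  "wild K \<delta> = {v\<in>V. (\<forall>j<r. \<delta> * n \<le> card (nbrs K v j)) \<or> \<delta> * n ^ (r - 1) < card (bad_at v)}"

lemma edges_at_meeting:
  assumes v: "v \<in> V" and B: "B \<subseteq> V"
  shows "card {e\<in>E. v \<in> e \<and> (e - {v}) \<inter> B \<noteq> {}} \<le> card B * card V ^ (r - 2)"
proof -
  have fB: "finite B" using B D(1) finite_subset by blast
  have "{e\<in>E. v \<in> e \<and> (e - {v}) \<inter> B \<noteq> {}} \<subseteq> (\<Union>b\<in>B - {v}. {e\<in>E. {v, b} \<subseteq> e})" by auto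
  then have "card {e\<in>E. v \<in> e \<and> (e - {v}) \<inter> B \<noteq> {}} \<le> card (\<Union>b\<in>B - {v}. {e\<in>E. {v, b} \<subseteq> e})"
    using fB D(5) by (intro card_mono) auto
  also have "\<dots> \<le> (\<Sum>b\<in>B - {v}. card {e\<in>E. {v, b} \<subseteq> e})" using fB by (intro card_UN_le) auto
  also have "\<dots> \<le> (\<Sum>b\<in>B - {v}. card V ^ (r - 2))"
  proof (intro sum_mono)
    fix b assume b: "b \<in> B - {v}"
    have "card {e\<in>E. {v, b} \<subseteq> e} \<le> card V ^ (r - card {v, b})"
      using D(2,3) v b B by (intro card_edges_containing[OF D(1)]) auto
    moreover have "v \<noteq> b" using b by blast
    ultimately show "card {e\<in>E. {v, b} \<subseteq> e} \<le> card V ^ (r - 2)" by (simp add: numeral_2_eq_2)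
  qed
  also have "\<dots> = card (B - {v}) * card V ^ (r - 2)" by simp
  also have "\<dots> \<le> card B * card V ^ (r - 2)" using fB by (intro mult_le_mono1 card_mono) auto
  finally show ?thesis .
qed

text \<open>A vertex with many robust neighbours in every colour is itself the centre. Otherwise it
  lies in so many bad edges that one of them has its two equally coloured vertices typical, and the
  fan is grown from that edge. This edge is found only after \<open>Z\<close> and \<open>U\<close>
  are given, so \<open>{v}\<close> is all that has to be reserved.\<close>

lemma extendable_wild:
  fixes \<alpha> \<delta> :: real
  assumes \<alpha>: "0 < \<alpha>" and K: "L + r * r + 1 \<le> K" and v: "v \<in> wild K \<delta>"
    and small: "2 ^ M * (r * \<alpha> * n) + L + r + card (low K \<delta>) < \<delta> * n"
  shows "extendable \<alpha> M L {v} {}"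
  unfolding extendable_def
proof (intro allI impI, elim conjE)
  fix Z U assume Z: "coherent \<alpha> Z" "card Z + r \<le> M" and U: "finite U" "card U \<le> L" "{v} \<inter> U = {}"
  have vV: "v \<in> V" using v by (simp add: wild_def)
  show "\<exists>g. fan_embedding r V E g \<and> g ` verts (fan r) \<inter> U = {} \<and> coherent \<alpha> (Z \<union> g ` Transv ` {..<r}) \<and>
       (\<forall>j<r. p (g (Transv j)) = j)"
  proof (cases "\<forall>j<r. \<delta> * n \<le> card (nbrs K v j)")
    case True
    have big: "2 ^ M * (r * \<alpha> * n) + L + r < card (nbrs K v j)" if "j < r" for j
    proof -
      have "\<delta> * n \<le> card (nbrs K v j)" using True that by blast
      then show ?thesis using small by linarith
    qed
    show ?thesis
      by (rule fan_at_centre[OF \<alpha> K vV, where J = "{..<r}" and e = "{}" and M = M]) (use big Z U in auto)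
  next
    case False
    then have many: "\<delta> * n ^ (r - 1) < card (bad_at v)" using v by (auto simp: wild_def)
    let ?I = "{z\<in>V. \<not> coherent \<alpha> (insert z Z)}"
    \<comment> \<open>Fewer than \<open>\<delta> * n\<close> vertices are unusable, so fewer than
      \<open>\<delta> * n ^ (r - 1)\<close> edges at \<open>v\<close> meet them away from
      \<open>v\<close>.\<close>
    define B where "B = (U \<inter> V) \<union> (?I \<union> low K \<delta>)"
    have BV: "B \<subseteq> V" by (auto simp: B_def low_def)
    have "card B \<le> card (U \<inter> V) + (card ?I + card (low K \<delta>))"
      unfolding B_def by (intro order_trans[OF card_Un_le] add_left_mono card_Un_le)
    moreover have "card (U \<inter> V) \<le> L" using U card_mono[of U "U \<inter> V"] by simp
    moreover have "real (card ?I) \<le> 2 ^ M * (r * \<alpha> * n)" using Z by (intro incoherent_extensions[OF \<alpha>]) auto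
    ultimately have "card B < \<delta> * n" using small by linarith
    then have "card B * n ^ (r - 2) \<le> \<delta> * n * n ^ (r - 2)" using n_pos by (intro mult_right_mono) auto
    also have "\<dots> = \<delta> * n ^ (r - 1)"
    proof -
      have "r - 1 = Suc (r - 2)" using r2 by simp
      then show ?thesis by simp
    qed
    finally have "real (card B * card V ^ (r - 2)) < card (bad_at v)" using many by simp
    then have "card {e\<in>E. v \<in> e \<and> (e - {v}) \<inter> B \<noteq> {}} < card (bad_at v)"
      using edges_at_meeting[OF vV BV] by linarith
    then have "\<not> bad_at v \<subseteq> {e\<in>E. v \<in> e \<and> (e - {v}) \<inter> B \<noteq> {}}" using card_mono D(5)
      by (metis (no_types, lifting) finite_Collect_conjI finite_subset leD mem_Collect_eq subsetI)
    then obtain e where e: "e \<in> bad_at v" "\<not> (e \<in> E \<and> v \<in> e \<and> (e - {v}) \<inter> B \<noteq> {})" by blast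
    then have eE: "e \<in> E" "v \<in> e" "(e - {v}) \<inter> B = {}" "\<not> inj_on p (e - {v})" by (auto simp: bad_at_def)
    then obtain y z where yz: "y \<in> e - {v}" "z \<in> e - {v}" "y \<noteq> z" "p y = p z" by (auto simp: inj_on_def)
    have yzV: "y \<in> V" "z \<in> V" using yz D(2)[OF eE(1)] by auto
    have eU: "e \<inter> U = {}" using eE U(3) D(2)[OF eE(1)] by (auto simp: B_def)
    have "z \<notin> ?I" using yz eE(3) by (auto simp: B_def)
    then have cz: "coherent \<alpha> (insert z Z)" using yzV by simp
    have ylow: "y \<notin> low K \<delta>" using yz eE(3) by (auto simp: B_def)
    have ny: "\<delta> * n \<le> card (nbrs K y j)" if "j < r" "j \<noteq> p y" for j
    proof (rule ccontr)
      assume "\<not> ?thesis"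
      then have "y \<in> low K \<delta>" using that yzV by (auto simp: low_def not_le)
      then show False using ylow by blast
    qed
    have big: "2 ^ M * (r * \<alpha> * n) + L + r < card (nbrs K y j)" if "j < r" "j \<noteq> p y" for j
      using ny[OF that] small by linarith
    have "card (insert z Z) + r \<le> Suc M" using Z(2) coherent_finite[OF Z(1)] by (simp add: card_insert_if)
    then obtain g where g: "fan_embedding r V E g" "g ` verts (fan r) \<inter> U = {}"
      "coherent \<alpha> (insert z Z \<union> g ` Transv ` {..<r})" "\<forall>j<r. p (g (Transv j)) = j"
      using extendable_bad_edge[OF \<alpha> K eE(1) _ _ yz(3,4) big cz _ _ U(1,2) eU] yz by blast
    moreover have "coherent \<alpha> (Z \<union> g ` Transv ` {..<r})" by (rule coherent_subset[OF g(3)]) auto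
    ultimately show ?thesis by blast
  qed
qed

end

section \<open>Wild vertices\<close>

text \<open>The chord of a convex function on the unit interval; \<open>2 ^ m - 1\<close> is its
  slope.\<close>

lemma power_one_plus_le:
  fixes y :: real
  assumes "0 \<le> y" "y \<le> 1"
  shows "(1 + y) ^ m \<le> 1 + (2 ^ m - 1) * y"
proof (induction m)
  case (Suc m)
  have "(1 + y) ^ Suc m \<le> (1 + y) * (1 + (2 ^ m - 1) * y)" using Suc assms by (simp add: mult_left_mono)
  also have "\<dots> = 1 + 2 ^ m * y + ((2 ^ m - 1) * y) * y" by (simp add: algebra_simps)
  also have "((2 ^ m - 1) * y) * y \<le> ((2 ^ m - 1) * y) * 1" using assms by (intro mult_left_mono) auto
  finally show ?case by (simp add: algebra_simps)
qed simp

context coloured_graph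
begin

section \<open>Rainbow degrees and the effect of a maximal colouring\<close>

definition colourful :: "'a \<Rightarrow> 'a set set" where
  "colourful v = {T \<in> rainbow V p {..<r}. v \<in> T}"

lemma finite_colourful: "finite (colourful v)"
  unfolding colourful_def by (rule finite_subset[OF _ finite_rainbow[OF D(1)]]) auto

lemma pow_r: "n ^ (r - 1) = n * n ^ (r - 2)" "n ^ r = n * n ^ (r - 1)"
proof -
  have "r - 1 = Suc (r - 2)" "r = Suc (r - 1)" using r2 by simp_all
  then show "n ^ (r - 1) = n * n ^ (r - 2)" "n ^ r = n * n ^ (r - 1)" by (metis power_Suc)+
qed

lemma class_mult_colourful:
  assumes "v \<in> V"
  shows "real (card {u\<in>V. p u = p v}) * card (colourful v) = card (rainbow V p {..<r})"
  using card_rainbow_split[OF D(1), of "{..<r}" v p] assms p_less by (simp add: colourful_def flip: of_nat_mult)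

lemma colourful_lower:
  fixes c :: real
  assumes v: "v \<in> V" and c: "c * n ^ r \<le> card (rainbow V p {..<r})"
  shows "c * n ^ (r - 1) \<le> card (colourful v)"
proof -
  have "real (card {u\<in>V. p u = p v}) \<le> n" using D(1) by (simp add: card_mono)
  then have "n * (c * n ^ (r - 1)) \<le> n * card (colourful v)"
    using c class_mult_colourful[OF v] mult_right_mono[of "real (card {u\<in>V. p u = p v})" n "real (card (colourful v))"]
    by (simp add: pow_r(2) mult_ac)
  then show ?thesis using n_pos by (simp only: mult_le_cancel_left_pos)
qed

lemma class_lower:
  fixes c :: real
  assumes v: "j < r" and c: "c * n ^ r \<le> card (rainbow V p {..<r})"
  shows "c * n \<le> card {u\<in>V. p u = j}"
proof (cases "{u\<in>V. p u = j} = {}")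
  case True
  have "card (rainbow V p {..<r}) = (\<Prod>i<r. card {u\<in>V. p u = i})" using D(1) by (simp add: card_rainbow)
  also have "\<dots> = 0"
  proof (rule prod_zero)
    have "card {u\<in>V. p u = j} = 0" by (simp only: True card.empty)
    then show "\<exists>i\<in>{..<r}. card {u\<in>V. p u = i} = 0" using v by blast
  qed simp
  finally have "c * n ^ r \<le> 0" using c by simp
  have "c \<le> 0"
  proof (rule ccontr)
    assume "\<not> c \<le> 0"
    then have "0 < c * n ^ r" using n_pos by simp
    then show False using \<open>c * n ^ r \<le> 0\<close> by simp
  qed
  then have "c * n \<le> 0" using n_pos by (simp add: mult_le_0_iff)
  then show ?thesis by (simp only: True card.empty of_nat_0)
next
  case False
  then obtain v where v: "v \<in> V" "p v = j" by blast
  have "card (colourful v) \<le> card {T. T \<subseteq> V - {v} \<and> card T = r - 1}"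
  proof (rule card_inj_on_le[where f = "\<lambda>T. T - {v}"])
    show "inj_on (\<lambda>T. T - {v}) (colourful v)" by (auto simp: inj_on_def colourful_def)
    show "(\<lambda>T. T - {v}) ` colourful v \<subseteq> {T. T \<subseteq> V - {v} \<and> card T = r - 1}"
      using rainbow_card[of _ V p "{..<r}"] by (auto simp: colourful_def rainbow_def)
    show "finite {T. T \<subseteq> V - {v} \<and> card T = r - 1}" using D(1) by simp
  qed
  also have "\<dots> \<le> card (V - {v}) ^ (r - 1)" using D(1) by (intro card_subsets_le) auto
  also have "\<dots> \<le> card V ^ (r - 1)" using D(1) by (intro power_mono card_mono) auto
  finally have "real (card (colourful v)) \<le> n ^ (r - 1)" by (simp flip: of_nat_power)
  then have "real (card {u\<in>V. p u = j}) * card (colourful v) \<le> real (card {u\<in>V. p u = j}) * n ^ (r - 1)"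
    by (intro mult_left_mono) auto
  then have "(c * n) * n ^ (r - 1) \<le> real (card {u\<in>V. p u = j}) * n ^ (r - 1)"
    using c class_mult_colourful[OF v(1)] v(2) by (simp add: pow_r(2) mult_ac)
  then show ?thesis using n_pos by (simp only: mult_le_cancel_right_pos zero_less_power)
qed

lemma colourful_missing: "card (missing {v}) + card {e\<in>E. e \<in> colourful v} = card (colourful v)"
proof -
  have "missing {v} \<union> {e\<in>E. e \<in> colourful v} = colourful v" by (auto simp: missing_def colourful_def)
  moreover have "card (missing {v} \<union> {e\<in>E. e \<in> colourful v}) = card (missing {v}) + card {e\<in>E. e \<in> colourful v}"
    using D(5) by (intro card_Un_disjoint finite_missing) (auto simp: missing_def)
  ultimately show ?thesis by simp
qed

text \<open>The vertex of colour \<open>j\<close> is a robust neighbour of \<open>v\<close>, or the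
  edge contains a non-robust pair at \<open>v\<close>.\<close>

lemma edges_with_colour:
  assumes v: "v \<in> V"
  shows "card {e\<in>E. v \<in> e \<and> (\<exists>u\<in>e - {v}. p u = j)} \<le> (card (nbrs K v j) + K) * card V ^ (r - 2)"
proof -
  let ?A = "{e\<in>E. v \<in> e \<and> (e - {v}) \<inter> nbrs K v j \<noteq> {}}"
  let ?B = "{e\<in>E. v \<in> e \<and> (\<exists>u\<in>e. u \<noteq> v \<and> \<not> robust_pair K E v u)}"
  have "{e\<in>E. v \<in> e \<and> (\<exists>u\<in>e - {v}. p u = j)} \<subseteq> ?A \<union> ?B"
    using D(2) by (auto simp: nbrs_def)
  then have "card {e\<in>E. v \<in> e \<and> (\<exists>u\<in>e - {v}. p u = j)} \<le> card (?A \<union> ?B)"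
    using D(5) by (intro card_mono) auto
  also have "\<dots> \<le> card ?A + card ?B" by (rule card_Un_le)
  also have "card ?A \<le> card (nbrs K v j) * card V ^ (r - 2)"
    by (rule edges_at_meeting[OF v]) (auto simp: nbrs_def)
  also have "card ?B \<le> K * card V ^ (r - 2)" by (rule nonrobust_degree[OF H r2 v])
  finally show ?thesis by (simp add: distrib_right)
qed

lemma edges_with_sparse_colour:
  fixes \<delta> :: real
  assumes v: "v \<in> V" and s: "card (nbrs K v j) < \<delta> * n" and K: "K \<le> \<delta> * n"
  shows "card {e\<in>E. v \<in> e \<and> (\<exists>u\<in>e - {v}. p u = j)} \<le> 2 * \<delta> * n ^ (r - 1)"
proof -
  have "real (card {e\<in>E. v \<in> e \<and> (\<exists>u\<in>e - {v}. p u = j)}) \<le> real ((card (nbrs K v j) + K) * card V ^ (r - 2))"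
    using edges_with_colour[OF v] by (simp only: of_nat_le_iff)
  also have "\<dots> = (real (card (nbrs K v j)) + K) * n ^ (r - 2)" by simp
  also have "\<dots> \<le> (2 * \<delta> * n) * n ^ (r - 2)" using s K by (intro mult_right_mono) auto
  also have "\<dots> = 2 * \<delta> * n ^ (r - 1)" unfolding pow_r(1) by (simp only: mult.assoc)
  finally show ?thesis .
qed

text \<open>A rainbow edge at \<open>y\<close> needs a vertex of the colour in which
  \<open>y\<close> has few robust neighbours, so almost all rainbow sets through \<open>y\<close>
  are missing.\<close>

lemma low_missing:
  fixes c \<delta> :: real
  assumes y: "y \<in> low K \<delta>" and K: "K \<le> \<delta> * n" and c: "c * n ^ r \<le> card (rainbow V p {..<r})"
  shows "(c - 2 * \<delta>) * n ^ (r - 1) \<le> card (missing {y})"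
proof -
  obtain j where j: "y \<in> V" "j < r" "j \<noteq> p y" "card (nbrs K y j) < \<delta> * n" using y by (auto simp: low_def)
  have "{e\<in>E. e \<in> colourful y} \<subseteq> {e\<in>E. y \<in> e \<and> (\<exists>u\<in>e - {y}. p u = j)}"
  proof
    fix e assume e: "e \<in> {e\<in>E. e \<in> colourful y}"
    then have "j \<in> p ` e" "y \<in> e" using j by (auto simp: colourful_def rainbow_def)
    then show "e \<in> {e\<in>E. y \<in> e \<and> (\<exists>u\<in>e - {y}. p u = j)}" using e j by auto
  qed
  then have "card {e\<in>E. e \<in> colourful y} \<le> card {e\<in>E. y \<in> e \<and> (\<exists>u\<in>e - {y}. p u = j)}"
    using D(5) by (intro card_mono) auto
  then have "card {e\<in>E. e \<in> colourful y} \<le> 2 * \<delta> * n ^ (r - 1)"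
    using edges_with_sparse_colour[OF j(1,4) K] by linarith
  then show ?thesis using colourful_missing[of y] colourful_lower[OF j(1) c] by (simp add: left_diff_distrib)
qed

text \<open>Double counting: each such vertex is in at least \<open>c / 2 * n ^ (r - 1)\<close>
  missing sets, of which \<open>good \<alpha> {}\<close> leaves few.\<close>

lemma card_low:
  fixes c \<alpha> \<delta> :: real
  assumes K: "K \<le> \<delta> * n" and c: "c * n ^ r \<le> card (rainbow V p {..<r})" "0 < c" "4 * \<delta> \<le> c"
    and \<alpha>: "0 < \<alpha>" "\<alpha> \<le> 1" "good \<alpha> {}"
  shows "card (low K \<delta>) \<le> r * \<alpha> / c * n"
proof -
  have "real (card (low K \<delta>)) * (c / 2 * n ^ (r - 1)) = (\<Sum>y\<in>low K \<delta>. c / 2 * n ^ (r - 1))" by simp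
  also have "\<dots> \<le> (\<Sum>y\<in>low K \<delta>. real (card (missing {y})))"
  proof (intro sum_mono)
    fix y assume y: "y \<in> low K \<delta>"
    have "c / 2 * n ^ (r - 1) \<le> (c - 2 * \<delta>) * n ^ (r - 1)" using c by (intro mult_right_mono) auto
    then show "c / 2 * n ^ (r - 1) \<le> real (card (missing {y}))" using low_missing[OF y K c(1)] by linarith
  qed
  also have "\<dots> \<le> (\<Sum>y\<in>V. real (card {T\<in>missing {}. y \<in> T}))"
  proof -
    have "missing {y} = {T\<in>missing {}. y \<in> T}" for y by (auto simp: missing_def)
    then show ?thesis using D(1) by (simp add: low_def sum_mono2)
  qed
  also have "\<dots> = real (\<Sum>T\<in>missing {}. card {y\<in>V. y \<in> T})"
    by (simp only: of_nat_sum[symmetric] sum_card_swap[OF D(1) finite_missing[of "{}"], of "\<lambda>y T. y \<in> T"])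
  also have "(\<Sum>T\<in>missing {}. card {y\<in>V. y \<in> T}) = (\<Sum>T\<in>missing {}. r)"
  proof (intro sum.cong refl)
    fix T assume "T \<in> missing {}"
    then have "T \<subseteq> V" "card T = r" using missingD by blast+
    then show "card {z\<in>V. z \<in> T} = r" by (metis Collect_mem_eq Int_absorb1 Int_def inf_commute)
  qed
  also have "real \<dots> = real r * card (missing {})" by simp
  also have "\<dots> \<le> real r * ((\<alpha> * n) ^ r / 2)" using \<alpha>(3) by (intro mult_left_mono) (auto simp: good_def)
  also have "(\<alpha> * n) ^ r = \<alpha> ^ r * n ^ r" by (rule power_mult_distrib)
  also have "real r * (\<alpha> ^ r * n ^ r / 2) \<le> real r * (\<alpha> * n ^ r / 2)"
  proof (intro mult_left_mono divide_right_mono mult_right_mono)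
    have "\<alpha> ^ r \<le> \<alpha> ^ 1" using \<alpha> r2 by (intro power_decreasing) auto
    then show "\<alpha> ^ r \<le> \<alpha>" by simp
  qed (use n_pos in auto)
  also have "\<dots> = (r * \<alpha> / c * n) * (c / 2 * n ^ (r - 1))" using c(2) by (simp add: pow_r(2))
  finally show ?thesis using c(2) n_pos by (simp only: mult_le_cancel_right_pos zero_less_power half_gt_zero mult_pos_pos)
qed

definition maximal :: bool where
  "maximal \<longleftrightarrow> (\<forall>q :: 'a \<Rightarrow> nat. (\<forall>v\<in>V. q v < r) \<longrightarrow>
     card (E \<inter> rainbow V q {..<r}) \<le> card (E \<inter> rainbow V p {..<r}))"

text \<open>Some colour \<open>j\<close> is sparse around \<open>v\<close>. If it were not the
  colour of \<open>v\<close>, recolouring \<open>v\<close> with \<open>j\<close> would lose at most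
  the \<open>2 * \<delta> * n ^ (r - 1)\<close> edges that use \<open>j\<close>, but make rainbow
  all edges at \<open>v\<close> except bad ones and those using \<open>j\<close>, at least
  \<open>(d - 3 * \<delta>) * n ^ (r - 1)\<close>. Since \<open>d > 5 * \<delta>\<close>, this
  contradicts maximality.\<close>

lemma nonwild_own_colour:
  fixes d \<delta> :: real
  assumes max: maximal and v: "v \<in> V" "v \<notin> wild K \<delta>" and K: "K \<le> \<delta> * n"
    and deg: "d * n ^ (r - 1) \<le> card {e\<in>E. v \<in> e}" and d: "5 * \<delta> < d"
  shows "card (nbrs K v (p v)) < \<delta> * n"
proof -
  obtain j where j: "j < r" "card (nbrs K v j) < \<delta> * n" using v by (auto simp: wild_def not_le)
  have bad: "card (bad_at v) \<le> \<delta> * n ^ (r - 1)" using v by (auto simp: wild_def not_less)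
  let ?C = "{e\<in>E. v \<in> e \<and> (\<exists>u\<in>e - {v}. p u = j)}"
  have C: "card ?C \<le> 2 * \<delta> * n ^ (r - 1)" by (rule edges_with_sparse_colour[OF v(1) j(2) K])
  have "p v = j"
  proof (rule ccontr)
    assume pj: "p v \<noteq> j"
    define q where "q = p(v := j)"
    define X where "X = {e\<in>E. v \<in> e} - bad_at v - ?C"
    have fin: "finite (bad_at v)" "finite ?C" "finite X" using D(5) by (auto simp: bad_at_def X_def)
    have "{e\<in>E. v \<in> e} \<subseteq> X \<union> bad_at v \<union> ?C" by (auto simp: X_def)
    then have "card {e\<in>E. v \<in> e} \<le> card (X \<union> bad_at v \<union> ?C)" using fin by (intro card_mono) auto
    also have "\<dots> \<le> card X + card (bad_at v) + card ?C"
      by (intro order_trans[OF card_Un_le] add_right_mono card_Un_le)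
    finally have "card {e\<in>E. v \<in> e} \<le> card X + card (bad_at v) + card ?C" .
    then have X: "d * n ^ (r - 1) - 3 * \<delta> * n ^ (r - 1) \<le> card X" using deg bad C by linarith
    have Xq: "X \<subseteq> {e \<in> E \<inter> rainbow V q {..<r}. v \<in> e}"
    proof
      fix e assume "e \<in> X"
      then have e: "e \<in> E" "v \<in> e" "inj_on p (e - {v})" "\<And>u. u \<in> e - {v} \<Longrightarrow> p u \<noteq> j"
        by (auto simp: X_def bad_at_def)
      have qp: "q u = p u" if "u \<in> e - {v}" for u using that by (simp add: q_def)
      have "inj_on q (e - {v}) = inj_on p (e - {v})" using qp by (rule inj_on_cong)
      then have "inj_on q (e - {v})" using e(3) by simp
      moreover have "q v \<notin> q ` (e - {v})" using e(4) qp by (auto simp: q_def)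
      ultimately have "inj_on q (insert v (e - {v}))" unfolding inj_on_insert by simp
      moreover have "insert v (e - {v}) = e" using e(2) by blast
      ultimately have "inj_on q e" by simp
      moreover have "q ` e \<subseteq> {..<r}" using D(2)[OF e(1)] p_less j(1) by (auto simp: q_def)
      ultimately have "e \<in> rainbow V q {..<r}" using D(2,3)[OF e(1)] by (intro rainbowI) auto
      then show "e \<in> {e \<in> E \<inter> rainbow V q {..<r}. v \<in> e}" using e by blast
    qed
    let ?R = "{e \<in> E \<inter> rainbow V p {..<r}. v \<notin> e}"
    have Rq: "?R \<subseteq> {e \<in> E \<inter> rainbow V q {..<r}. v \<notin> e}"
    proof
      fix e assume e: "e \<in> ?R"
      have "q u = p u" if "u \<in> e" for u using e that by (auto simp: q_def)
      then have "inj_on q e = inj_on p e" "q ` e = p ` e" by (auto cong: inj_on_cong image_cong)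
      then show "e \<in> {e \<in> E \<inter> rainbow V q {..<r}. v \<notin> e}" using e by (auto simp: rainbow_def)
    qed
    have "E \<inter> rainbow V p {..<r} \<subseteq> ?R \<union> ?C"
    proof
      fix e assume e: "e \<in> E \<inter> rainbow V p {..<r}"
      then have "j \<in> p ` e" using j(1) by (auto simp: rainbow_def)
      then show "e \<in> ?R \<union> ?C" using e pj by auto
    qed
    then have "card (E \<inter> rainbow V p {..<r}) \<le> card (?R \<union> ?C)" using D(5) by (intro card_mono) auto
    also have "\<dots> \<le> card ?R + card ?C" by (rule card_Un_le)
    finally have 1: "card (E \<inter> rainbow V p {..<r}) \<le> card ?R + card ?C" .
    have dis: "?R \<inter> X = {}" and sub: "?R \<union> X \<subseteq> E \<inter> rainbow V q {..<r}" using Xq Rq by blast+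
    have "card ?R + card X = card (?R \<union> X)"
      using D(5) fin(3) dis by (intro card_Un_disjoint[symmetric]) auto
    also have "\<dots> \<le> card (E \<inter> rainbow V q {..<r})" using sub D(5) by (intro card_mono) auto
    also have "\<dots> \<le> card (E \<inter> rainbow V p {..<r})"
    proof -
      have "\<forall>v\<in>V. q v < r" using p_less j(1) by (auto simp: q_def)
      then show ?thesis using max unfolding maximal_def by blast
    qed
    finally have "card X \<le> card ?C" using 1 by linarith
    then have "d * n ^ (r - 1) \<le> 5 * \<delta> * n ^ (r - 1)" using X C by linarith
    then have "d \<le> 5 * \<delta>" using n_pos by (simp only: mult_le_cancel_right_pos zero_less_power)
    then show False using d by simp
  qed
  then show ?thesis using j(2) by simp
qed

lemma nonwild_bad:
  fixes d \<delta> :: real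
  assumes max: maximal and v: "v \<in> V" "v \<notin> wild K \<delta>" and K: "K \<le> \<delta> * n"
    and deg: "d * n ^ (r - 1) \<le> card {e\<in>E. v \<in> e}" and d: "5 * \<delta> < d"
  shows "card {e\<in>E. v \<in> e \<and> \<not> inj_on p e} \<le> 3 * \<delta> * n ^ (r - 1)"
proof -
  let ?C = "{e\<in>E. v \<in> e \<and> (\<exists>u\<in>e - {v}. p u = p v)}"
  have 1: "card (nbrs K v (p v)) < \<delta> * n" by (rule nonwild_own_colour[OF assms])
  have 2: "card (bad_at v) \<le> \<delta> * n ^ (r - 1)"
    using v 1 p_less[OF v(1)] by (auto simp: wild_def not_less)
  have 3: "card ?C \<le> 2 * \<delta> * n ^ (r - 1)" by (rule edges_with_sparse_colour[OF v(1) 1 K])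
  have "{e\<in>E. v \<in> e \<and> \<not> inj_on p e} \<subseteq> bad_at v \<union> ?C"
  proof
    fix e assume e: "e \<in> {e\<in>E. v \<in> e \<and> \<not> inj_on p e}"
    then have ie: "insert v (e - {v}) = e" by blast
    have "\<not> inj_on p (insert v (e - {v}))" unfolding ie using e by blast
    then have "\<not> inj_on p (e - {v}) \<or> p v \<in> p ` (e - {v})" unfolding inj_on_insert by simp
    then show "e \<in> bad_at v \<union> ?C" using e by (auto simp: bad_at_def)
  qed
  then have "card {e\<in>E. v \<in> e \<and> \<not> inj_on p e} \<le> card (bad_at v \<union> ?C)"
    using D(5) by (intro card_mono) (auto simp: bad_at_def)
  also have "\<dots> \<le> card (bad_at v) + card ?C" by (rule card_Un_le)
  finally show ?thesis using 2 3 by linarith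
qed

lemma nonwild_colourful:
  fixes d \<delta> :: real
  assumes max: maximal and v: "v \<in> V" "v \<notin> wild K \<delta>" and K: "K \<le> \<delta> * n"
    and deg: "d * n ^ (r - 1) \<le> card {e\<in>E. v \<in> e}" and d: "5 * \<delta> < d"
  shows "(d - 3 * \<delta>) * n ^ (r - 1) \<le> card {e\<in>E. e \<in> colourful v}"
proof -
  let ?B = "{e\<in>E. v \<in> e \<and> \<not> inj_on p e}"
  have "{e\<in>E. v \<in> e} \<subseteq> {e\<in>E. e \<in> colourful v} \<union> ?B"
  proof
    fix e assume e: "e \<in> {e\<in>E. v \<in> e}"
    have "e \<in> rainbow V p {..<r}" if "inj_on p e"
      using that D(2,3)[of e] e p_less by (intro rainbowI) auto
    then show "e \<in> {e\<in>E. e \<in> colourful v} \<union> ?B" using e by (auto simp: colourful_def)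
  qed
  then have "card {e\<in>E. v \<in> e} \<le> card ({e\<in>E. e \<in> colourful v} \<union> ?B)" using D(5) by (intro card_mono) auto
  also have "\<dots> \<le> card {e\<in>E. e \<in> colourful v} + card ?B" by (rule card_Un_le)
  finally have "d * n ^ (r - 1) - 3 * \<delta> * n ^ (r - 1) \<le> card {e\<in>E. e \<in> colourful v}"
    using deg nonwild_bad[OF assms] by linarith
  then show ?thesis by (simp add: left_diff_distrib)
qed

text \<open>The product of a class size and the rainbow degree of one of its vertices is the total
  number of rainbow sets, at most \<open>(n / r) ^ r\<close>; a nearly full rainbow degree thus caps
  the class. The factor 2 comes from \<open>1 / (1 - x) \<le> 1 + 2 * x\<close> for
  \<open>x \<le> 1/2\<close>.\<close>

lemma class_upper:
  fixes \<delta> :: real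
  assumes lo: "\<And>j. j < r \<Longrightarrow> \<exists>v\<in>V. p v = j \<and> (1 / real r ^ (r - 1) - 4 * \<delta>) * n ^ (r - 1) \<le> card (colourful v)"
    and \<delta>: "0 < \<delta>" "8 * \<delta> * real r ^ (r - 1) \<le> 1" and j: "j < r"
  shows "card {u\<in>V. p u = j} \<le> n / r * (1 + 8 * \<delta> * real r ^ (r - 1))"
proof -
  define x where "x = 4 * \<delta> * real r ^ (r - 1)"
  have rp: "0 < real r ^ (r - 1)" using r2 by simp
  have x: "0 < x" "x \<le> 1 / 2" using \<delta> rp by (auto simp: x_def)
  obtain v where v: "v \<in> V" "p v = j" "(1 / real r ^ (r - 1) - 4 * \<delta>) * n ^ (r - 1) \<le> card (colourful v)"
    using lo[OF j] by blast
  have rr: "real r ^ r = real r * real r ^ (r - 1)" using r2 by (simp add: power_eq_if)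
  have "real (card {u\<in>V. p u = j}) * ((1 - x) / real r ^ (r - 1) * n ^ (r - 1)) \<le> real (card {u\<in>V. p u = j}) * card (colourful v)"
  proof (intro mult_left_mono)
    have "(1 - x) / real r ^ (r - 1) = 1 / real r ^ (r - 1) - 4 * \<delta>" using rp by (simp add: x_def diff_divide_distrib)
    then show "(1 - x) / real r ^ (r - 1) * n ^ (r - 1) \<le> card (colourful v)" using v(3) by simp
  qed simp
  also have "\<dots> = card (rainbow V p {..<r})" using class_mult_colourful[OF v(1)] v(2) by simp
  also have "\<dots> \<le> (n / r) ^ r" using r2 p_less by (intro card_rainbow_le D(1)) auto
  also have "\<dots> = n / r * (n ^ (r - 1) / real r ^ (r - 1))" by (simp add: power_divide rr pow_r(2))
  finally have "(real (card {u\<in>V. p u = j}) * (1 - x)) * (n ^ (r - 1) / real r ^ (r - 1)) \<le> n / r * (n ^ (r - 1) / real r ^ (r - 1))"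
    by (simp add: mult_ac)
  moreover have "0 < n ^ (r - 1) / real r ^ (r - 1)" using n_pos rp by simp
  ultimately have 1: "real (card {u\<in>V. p u = j}) * (1 - x) \<le> n / r" by (simp only: mult_le_cancel_right_pos)
  have "1 \<le> (1 - x) * (1 + 2 * x)" using x by (simp add: algebra_simps)
  then have "real (card {u\<in>V. p u = j}) \<le> real (card {u\<in>V. p u = j}) * ((1 - x) * (1 + 2 * x))"
    by (simp add: mult_le_cancel_left1)
  also have "\<dots> = (real (card {u\<in>V. p u = j}) * (1 - x)) * (1 + 2 * x)" by simp
  also have "\<dots> \<le> n / r * (1 + 2 * x)" using 1 x by (intro mult_right_mono) auto
  finally show ?thesis by (simp add: x_def mult.assoc)
qed

text \<open>The bounds on the other classes are multiplied; this holds for all vertices, wild or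
  not.\<close>

lemma colourful_upper:
  fixes \<delta> :: real
  assumes lo: "\<And>j. j < r \<Longrightarrow> \<exists>v\<in>V. p v = j \<and> (1 / real r ^ (r - 1) - 4 * \<delta>) * n ^ (r - 1) \<le> card (colourful v)"
    and \<delta>: "0 < \<delta>" "8 * \<delta> * real r ^ (r - 1) \<le> 1" and v: "v \<in> V"
  shows "card (colourful v) \<le> (1 / real r ^ (r - 1) + 2 ^ (r + 2) * \<delta>) * n ^ (r - 1)"
proof -
  define y where "y = 8 * \<delta> * real r ^ (r - 1)"
  have rp: "0 < real r ^ (r - 1)" using r2 by simp
  have y: "0 \<le> y" "y \<le> 1" using \<delta> rp by (auto simp: y_def)
  have "card (colourful v) = (\<Prod>j\<in>{..<r} - {p v}. card {u\<in>V. p u = j})"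
    using card_rainbow_containing[OF D(1), of "{..<r}" v p] v p_less by (simp add: colourful_def)
  then have "real (card (colourful v)) = (\<Prod>j\<in>{..<r} - {p v}. real (card {u\<in>V. p u = j}))" by simp
  also have "\<dots> \<le> (\<Prod>j\<in>{..<r} - {p v}. n / r * (1 + y))"
    using class_upper[OF lo \<delta>] by (intro prod_mono) (auto simp: y_def)
  also have "\<dots> = (n / r * (1 + y)) ^ (r - 1)" using p_less[OF v] by simp
  also have "\<dots> = (n / r) ^ (r - 1) * (1 + y) ^ (r - 1)" by (rule power_mult_distrib)
  also have "\<dots> \<le> (n / r) ^ (r - 1) * (1 + 2 ^ (r - 1) * y)"
  proof (intro mult_left_mono)
    have "(1 + y) ^ (r - 1) \<le> 1 + (2 ^ (r - 1) - 1) * y" by (rule power_one_plus_le[OF y])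
    then show "(1 + y) ^ (r - 1) \<le> 1 + 2 ^ (r - 1) * y" using y by (simp add: algebra_simps)
  qed simp
  also have "\<dots> = (1 / real r ^ (r - 1) + 2 ^ (r - 1) * (8 * \<delta>)) * n ^ (r - 1)"
  proof -
    have "P / R * (1 + A * (8 * \<delta> * R)) = (1 / R + A * (8 * \<delta>)) * P" if "R \<noteq> 0" for P R A :: real
      using that by (simp add: field_simps)
    from this[OF less_imp_neq[OF rp, symmetric], of "n ^ (r - 1)" "2 ^ (r - 1)"]
    show ?thesis unfolding power_divide y_def .
  qed
  also have "2 ^ (r - 1) * (8 * \<delta>) = 2 ^ (r + 2) * \<delta>"
  proof -
    have "r + 2 = (r - 1) + 3" using r2 by simp
    then have "(2 :: real) ^ (r + 2) = 2 ^ (r - 1) * 8" by (simp only: power_add) simp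
    then show ?thesis by simp
  qed
  finally show ?thesis .
qed

end

context coloured_graph
begin

section \<open>Seeds of \<open>t\<close> fans\<close>

text \<open>On a set of one colour, the only subsets with distinct colours are the empty set and the
  singletons.\<close>

lemma coherent_monochromatic:
  fixes \<alpha> :: real
  assumes "Z \<subseteq> V" "good \<alpha> {}" "\<And>z. z \<in> Z \<Longrightarrow> good \<alpha> {z}" "\<And>z. z \<in> Z \<Longrightarrow> p z = j"
  shows "coherent \<alpha> Z"
  unfolding coherent_def
proof (intro conjI allI impI)
  fix S assume S: "S \<subseteq> Z" "inj_on p S"
  show "good \<alpha> S"
  proof (cases "S = {}")
    case False
    then obtain z where z: "z \<in> S" by blast
    have "w = z" if "w \<in> S" for w
      using inj_onD[OF S(2) _ that z] assms(4) S(1) that z by (metis subsetD)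
    then have "S = {z}" using z by blast
    then show ?thesis using assms(3) S(1) by blast
  qed (use assms in simp)
qed fact

text \<open>Here \<open>t + t r\<close> and \<open>t r\<^sup>2 + t r\<close> are the bounds needed in \<open>many_extendable\<close>.\<close>

definition fits :: "nat \<Rightarrow> nat \<Rightarrow> real \<Rightarrow> real \<Rightarrow> bool" where
  "fits t K \<delta> \<alpha> \<longleftrightarrow> 0 < (\<alpha> :: real) \<and> good \<alpha> {} \<and>
     2 ^ (t + t * r) * (real r * \<alpha> * n) + (t * (r * r) + t * r) + r + card (low K \<delta>) < \<delta> * n \<and>
     (t * (r * r) + t * r) + r * r + 1 \<le> K"

text \<open>Wild vertices and disjoint edges with a repeated colour all act as seeds, and
  \<open>t\<close> seeds give a copy. The colour \<open>j\<close> is common to all edges: the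
  vertices \<open>z\<close> they contribute in advance to the coherent set then need only be good
  one by one.\<close>

lemma no_wild_bad_family:
  fixes \<alpha> :: real
  assumes free: "\<not> contains_copy (Hypergraph V E) (semi_blowup_fan r t)" and fit: "fits t K \<delta> \<alpha>"
    and W: "W \<subseteq> wild K \<delta>"
    and F: "finite F" "F \<subseteq> E" "\<And>e e'. e \<in> F \<Longrightarrow> e' \<in> F \<Longrightarrow> e \<noteq> e' \<Longrightarrow> e \<inter> e' = {}"
      "\<And>e. e \<in> F \<Longrightarrow> e \<inter> W = {}"
      "\<And>e. e \<in> F \<Longrightarrow> \<exists>y\<in>e. \<exists>z\<in>e. y \<noteq> z \<and> p y = j \<and> p z = j \<and> y \<notin> low K \<delta> \<and> good \<alpha> {z}"
  shows "card W + card F \<noteq> t"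
proof
  assume cardt: "card W + card F = t"
  define M where "M = t + t * r"
  define L where "L = t * (r * r) + t * r"
  have \<alpha>: "0 < \<alpha>" "good \<alpha> {}" and small: "2 ^ M * (r * \<alpha> * n) + L + r + card (low K \<delta>) < \<delta> * n"
    and K: "L + r * r + 1 \<le> K" using fit by (simp_all add: fits_def M_def L_def)
  have WV: "W \<subseteq> V" using W by (auto simp: wild_def)
  then have fW: "finite W" using D(1) finite_subset by blast
  obtain hW where hW: "bij_betw hW {..<card W} W" using ex_bij_betw_nat_finite[OF fW] by (auto simp: atLeast0LessThan)
  obtain hF where hF: "bij_betw hF {..<card F} F" using ex_bij_betw_nat_finite[OF F(1)] by (auto simp: atLeast0LessThan)
  obtain Y Z where YZ: "\<And>e. e \<in> F \<Longrightarrow> Y e \<in> e \<and> Z e \<in> e \<and> Y e \<noteq> Z e \<and> p (Y e) = j \<and> p (Z e) = j \<and>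
      Y e \<notin> low K \<delta> \<and> good \<alpha> {Z e}" using F(5) by metis
  define w where "w = card W"
  \<comment> \<open>Seeds below \<open>w\<close> are wild vertices and fix no transversal vertex;
    the remaining ones are edges, reserved entirely and with \<open>Z e\<close> already
    fixed.\<close>
  define A where "A i = (if i < w then {hW i} else hF (i - w))" for i
  define Z0 where "Z0 i = (if i < w then {} else {Z (hF (i - w))})" for i
  have hWi: "hW i \<in> W" if "i < w" for i using hW that by (auto simp: bij_betw_def w_def)
  have hFi: "hF (i - w) \<in> F" if "w \<le> i" "i < t" for i
  proof -
    have "i - w < card F" using that cardt by (simp add: w_def)
    then show ?thesis using hF by (auto simp: bij_betw_def)
  qed
  have "contains_copy (Hypergraph V E) (semi_blowup_fan r t)"
  proof (rule many_extendable[where A = A and ?Z0.0 = Z0 and \<alpha> = \<alpha> and M = M and L = L])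
    show "finite (A i) \<and> card (A i) \<le> r" if i: "i < t" for i
    proof (cases "i < w")
      case False
      then have "hF (i - w) \<in> E" using hFi[of i] i F(2) by auto
      then show ?thesis using False D(3,4) by (simp add: A_def)
    qed (use r2 in \<open>simp add: A_def\<close>)
    show "A i \<inter> A i' = {}" if i: "i < t" "i' < t" "i \<noteq> i'" for i i'
    proof -
      consider "i < w" "i' < w" | "i < w" "w \<le> i'" | "w \<le> i" "i' < w" | "w \<le> i" "w \<le> i'" by linarith
      then show ?thesis
      proof cases
        case 1
        then have "hW i \<noteq> hW i'" using hW i(3) by (auto simp: bij_betw_def inj_on_def w_def)
        then show ?thesis using 1 by (simp add: A_def)
      next
        case 2
        then show ?thesis using F(4)[OF hFi[OF 2(2) i(2)]] hWi[OF 2(1)] by (auto simp: A_def)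
      next
        case 3
        then show ?thesis using F(4)[OF hFi[OF 3(1) i(1)]] hWi[OF 3(2)] by (auto simp: A_def)
      next
        case 4
        then have "i - w < card F" "i' - w < card F" "i - w \<noteq> i' - w" using i cardt by (auto simp: w_def)
        then have "hF (i - w) \<noteq> hF (i' - w)" using hF by (auto simp: bij_betw_def inj_on_def)
        then show ?thesis using F(3)[OF hFi[OF 4(1) i(1)] hFi[OF 4(2) i(2)]] 4 by (simp add: A_def)
      qed
    qed
    show "extendable \<alpha> M L (A i) (Z0 i)" if i: "i < t" for i
    proof (cases "i < w")
      case True
      then show ?thesis using extendable_wild[OF \<alpha>(1) K _ small] hWi[OF True] W by (auto simp: A_def Z0_def)
    next
      case False
      define e where "e = hF (i - w)"
      have eF: "e \<in> F" using hFi[of i] False i by (simp add: e_def)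
      note yz = YZ[OF eF]
      have yV: "Y e \<in> V" using yz eF F(2) D(2) by blast
      have big: "2 ^ M * (r * \<alpha> * n) + L + r < card (nbrs K (Y e) j')" if "j' < r" "j' \<noteq> p (Y e)" for j'
      proof -
        have "\<not> card (nbrs K (Y e) j') < \<delta> * n" using yz that yV by (auto simp: low_def)
        then show ?thesis using small by linarith
      qed
      have "extendable \<alpha> M L e {Z e}"
        unfolding extendable_def
      proof (intro allI impI, elim conjE)
        fix Z' U assume "coherent \<alpha> Z'" "{Z e} \<subseteq> Z'" "card Z' + r \<le> M" "finite U" "card U \<le> L" "e \<inter> U = {}"
        then show "\<exists>g. fan_embedding r V E g \<and> g ` verts (fan r) \<inter> U = {} \<and>
            coherent \<alpha> (Z' \<union> g ` Transv ` {..<r}) \<and> (\<forall>j<r. p (g (Transv j)) = j)"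
          using yz eF F(2) by (intro extendable_bad_edge[OF \<alpha>(1) K _ _ _ _ _ big, of e]) auto
      qed
      then show ?thesis using False by (simp add: A_def Z0_def e_def)
    qed
    have Zi: "\<exists>e\<in>F. z = Z e" if z: "z \<in> (\<Union>i<t. Z0 i)" for z
    proof -
      obtain i where "i < t" "z \<in> Z0 i" using z by blast
      then show ?thesis using hFi[of i] by (auto simp: Z0_def split: if_splits)
    qed
    show "coherent \<alpha> (\<Union>i<t. Z0 i)"
    proof (rule coherent_monochromatic[where j = j])
      show "(\<Union>i<t. Z0 i) \<subseteq> V"
      proof
        fix z assume "z \<in> (\<Union>i<t. Z0 i)"
        then obtain e where "e \<in> F" "z = Z e" using Zi by blast
        then show "z \<in> V" using YZ[of e] F(2) D(2)[of e] by blast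
      qed
      show "good \<alpha> {z}" "p z = j" if "z \<in> (\<Union>i<t. Z0 i)" for z using Zi[OF that] YZ by auto
    qed (rule \<alpha>(2))
    have "card (\<Union>i<t. Z0 i) \<le> (\<Sum>i<t. card (Z0 i))" by (rule card_UN_le) simp
    also have "\<dots> \<le> (\<Sum>i<t. 1)" by (intro sum_mono) (simp add: Z0_def)
    finally show "card (\<Union>i<t. Z0 i) \<le> t" by simp
  qed (simp_all add: M_def L_def)
  then show False using free by blast
qed

lemma card_wild_less:
  fixes \<alpha> :: real
  assumes "\<not> contains_copy (Hypergraph V E) (semi_blowup_fan r t)" "fits t K \<delta> \<alpha>"
  shows "card (wild K \<delta>) < t"
proof (rule ccontr)
  assume "\<not> ?thesis"
  then obtain W where "W \<subseteq> wild K \<delta>" "card W = t" by (meson not_less obtain_subset_with_card_n)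
  \<comment> \<open>No edge occurs in the empty family, so the colour can be arbitrary.\<close>
  then show False using no_wild_bad_family[OF assms, of W "{}" undefined] by simp
qed

lemma wild_antimono:
  fixes \<delta>1 \<delta>2 :: real
  assumes "\<delta>1 \<le> \<delta>2"
  shows "wild K \<delta>2 \<subseteq> wild K \<delta>1"
proof
  fix v assume v: "v \<in> wild K \<delta>2"
  have "\<delta>1 * n \<le> \<delta>2 * n" "\<delta>1 * n ^ (r - 1) \<le> \<delta>2 * n ^ (r - 1)"
    using assms n_pos by (auto intro!: mult_right_mono)
  then show "v \<in> wild K \<delta>1" using v by (force simp: wild_def)
qed

text \<open>Colour by colour, a maximal disjoint family of non-rainbow edges outside \<open>wild K \<delta>1\<close> is too small
  to complete \<open>wild K \<delta>2\<close> to \<open>t\<close> seeds, so few vertices cover all such edges.\<close>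

lemma few_bad_edges:
  fixes d \<delta>1 \<delta>2 \<alpha>1 \<alpha>2 :: real
  assumes free: "\<not> contains_copy (Hypergraph V E) (semi_blowup_fan r t)"
    and fit1: "fits t K \<delta>1 \<alpha>1" and fit2: "fits t K \<delta>2 \<alpha>2"
    and max: maximal and K: "K \<le> \<delta>1 * n" "\<delta>1 \<le> \<delta>2" "0 < \<delta>1"
    and deg: "\<And>v. v \<in> V \<Longrightarrow> d * n ^ (r - 1) \<le> card {e\<in>E. v \<in> e}" and d: "5 * \<delta>2 < d"
    and tame: "\<And>v. v \<in> V \<Longrightarrow> v \<notin> wild K \<delta>1 \<Longrightarrow> v \<notin> low K \<delta>2 \<and> good \<alpha>2 {v}"
  shows "real (card {e\<in>E. e \<inter> wild K \<delta>2 = {} \<and> \<not> inj_on p e}) \<le>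
    real (t - 1 - card (wild K \<delta>2)) * ((3 * real r * real r + 3) * \<delta>2 * n ^ (r - 1))"
proof -
  define W1 where "W1 = wild K \<delta>1"
  define W2 where "W2 = wild K \<delta>2"
  define s where "s = t - 1 - card W2"
  have W12: "W2 \<subseteq> W1" "W1 \<subseteq> V" unfolding W1_def W2_def using wild_antimono[OF K(2)] by (auto simp: wild_def)
  have fW: "finite W1" "finite W2"
    using finite_subset[OF W12(2) D(1)] finite_subset[OF W12(1)] by simp_all
  have cW1: "card W1 < t" unfolding W1_def by (rule card_wild_less[OF free fit1])
  have K2: "K \<le> \<delta>2 * n"
    using K(1) mult_right_mono[OF K(2), of n] n_pos by linarith
  define P where "P = n ^ (r - 1)"
  have P: "0 < P" using n_pos by (simp add: P_def)
  define bad where "bad v = {e\<in>E. v \<in> e \<and> \<not> inj_on p e}" for v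
  have fbad: "finite (bad v)" for v using D(5) by (simp add: bad_def)
  have bad1: "card (bad v) \<le> 3 * \<delta>1 * P" if "v \<in> V" "v \<notin> W1" for v
    unfolding bad_def P_def using that d K unfolding W1_def
    by (intro nonwild_bad[OF max _ _ K(1) deg]) auto
  have bad2: "card (bad v) \<le> 3 * \<delta>2 * P" if "v \<in> V" "v \<notin> W2" for v
    unfolding bad_def P_def using that d unfolding W2_def by (intro nonwild_bad[OF max _ _ K2 deg]) auto
  define B where "B j = {e\<in>E. e \<inter> W1 = {} \<and> (\<exists>y\<in>e. \<exists>z\<in>e. y \<noteq> z \<and> p y = j \<and> p z = j)}" for j
  have fB: "finite (B j)" for j using D(5) by (simp add: B_def)
  have cB: "real (card (B j)) \<le> real s * real r * (3 * \<delta>1 * P)" for j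
  proof -
    define \<M> where "\<M> = {F. F \<subseteq> B j \<and> (\<forall>e\<in>F. \<forall>e'\<in>F. e \<noteq> e' \<longrightarrow> e \<inter> e' = {})}"
    have f\<M>: "finite \<M>" by (rule finite_subset[of _ "Pow (B j)"]) (use fB in \<open>auto simp: \<M>_def\<close>)
    have "{} \<in> \<M>" by (simp add: \<M>_def)
    then have "Max (card ` \<M>) \<in> card ` \<M>" using f\<M> by (intro Max_in) auto
    then obtain F where F: "F \<in> \<M>" "card F = Max (card ` \<M>)" by auto
    have Fmax: "card F' \<le> card F" if "F' \<in> \<M>" for F' using that f\<M> F(2) by simp
    have FB: "F \<subseteq> B j" using F(1) by (simp add: \<M>_def)
    have Fdis: "e \<inter> e' = {}" if "e \<in> F" "e' \<in> F" "e \<noteq> e'" for e e'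
      using F(1) that unfolding \<M>_def by blast
    have fF: "finite F" using FB fB finite_subset by blast
    \<comment> \<open>A larger family could be trimmed to exactly \<open>t - card W2\<close> edges
      and joined to \<open>W2\<close>. Its edges avoid the larger set \<open>W1\<close>, so
      \<open>tame\<close> makes their vertices typical for the parameters indexed 2.\<close>
    have cF: "card F \<le> s"
    proof (rule ccontr)
      assume "\<not> ?thesis"
      then have "t - card W2 \<le> card F" by (simp add: s_def)
      then obtain F' where F': "F' \<subseteq> F" "card F' = t - card W2" by (meson obtain_subset_with_card_n)
      have sub: "F' \<subseteq> B j" using F' FB by blast
      have "card W2 + card F' \<noteq> t"
      proof (rule no_wild_bad_family[OF free fit2, where j = j])
        show "W2 \<subseteq> wild K \<delta>2" by (simp add: W2_def)
        show "finite F'" using F' fF finite_subset by blast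
        show "F' \<subseteq> E" using sub by (auto simp: B_def)
        show "e \<inter> e' = {}" if "e \<in> F'" "e' \<in> F'" "e \<noteq> e'" for e e'
          using Fdis that F'(1) by blast
        show "e \<inter> W2 = {}" if "e \<in> F'" for e using that sub W12 by (auto simp: B_def)
        fix e assume "e \<in> F'"
        then have e: "e \<in> E" "e \<inter> W1 = {}" "\<exists>y\<in>e. \<exists>z\<in>e. y \<noteq> z \<and> p y = j \<and> p z = j" using sub by (auto simp: B_def)
        then obtain y z where yz: "y \<in> e" "z \<in> e" "y \<noteq> z" "p y = j" "p z = j" by blast
        have "y \<in> V" "z \<in> V" "y \<notin> wild K \<delta>1" "z \<notin> wild K \<delta>1" using yz e(2) D(2)[OF e(1)] by (auto simp: W1_def)
        then show "\<exists>y\<in>e. \<exists>z\<in>e. y \<noteq> z \<and> p y = j \<and> p z = j \<and> y \<notin> low K \<delta>2 \<and> good \<alpha>2 {z}"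
          using yz tame by blast
      qed
      moreover have "card W2 \<le> t" using card_mono[OF fW(1) W12(1)] cW1 by simp
      ultimately show False using F'(2) by simp
    qed
    \<comment> \<open>By maximality of \<open>F\<close>, each edge of \<open>B j\<close> meets a
      member of \<open>F\<close>; hence the at most \<open>s * r\<close> vertices in
      \<open>\<Union>F\<close> cover \<open>B j\<close>.\<close>
    have "B j \<subseteq> (\<Union>v\<in>\<Union>F. bad v)"
    proof
      fix e assume e: "e \<in> B j"
      have "\<exists>f\<in>F. e \<inter> f \<noteq> {}"
      proof (rule ccontr)
        assume "\<not> ?thesis"
        then have dis: "\<And>f. f \<in> F \<Longrightarrow> e \<inter> f = {}" by blast
        have "e \<noteq> {}" using e by (auto simp: B_def)
        then have "e \<notin> F" using dis by blast
        have "insert e F \<in> \<M>" using F(1) e dis by (auto simp: \<M>_def)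
        then show False using Fmax fF \<open>e \<notin> F\<close> by fastforce
      qed
      then obtain f v where "f \<in> F" "v \<in> f" "v \<in> e" by blast
      moreover have "e \<in> bad v" if "v \<in> e" for v using e that by (auto simp: B_def bad_def inj_on_def)
      ultimately show "e \<in> (\<Union>v\<in>\<Union>F. bad v)" by blast
    qed
    moreover have fUF: "finite (\<Union>F)" using fF FB D(4) by (auto simp: B_def)
    moreover have "finite (\<Union>v\<in>\<Union>F. bad v)" using fUF fbad by (rule finite_UN_I)
    ultimately have "card (B j) \<le> card (\<Union>v\<in>\<Union>F. bad v)" by (intro card_mono)
    also have "\<dots> \<le> (\<Sum>v\<in>\<Union>F. card (bad v))" using fUF by (rule card_UN_le)
    finally have "real (card (B j)) \<le> (\<Sum>v\<in>\<Union>F. real (card (bad v)))" by (simp only: of_nat_sum[symmetric] of_nat_le_iff)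
    also have "\<dots> \<le> (\<Sum>v\<in>\<Union>F. 3 * \<delta>1 * P)"
    proof (rule sum_mono)
      fix v assume "v \<in> \<Union>F"
      then have "v \<in> V" "v \<notin> W1" using FB D(2) by (auto simp: B_def)
      then show "real (card (bad v)) \<le> 3 * \<delta>1 * P" by (rule bad1)
    qed
    also have "\<dots> = real (card (\<Union>F)) * (3 * \<delta>1 * P)" by simp
    also have "\<dots> \<le> (real s * real r) * (3 * \<delta>1 * P)"
    proof (rule mult_right_mono)
      have "card (\<Union>F) \<le> (\<Sum>e\<in>F. card e)" by (rule card_Union_le_sum_card)
      also have "\<dots> = (\<Sum>e\<in>F. r)" using FB D(3) by (intro sum.cong) (auto simp: B_def)
      also have "\<dots> \<le> s * r" using cF by simp
      finally show "real (card (\<Union>F)) \<le> real s * real r" by (metis of_nat_le_iff of_nat_mult)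
    qed (use K(3) P in simp)
    finally show ?thesis .
  qed
  \<comment> \<open>Edges avoiding \<open>W1\<close> lie in some \<open>B j\<close>; the others are
    bad at a vertex of \<open>W1 - W2\<close>, which has at most \<open>s\<close> elements because
    \<open>card W1 < t\<close>. So both parts carry the factor \<open>s\<close>.\<close>
  have "{e\<in>E. e \<inter> W2 = {} \<and> \<not> inj_on p e} \<subseteq> (\<Union>j<r. B j) \<union> (\<Union>v\<in>W1 - W2. bad v)"
  proof
    fix e assume e: "e \<in> {e\<in>E. e \<inter> W2 = {} \<and> \<not> inj_on p e}"
    show "e \<in> (\<Union>j<r. B j) \<union> (\<Union>v\<in>W1 - W2. bad v)"
    proof (cases "e \<inter> W1 = {}")
      case True
      obtain y z where yz: "y \<in> e" "z \<in> e" "y \<noteq> z" "p y = p z" using e by (auto simp: inj_on_def)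
      then have "p y < r" using e D(2)[of e] p_less by auto
      moreover have "e \<in> B (p y)" using e True yz by (auto simp: B_def)
      ultimately show ?thesis by blast
    next
      case False
      then show ?thesis using e by (auto simp: bad_def)
    qed
  qed
  then have "card {e\<in>E. e \<inter> W2 = {} \<and> \<not> inj_on p e} \<le> card ((\<Union>j<r. B j) \<union> (\<Union>v\<in>W1 - W2. bad v))"
    using fB fbad fW by (intro card_mono) auto
  also have "\<dots> \<le> card (\<Union>j<r. B j) + card (\<Union>v\<in>W1 - W2. bad v)" by (rule card_Un_le)
  also have "\<dots> \<le> (\<Sum>j<r. card (B j)) + (\<Sum>v\<in>W1 - W2. card (bad v))"
    using fW by (intro add_mono card_UN_le) auto
  finally have "real (card {e\<in>E. e \<inter> W2 = {} \<and> \<not> inj_on p e}) \<le> (\<Sum>j<r. real (card (B j))) + (\<Sum>v\<in>W1 - W2. real (card (bad v)))"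
    by (simp only: of_nat_sum[symmetric] of_nat_add[symmetric] of_nat_le_iff)
  also have "\<dots> \<le> (\<Sum>j<r. real s * real r * (3 * \<delta>1 * P)) + (\<Sum>v\<in>W1 - W2. 3 * \<delta>2 * P)"
    using cB bad2 W12 by (intro add_mono sum_mono) auto
  also have "\<dots> = real r * (real s * real r * (3 * \<delta>1 * P)) + real (card (W1 - W2)) * (3 * \<delta>2 * P)" by simp
  also have "\<dots> \<le> real r * (real s * real r * (3 * \<delta>2 * P)) + real s * (3 * \<delta>2 * P)"
  proof (intro add_mono mult_left_mono mult_right_mono)
    have "card (W1 - W2) \<le> s" using card_Diff_subset[OF fW(2) W12(1)] cW1 by (simp add: s_def)
    then show "real (card (W1 - W2)) \<le> real s" by simp
  qed (use K P in auto)
  also have "\<dots> = real s * ((3 * real r * real r + 3) * \<delta>2 * P)" by (simp add: algebra_simps)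
  finally show ?thesis unfolding s_def W2_def P_def .
qed

end

section \<open>Counting edges\<close>

lemma partition_part: "0 < r \<Longrightarrow> {..<m} = (\<Union>i<r. part r m i)"
  by (auto simp: part_def)

lemma finite_part: "finite (part r m i)"
  by (simp add: part_def)

lemma sum_card_part:
  assumes "0 < r"
  shows "(\<Sum>i<r. card (part r m i)) = m"
proof -
  have "card (\<Union>i<r. part r m i) = (\<Sum>i<r. card (part r m i))"
    by (intro card_UN_disjoint) (auto simp: finite_part part_def)
  also have "(\<Union>i<r. part r m i) = {..<m}" by (rule partition_part[OF assms, symmetric])
  finally show ?thesis by simp
qed

lemma part_bounds:
  assumes "i < r"
  shows "(real m - r) / r \<le> card (part r m i)" "card (part r m i) \<le> (real m + r) / r"
proof -
  have r: "0 < r" using assms by simp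
  have "m = (\<Sum>j<r. card (part r m j))" using sum_card_part[OF r] by simp
  also have "\<dots> \<le> (\<Sum>j<r. card (part r m i) + 1)" using part_balanced assms by (intro sum_mono) auto
  finally have "real m \<le> real (r * (card (part r m i) + 1))" by (simp only: of_nat_le_iff sum_constant card_lessThan of_nat_id)
  then show "(real m - r) / r \<le> card (part r m i)" using r by (simp add: field_simps)
  have "r * card (part r m i) = (\<Sum>j<r. card (part r m i))" by simp
  also have "\<dots> \<le> (\<Sum>j<r. card (part r m j) + 1)" using part_balanced assms by (intro sum_mono) auto
  also have "\<dots> = m + r" using sum_card_part[OF r] by (simp only: sum.distrib) simp
  finally have "real (r * card (part r m i)) \<le> real (m + r)" by (simp only: of_nat_le_iff)
  then show "card (part r m i) \<le> (real m + r) / r" using r by (simp add: field_simps)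
qed

lemma edges_turan_graph: "0 < r \<Longrightarrow> edges (turan_graph r m) = rainbow {..<m} (\<lambda>v. v mod r) {..<r}"
proof -
  assume r: "0 < r"
  have "(card e = r \<and> (\<forall>i<r. card (e \<inter> part r m i) = 1)) \<longleftrightarrow> inj_on (\<lambda>v. v mod r) e \<and> (\<lambda>v. v mod r) ` e = {..<r}"
    if e: "e \<subseteq> {..<m}" for e
  proof
    assume c: "card e = r \<and> (\<forall>i<r. card (e \<inter> part r m i) = 1)"
    have "inj_on (\<lambda>v. v mod r) e"
    proof (rule inj_onI)
      fix x y assume xy: "x \<in> e" "y \<in> e" "x mod r = y mod r"
      have "card (e \<inter> part r m (x mod r)) = 1" using c r by simp
      moreover have "x \<in> e \<inter> part r m (x mod r)" "y \<in> e \<inter> part r m (x mod r)" using xy e by (auto simp: part_def)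
      ultimately show "x = y" by (metis card_1_singletonE singletonD)
    qed
    moreover have "(\<lambda>v. v mod r) ` e \<subseteq> {..<r}" using r by auto
    ultimately show "inj_on (\<lambda>v. v mod r) e \<and> (\<lambda>v. v mod r) ` e = {..<r}"
      using c card_subset_eq[of "{..<r}" "(\<lambda>v. v mod r) ` e"] by (simp add: card_image)
  next
    assume a: "inj_on (\<lambda>v. v mod r) e \<and> (\<lambda>v. v mod r) ` e = {..<r}"
    have "card e = card ((\<lambda>v. v mod r) ` e)" using a by (intro card_image[symmetric]) blast
    then have "card e = r" using a by simp
    moreover have "card (e \<inter> part r m i) = 1" if i: "i < r" for i
    proof -
      have "i \<in> (\<lambda>v. v mod r) ` e" using a i by simp
      then obtain v where v: "v \<in> e" "v mod r = i" by blast
      have "e \<inter> part r m i = {v}" using v e a by (auto simp: part_def dest: inj_onD)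
      then show ?thesis by simp
    qed
    ultimately show "card e = r \<and> (\<forall>i<r. card (e \<inter> part r m i) = 1)" by blast
  qed
  then show ?thesis unfolding turan_graph_def rainbow_def by auto
qed

lemma turan_number_eq: "0 < r \<Longrightarrow> turan_number r m = (\<Prod>i<r. card (part r m i))"
  by (simp add: turan_number_def edges_turan_graph card_rainbow) (simp add: part_def)

lemma turan_number_Suc:
  assumes r: "0 < r"
  shows "turan_number r (Suc m) = turan_number r m + (\<Prod>i\<in>{..<r} - {m mod r}. card (part r m i))"
proof -
  let ?k = "m mod r"
  have k: "?k < r" using r by simp
  have 1: "part r (Suc m) ?k = insert m (part r m ?k)" by (auto simp: part_def less_Suc_eq)
  have "m \<notin> part r m ?k" by (simp add: part_def)
  then have 2: "card (part r (Suc m) ?k) = card (part r m ?k) + 1" unfolding 1 by (simp add: finite_part)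
  have 3: "part r (Suc m) i = part r m i" if "i \<noteq> ?k" for i using that by (auto simp: part_def less_Suc_eq)
  have "turan_number r (Suc m) = card (part r (Suc m) ?k) * (\<Prod>i\<in>{..<r} - {?k}. card (part r (Suc m) i))"
    using k by (simp add: turan_number_eq[OF r] prod.remove[of _ ?k])
  also have "(\<Prod>i\<in>{..<r} - {?k}. card (part r (Suc m) i)) = (\<Prod>i\<in>{..<r} - {?k}. card (part r m i))"
    using 3 by (intro prod.cong) auto
  finally show ?thesis using k by (simp add: 2 turan_number_eq[OF r] prod.remove[of _ ?k])
qed

lemma turan_number_Suc_bounds:
  assumes r: "0 < r"
  shows "r \<le> m \<Longrightarrow> ((real m - r) / r) ^ (r - 1) \<le> real (turan_number r (Suc m)) - turan_number r m"
    "real (turan_number r (Suc m)) - turan_number r m \<le> ((real m + r) / r) ^ (r - 1)"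
proof -
  let ?k = "m mod r"
  have c: "card ({..<r} - {?k}) = r - 1" using r by simp
  have eq: "real (turan_number r (Suc m)) - turan_number r m = (\<Prod>i\<in>{..<r} - {?k}. real (card (part r m i)))"
    by (simp add: turan_number_Suc[OF r])
  have "(\<Prod>i\<in>{..<r} - {?k}. real (card (part r m i))) \<le> (\<Prod>i\<in>{..<r} - {?k}. (real m + r) / r)"
    using part_bounds(2) by (intro prod_mono) auto
  then show "real (turan_number r (Suc m)) - turan_number r m \<le> ((real m + r) / r) ^ (r - 1)" using eq c by simp
  assume "r \<le> m"
  then have "(\<Prod>i\<in>{..<r} - {?k}. (real m - r) / r) \<le> (\<Prod>i\<in>{..<r} - {?k}. real (card (part r m i)))"
    using part_bounds(1) by (intro prod_mono) auto
  then show "((real m - r) / r) ^ (r - 1) \<le> real (turan_number r (Suc m)) - turan_number r m" using eq c by simp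
qed

lemma turan_number_lower:
  assumes r: "0 < r" "r \<le> m"
  shows "((real m - r) / r) ^ r \<le> turan_number r m"
proof -
  have "(\<Prod>i<r. (real m - r) / r) \<le> (\<Prod>i<r. real (card (part r m i)))"
    using part_bounds(1) r by (intro prod_mono) auto
  then show ?thesis by (simp add: turan_number_eq[OF r(1)])
qed

text \<open>By Bernoulli, replacing \<open>n\<close> by \<open>n - c\<close> costs a relative error
  of at most \<open>k * c / n\<close>.\<close>

lemma shifted_power_lower:
  fixes \<delta> :: real
  assumes "0 < \<delta>" "0 < r"
  shows "\<exists>N. \<forall>n\<ge>N. real c \<le> n \<and> (1 / real r ^ k - \<delta>) * real n ^ k \<le> ((real n - c) / r) ^ k"
proof -
  define N where "N = nat \<lceil>real (c + k * c) / \<delta>\<rceil> + c + 1"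
  have "real c \<le> n \<and> (1 / real r ^ k - \<delta>) * real n ^ k \<le> ((real n - c) / r) ^ k" if "N \<le> n" for n
  proof -
    have n: "real (c + k * c) / \<delta> \<le> n" "c \<le> n" "0 < n" using that unfolding N_def by linarith+
    then have n1: "real k * (c / n) \<le> \<delta>" using assms by (simp add: field_simps)
    have cn: "- 1 \<le> - (c / real n)" using n by simp
    have "1 - \<delta> \<le> 1 + real k * (- (c / real n))" using n1 by simp
    also have "\<dots> \<le> (1 + - (c / real n)) ^ k" by (rule Bernoulli_inequality[OF cn])
    also have "1 + - (c / real n) = (real n - c) / n" using n by (simp add: field_simps)
    finally have b: "1 - \<delta> \<le> ((real n - c) / n) ^ k" .
    have rk: "0 < real r ^ k" "1 \<le> real r ^ k" using assms by (auto simp: one_le_power)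
    have "1 / real r ^ k - \<delta> \<le> (1 - \<delta>) / real r ^ k"
      using rk assms by (simp add: field_simps mult_left_mono)
    also have "\<dots> \<le> ((real n - c) / n) ^ k / real r ^ k" using b rk by (intro divide_right_mono) auto
    finally have "(1 / real r ^ k - \<delta>) * real n ^ k \<le> (((real n - c) / n) ^ k / real r ^ k) * real n ^ k"
      by (intro mult_right_mono) auto
    also have "\<dots> = ((real n - c) / r) ^ k" using n by (simp add: power_divide)
    finally show ?thesis using n by simp
  qed
  then show ?thesis by blast
qed

lemma binomial_lower: "k \<le> m \<Longrightarrow> (m - k) ^ k \<le> fact k * (m choose k)"
proof (induction k arbitrary: m)
  case (Suc k)
  then obtain m' where m: "m = Suc m'" by (cases m) auto
  have "(m - Suc k) ^ Suc k = (m' - k) * (m' - k) ^ k" by (simp add: m)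
  also have "\<dots> \<le> Suc m' * (fact k * (m' choose k))" using Suc m by (intro mult_mono) auto
  also have "\<dots> = fact k * (Suc k * (Suc m' choose Suc k))" by (simp only: Suc_times_binomial mult_ac)
  also have "\<dots> = fact (Suc k) * (m choose Suc k)" by (simp only: m fact_Suc of_nat_id mult_ac)
  finally show ?case .
qed simp

section \<open>The size of the extremal graph as a function of the number of vertices\<close>

text \<open>The size of the conjectured extremal graph, over the reals so that differences are not
  truncated.\<close>

definition jsize :: "nat \<Rightarrow> nat \<Rightarrow> nat \<Rightarrow> real" where
  "jsize r s m = real (m choose r) - real ((m - s) choose r) + turan_number r (m - s)"

text \<open>This increment is the minimum degree that may be assumed; it is at least the increment
  of the Turan number.\<close>

lemma jsize_increment:
  fixes \<delta> :: real
  assumes r: "2 \<le> r" and \<delta>: "0 < \<delta>"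
  shows "\<exists>N. \<forall>n\<ge>N. (1 / real r ^ (r - 1) - \<delta>) * real n ^ (r - 1) \<le> jsize r s n - jsize r s (n - 1)"
proof -
  obtain N where N: "\<And>n. N \<le> n \<Longrightarrow> real (s + 1 + r) \<le> n \<and>
    (1 / real r ^ (r - 1) - \<delta>) * real n ^ (r - 1) \<le> ((real n - (s + 1 + r)) / r) ^ (r - 1)"
    using shifted_power_lower[OF \<delta>, of r "s + 1 + r" "r - 1"] r by auto
  have "(1 / real r ^ (r - 1) - \<delta>) * real n ^ (r - 1) \<le> jsize r s n - jsize r s (n - 1)" if n: "N \<le> n" for n
  proof -
    have ns: "s + 1 + r \<le> n" using N[OF n] by (simp only: of_nat_le_iff)
    define m where "m = n - s - 1"
    have m: "n - s = Suc m" "n - 1 - s = m" "r \<le> m" "real m = real n - s - 1" using ns by (auto simp: m_def)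
    obtain k where k: "r = Suc k" using r by (cases r) auto
    obtain l where l: "n = Suc l" using ns by (cases n) auto
    have "((real n - (s + 1 + r)) / r) ^ (r - 1) \<le> real (turan_number r (Suc m)) - turan_number r m"
      using turan_number_Suc_bounds(1)[of r m] r m by (simp add: algebra_simps)
    \<comment> \<open>The binomial terms contribute a non-negative amount, since by Pascal the two
      differences are \<open>m choose k\<close> and \<open>l choose k\<close> with
      \<open>m \<le> l\<close>.\<close>
    moreover have "real (Suc m choose r) - real (m choose r) \<le> real (n choose r) - real ((n - 1) choose r)"
    proof -
      have "(m choose k) \<le> (l choose k)" using ns l by (intro binomial_right_mono) (simp add: m_def)
      then show ?thesis by (simp add: k l)
    qed
    ultimately show ?thesis using N[OF n] unfolding jsize_def m(1,2) by linarith
  qed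
  then show ?thesis by blast
qed

lemma jsize_lower:
  fixes \<gamma> :: real
  assumes r: "2 \<le> r" and \<gamma>: "0 < \<gamma>"
  shows "\<exists>N. \<forall>n\<ge>N. (n / r) ^ r - \<gamma> * real n ^ r \<le> jsize r s n"
proof -
  obtain N where N: "\<And>n. N \<le> n \<Longrightarrow> real (s + r) \<le> n \<and>
    (1 / real r ^ r - \<gamma>) * real n ^ r \<le> ((real n - (s + r)) / r) ^ r"
    using shifted_power_lower[OF \<gamma>, of r "s + r" r] r by auto
  have "(n / r) ^ r - \<gamma> * real n ^ r \<le> jsize r s n" if n: "N \<le> n" for n
  proof -
    have ns: "s + r \<le> n" using N[OF n] by (simp only: of_nat_le_iff)
    have "((real n - (s + r)) / r) ^ r \<le> turan_number r (n - s)"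
      using turan_number_lower[of r "n - s"] ns r by (simp add: of_nat_diff algebra_simps)
    moreover have "(n - s) choose r \<le> n choose r" by (intro binomial_right_mono) simp
    moreover have "(n / r) ^ r - \<gamma> * real n ^ r = (1 / real r ^ r - \<gamma>) * real n ^ r"
      by (simp add: power_divide left_diff_distrib)
    ultimately show ?thesis using N[OF n] unfolding jsize_def by (simp add: of_nat_le_iff[symmetric] del: of_nat_le_iff)
  qed
  then show ?thesis by blast
qed

lemma fact_less_power:
  assumes "2 \<le> r"
  shows "fact (r - 1) < real r ^ (r - 1)"
proof -
  have "(fact (r - 1) :: nat) \<le> (r - 1) ^ (r - 1)"
    using fact_le_power[of "r - 1", where 'a = nat] by simp
  also have "\<dots> < r ^ (r - 1)" using assms by (intro power_strict_mono) auto
  finally have "real (fact (r - 1)) < real (r ^ (r - 1))" by (simp only: of_nat_less_iff)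
  then show ?thesis by simp
qed

text \<open>Moving one vertex from the partite part to the joined set replaces about
  \<open>n ^ (r - 1) / r ^ (r - 1)\<close> edges by about \<open>n ^ (r - 1) / (r - 1)!\<close>, a
  gain by \<open>fact_less_power\<close>; this is repeated from \<open>w\<close> to
  \<open>s\<close>.\<close>

lemma jsize_gap:
  assumes r: "2 \<le> r"
  shows "\<exists>c>0. \<exists>N. \<forall>n\<ge>N. \<forall>w\<le>s. real (n choose r) - real ((n - w) choose r) + turan_number r (n - w) +
    real (s - w) * (c * real n ^ (r - 1)) \<le> jsize r s n"
proof -
  define a where "a = 1 / (fact (r - 1) :: real)"
  define b where "b = 1 / real r ^ (r - 1)"
  have rr: "0 < real r ^ (r - 1)" using r by simp
  have ab: "b < a" unfolding a_def b_def using fact_less_power[OF r] rr by (intro divide_strict_left_mono mult_pos_pos) auto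
  \<comment> \<open>Of the four parts of \<open>a - b\<close>, one is lost in each of the two
    estimates for the degrees; half of what remains is claimed.\<close>
  define c where "c = (a - b) / 4"
  have c: "0 < c" using ab by (simp add: c_def)
  obtain N1 where N1: "\<And>n. N1 \<le> n \<Longrightarrow> real (s + r) \<le> n \<and>
    (1 / real 1 ^ (r - 1) - c) * real n ^ (r - 1) \<le> ((real n - (s + r)) / 1) ^ (r - 1)"
    using shifted_power_lower[OF c, of 1 "s + r" "r - 1"] by auto
  define N where "N = N1 + nat \<lceil>2 ^ r * r / c\<rceil> + r + 1"
  have step: "c * real n ^ (r - 1) \<le> real (m choose (r - 1)) - (real (turan_number r (Suc m)) - turan_number r m)"
    if n: "N \<le> n" and m: "n - s \<le> m" "m \<le> n" for n m
  proof -
    have n1: "N1 \<le> n" "2 ^ r * r / c \<le> n" "r \<le> n" "0 < n" using n unfolding N_def by linarith+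
    have ns: "s + r \<le> n" using N1[OF n1(1)] by (simp only: of_nat_le_iff)
    have f1: "1 \<le> (fact (r - 1) :: real)" by (rule fact_ge_1)
    have "(1 - c) * real n ^ (r - 1) \<le> (real n - (s + r)) ^ (r - 1)" using N1[OF n1(1)] by simp
    also have "\<dots> \<le> real (m - (r - 1)) ^ (r - 1)" using ns m r by (intro power_mono) (auto simp: of_nat_diff)
    also have "\<dots> \<le> real (fact (r - 1) * (m choose (r - 1)))"
      unfolding of_nat_power[symmetric] of_nat_le_iff using ns m by (intro binomial_lower) auto
    finally have "(1 - c) * real n ^ (r - 1) / fact (r - 1) \<le> real (m choose (r - 1))"
      by (simp add: divide_le_eq mult.commute)
    moreover have "(a - c) * real n ^ (r - 1) \<le> (1 - c) * real n ^ (r - 1) / fact (r - 1)"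
    proof -
      have "a - c \<le> (1 - c) / fact (r - 1)"
        using c f1 by (simp add: a_def diff_divide_distrib divide_le_eq mult_le_cancel_left1)
      then have "(a - c) * real n ^ (r - 1) \<le> (1 - c) / fact (r - 1) * real n ^ (r - 1)" by (intro mult_right_mono) auto
      then show ?thesis by simp
    qed
    moreover have "real (turan_number r (Suc m)) - turan_number r m \<le> (b + c) * real n ^ (r - 1)"
    proof -
      have "real (turan_number r (Suc m)) - turan_number r m \<le> ((real m + r) / r) ^ (r - 1)"
        using turan_number_Suc_bounds(2)[of r m] r by simp
      also have "\<dots> \<le> ((real n + r) / r) ^ (r - 1)" using m by (intro power_mono divide_right_mono) auto
      also have "\<dots> = (1 + r / real n) ^ (r - 1) * (b * real n ^ (r - 1))"
      proof -
        have "(real n + r) / r = (1 + r / real n) * (n / r)" using n1 r by (simp add: field_simps)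
        moreover have "b * real n ^ (r - 1) = (n / r) ^ (r - 1)" by (simp add: b_def power_divide)
        ultimately show ?thesis by (simp only: power_mult_distrib)
      qed
      also have "\<dots> \<le> (1 + c) * (b * real n ^ (r - 1))"
      proof (rule mult_right_mono)
        have "(1 + r / real n) ^ (r - 1) \<le> 1 + (2 ^ (r - 1) - 1) * (r / real n)"
          using n1 by (intro power_one_plus_le) auto
        also have "(2 ^ (r - 1) - 1) * (r / real n) \<le> 2 ^ r * (r / real n)"
        proof (rule mult_right_mono)
          have "(2 :: real) ^ (r - 1) \<le> 2 ^ r" by (intro power_increasing) auto
          then show "(2 :: real) ^ (r - 1) - 1 \<le> 2 ^ r" by linarith
        qed simp
        also have "2 ^ r * (r / real n) \<le> c" using n1(2,4) c by (simp add: field_simps)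
        finally show "(1 + r / real n) ^ (r - 1) \<le> 1 + c" by simp
      qed (use rr in \<open>simp add: b_def\<close>)
      also have "\<dots> \<le> (b + c) * real n ^ (r - 1)"
      proof -
        have "b \<le> 1" unfolding b_def using r by (simp add: one_le_power)
        then have "(1 + c) * b \<le> b + c" using c by (simp add: algebra_simps mult_left_le)
        then have "(1 + c) * b * real n ^ (r - 1) \<le> (b + c) * real n ^ (r - 1)" by (intro mult_right_mono) auto
        then show ?thesis by (simp only: mult.assoc)
      qed
      finally show ?thesis .
    qed
    moreover have "(a - c) * real n ^ (r - 1) - (b + c) * real n ^ (r - 1) = 2 * c * real n ^ (r - 1)"
      by (simp add: c_def field_simps)
    moreover have "0 \<le> c * real n ^ (r - 1)" using c by simp
    ultimately show ?thesis by linarith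
  qed
  define f where "f n w = real (n choose r) - real ((n - w) choose r) + turan_number r (n - w)" for n w
  have inc: "f n w + c * real n ^ (r - 1) \<le> f n (Suc w)" if n: "N \<le> n" and w: "w < s" for n w
  proof -
    have "N1 \<le> n" using n by (simp add: N_def)
    then have ns: "s + r \<le> n" using N1 by (metis of_nat_le_iff)
    define m where "m = n - Suc w"
    have m: "n - w = Suc m" using ns w by (simp add: m_def)
    obtain k where k: "r = Suc k" using r by (cases r) auto
    have "real (Suc m choose r) - real (m choose r) = real (m choose (r - 1))" by (simp add: k)
    moreover have "c * real n ^ (r - 1) \<le> real (m choose (r - 1)) - (real (turan_number r (Suc m)) - turan_number r m)"
      using w by (intro step[OF n]) (auto simp: m_def)
    ultimately show ?thesis unfolding f_def m m_def[symmetric] by linarith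
  qed
  have tot: "f n w + real (s - w) * (c * real n ^ (r - 1)) \<le> f n s" if n: "N \<le> n" and w: "w \<le> s" for n w
    using w
  proof (induction w rule: inc_induct)
    case base
    then show ?case by simp
  next
    case (step w)
    have "real (s - w) = real (s - Suc w) + 1" using step by simp
    then show ?case using step inc[OF n, of w] by (simp add: algebra_simps)
  qed
  show ?thesis
  proof (rule exI[of _ c], intro conjI c, rule exI[of _ N], intro allI impI)
    fix n w assume "N \<le> n" "w \<le> s"
    from tot[OF this] show "real (n choose r) - real ((n - w) choose r) + turan_number r (n - w) +
      real (s - w) * (c * real n ^ (r - 1)) \<le> jsize r s n" unfolding f_def jsize_def .
  qed
qed

text \<open>By Bernoulli, \<open>a \<le> q (1 + 1/q)\<^sup>a\<^sup>-\<^sup>q\<close> with equality only for \<open>a \<in> {q, q + 1}\<close>; multiplying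
  these inequalities compares a product of class sizes with the balanced one.\<close>

lemma balanced_factor_bound:
  assumes q: "0 < q"
  shows "real a \<le> q * (1 + 1 / real q) powr (real a - q)"
    "a \<noteq> q \<Longrightarrow> a \<noteq> q + 1 \<Longrightarrow> real a < q * (1 + 1 / real q) powr (real a - q)"
    "a = q \<or> a = q + 1 \<Longrightarrow> real a = q * (1 + 1 / real q) powr (real a - q)"
proof -
  let ?x = "1 + 1 / real q"
  have x: "0 < ?x" using q by (simp add: add_pos_nonneg)
  show eq: "real a = q * ?x powr (real a - q)" if "a = q \<or> a = q + 1"
    using that x q by (auto simp: field_simps)
  show lt: "real a < q * ?x powr (real a - q)" if a: "a \<noteq> q" "a \<noteq> q + 1"
  proof (cases "q \<le> a")
    case True
    define k where "k = a - q"
    have k: "2 \<le> k" "a = q + k" using a True by (auto simp: k_def)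
    \<comment> \<open>Bernoulli is applied to all factors but one; multiplying by the last factor
      leaves the surplus \<open>(k - 1) / q\<^sup>2\<close>, hence strictness.\<close>
    then obtain l where l: "k = Suc (Suc l)" by (metis add_2_eq_Suc le_Suc_ex)
    have "1 + real (Suc l) * (1 / q) \<le> ?x ^ Suc l" by (rule Bernoulli_inequality) (use q in \<open>simp add: order_trans[of _ 0]\<close>)
    then have "?x * (1 + real (Suc l) * (1 / q)) \<le> ?x ^ k" using x l by (simp add: mult_left_mono)
    moreover have "1 + real k * (1 / q) < ?x * (1 + real (Suc l) * (1 / q))"
    proof -
      have "(1 + u) * (1 + z * u) = 1 + (z + 1) * u + z * u * u" for u z :: real by (simp add: algebra_simps)
      from this[of "1 / q" "real (Suc l)"]
      have "?x * (1 + real (Suc l) * (1 / q)) = 1 + real k * (1 / q) + real (Suc l) * (1 / q) * (1 / q)"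
        unfolding l of_nat_Suc[of "Suc l"] by simp
      then show ?thesis using q by simp
    qed
    ultimately have "1 + real k * (1 / q) < ?x ^ k" by linarith
    then have "q * (1 + real k * (1 / q)) < q * ?x ^ k" using q by simp
    moreover have "q * (1 + real k * (1 / q)) = a" using q k by (simp add: field_simps)
    moreover have "?x powr (real a - q) = ?x ^ k" using x k by (simp add: powr_realpow)
    ultimately show ?thesis by simp
  next
    case False
    define k where "k = q - a"
    have k: "0 < k" "q = a + k" using False by (auto simp: k_def)
    \<comment> \<open>The inverse of \<open>1 + 1 / q\<close> is \<open>1 - 1 / (q + 1)\<close>, and
      strictness comes from \<open>1 / (q + 1) < 1 / q\<close>.\<close>
    define y where "y = 1 / (real q + 1)"
    have y: "1 + - y = inverse ?x" using q by (simp add: y_def field_simps)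
    have "1 + real k * (- y) \<le> (1 + - y) ^ k"
      by (rule Bernoulli_inequality) (simp add: y_def)
    then have "1 + real k * (- y) \<le> inverse ?x ^ k" unfolding y .
    moreover have "1 - real k / q < 1 + real k * (- y)"
    proof -
      have "real k * y < real k / q" using k q by (simp add: y_def field_simps)
      then show ?thesis by simp
    qed
    ultimately have "1 - real k / q < inverse ?x ^ k" by linarith
    then have "q * (1 - real k / q) < q * inverse ?x ^ k" using q by simp
    moreover have "q * (1 - real k / q) = a" using q k by (simp add: field_simps)
    moreover have "?x powr (real a - q) = inverse ?x ^ k"
    proof -
      have "real a - q = - real k" using k by simp
      then show ?thesis using x by (simp add: powr_minus powr_realpow power_inverse)
    qed
    ultimately show ?thesis by simp
  qed
  show "real a \<le> q * ?x powr (real a - q)" using eq lt by (cases "a = q \<or> a = q + 1") auto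
qed

lemma balanced_values:
  fixes a :: "nat \<Rightarrow> nat"
  assumes r: "0 < r" and sum: "sum a {..<r} = m" and bal: "\<And>i j. i < r \<Longrightarrow> j < r \<Longrightarrow> a i \<le> a j + 1" and i: "i < r"
  shows "a i = m div r \<or> a i = m div r + 1"
proof -
  have s: "sum a {..<r} = a i + sum a ({..<r} - {i})" using i by (simp add: sum.remove[of _ i])
  have "sum a ({..<r} - {i}) \<le> (\<Sum>j\<in>{..<r} - {i}. a i + 1)" using bal i by (intro sum_mono) auto
  also have "\<dots> = (r - 1) * (a i + 1)" using i by simp
  finally have 1: "m \<le> a i + (r - 1) * (a i + 1)" using s sum by simp
  have "(r - 1) * a i = (\<Sum>j\<in>{..<r} - {i}. a i)" using i by simp
  also have "\<dots> \<le> (\<Sum>j\<in>{..<r} - {i}. a j + 1)" using bal i by (intro sum_mono) auto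
  also have "\<dots> = sum a ({..<r} - {i}) + (r - 1)" using i by (simp only: sum.distrib) simp
  finally have 2: "a i + (r - 1) * a i \<le> m + (r - 1)" using s sum by simp
  obtain k where k: "r = Suc k" using r by (cases r) auto
  have "m < (a i + 1) * r" using 1 by (simp add: k mult.commute)
  then have "m div r < a i + 1" using r by (simp add: div_less_iff_less_mult)
  moreover have "a i < m div r + 2"
  proof -
    have "a i * r < m + r" using 2 by (simp add: k mult.commute)
    moreover have "m < (m div r + 1) * r" using div_less_iff_less_mult[OF r, of m "m div r + 1"] by simp
    ultimately have "a i * r < (m div r + 2) * r" by (simp add: algebra_simps)
    then show ?thesis by (simp only: mult_less_cancel2)
  qed
  ultimately show ?thesis by linarith
qed

lemma part_values:
  assumes "i < r"
  shows "card (part r m i) = m div r \<or> card (part r m i) = m div r + 1"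
  using assms by (intro balanced_values sum_card_part part_balanced) auto

text \<open>Each factor \<open>b\<close> is at most \<open>h b\<close>, and the product of the
  \<open>h\<close> values depends on the sum of the sizes only. For the balanced sizes every factor
  is tight, so that product is the Turan number; equality forces tightness of every factor.\<close>

lemma prod_le_turan_number:
  fixes a :: "nat \<Rightarrow> nat"
  assumes r: "0 < r" "r \<le> m" and sum: "sum a {..<r} = m"
  shows "prod a {..<r} \<le> turan_number r m"
    "prod a {..<r} = turan_number r m \<Longrightarrow> i < r \<Longrightarrow> a i = m div r \<or> a i = m div r + 1"
proof -
  define q where "q = m div r"
  have q: "0 < q" using r by (simp add: q_def div_greater_zero_iff)
  define x where "x = 1 + 1 / real q"
  define h where "h b = real q * x powr (real b - q)" for b :: nat
  have x: "0 < x" using q by (simp add: x_def add_pos_nonneg)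
  have hpos: "0 < h b" for b using q x by (simp add: h_def)
  have le: "real b \<le> h b" for b unfolding h_def x_def by (rule balanced_factor_bound(1)[OF q])
  have total: "(\<Prod>j<r. h (b j)) = real q ^ r * x powr (real m - r * real q)" if "sum b {..<r} = m" for b
  proof -
    have "(\<Sum>j<r. real (b j) - q) = real m - r * real q"
      using that by (simp add: sum_subtractf flip: of_nat_sum)
    then show ?thesis using x by (simp add: h_def prod.distrib powr_sum[symmetric])
  qed
  have "turan_number r m = (\<Prod>j<r. real (card (part r m j)))" by (simp add: turan_number_eq[OF r(1)])
  also have "\<dots> = (\<Prod>j<r. h (card (part r m j)))"
    unfolding h_def x_def by (intro prod.cong refl balanced_factor_bound(3)[OF q]) (use part_values in \<open>auto simp: q_def\<close>)
  also have "\<dots> = (\<Prod>j<r. h (a j))" using total[OF sum] total[OF sum_card_part[OF r(1)]] by simp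
  finally have T: "real (turan_number r m) = (\<Prod>j<r. h (a j))" .
  have "real (prod a {..<r}) \<le> (\<Prod>j<r. h (a j))" unfolding of_nat_prod using le by (intro prod_mono) auto
  then show "prod a {..<r} \<le> turan_number r m" unfolding T[symmetric] by (simp only: of_nat_le_iff)
  assume eq: "prod a {..<r} = turan_number r m" and i: "i < r"
  show "a i = m div r \<or> a i = m div r + 1"
  proof (rule ccontr)
    assume n: "\<not> ?thesis"
    then have "real (a i) < h (a i)" unfolding h_def x_def by (intro balanced_factor_bound(2)[OF q]) (auto simp: q_def)
    moreover have "(\<Prod>j\<in>{..<r} - {i}. real (a j)) \<le> (\<Prod>j\<in>{..<r} - {i}. h (a j))" using le by (intro prod_mono) auto
    moreover have "0 < (\<Prod>j\<in>{..<r} - {i}. h (a j))" using hpos by (intro prod_pos) auto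
    ultimately have "real (a i) * (\<Prod>j\<in>{..<r} - {i}. real (a j)) < h (a i) * (\<Prod>j\<in>{..<r} - {i}. h (a j))"
    proof -
      assume 1: "real (a i) < h (a i)" and 2: "(\<Prod>j\<in>{..<r} - {i}. real (a j)) \<le> (\<Prod>j\<in>{..<r} - {i}. h (a j))"
        and 3: "0 < (\<Prod>j\<in>{..<r} - {i}. h (a j))"
      have "real (a i) * (\<Prod>j\<in>{..<r} - {i}. real (a j)) \<le> real (a i) * (\<Prod>j\<in>{..<r} - {i}. h (a j))"
        using 2 by (intro mult_left_mono) auto
      also have "\<dots> < h (a i) * (\<Prod>j\<in>{..<r} - {i}. h (a j))" using 1 3 by (intro mult_strict_right_mono)
      finally show ?thesis .
    qed
    moreover have "real (a i) * (\<Prod>j\<in>{..<r} - {i}. real (a j)) = real (prod a {..<r})"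
      using i by (simp add: prod.remove[of "{..<r}" i])
    moreover have "h (a i) * (\<Prod>j\<in>{..<r} - {i}. h (a j)) = (\<Prod>j<r. h (a j))"
      using i by (simp add: prod.remove[of "{..<r}" i])
    ultimately show False using eq T by simp
  qed
qed

lemma sum_colour_classes:
  fixes p :: "'a \<Rightarrow> nat"
  assumes "finite V" "\<And>v. v \<in> V \<Longrightarrow> p v < r"
  shows "(\<Sum>j<r. card {v\<in>V. p v = j}) = card V"
proof -
  have "V = (\<Union>j<r. {v\<in>V. p v = j})" using assms by auto
  also have "card \<dots> = (\<Sum>j<r. card {v\<in>V. p v = j})"
    using assms by (intro card_UN_disjoint) auto
  finally show ?thesis by simp
qed

lemma card_edges_meeting:
  assumes "finite V" "W \<subseteq> V"
  shows "card {e. e \<subseteq> V \<and> card e = r \<and> e \<inter> W \<noteq> {}} + ((card V - card W) choose r) = card V choose r"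
proof -
  have fW: "finite W" using assms finite_subset by blast
  have "{e. e \<subseteq> V \<and> card e = r} = {e. e \<subseteq> V \<and> card e = r \<and> e \<inter> W \<noteq> {}} \<union> {e. e \<subseteq> V - W \<and> card e = r}" by auto
  also have "card \<dots> = card {e. e \<subseteq> V \<and> card e = r \<and> e \<inter> W \<noteq> {}} + card {e. e \<subseteq> V - W \<and> card e = r}"
    using assms by (intro card_Un_disjoint) auto
  finally show ?thesis using assms fW by (simp add: n_subsets card_Diff_subset)
qed

text \<open>An edge meets \<open>W\<close>, or is rainbow outside \<open>W\<close>, or is counted in
  the last term; the second kind is bounded by the Turan number.\<close>

lemma edges_upper_bound:
  fixes p :: "'a \<Rightarrow> nat"
  assumes H: "r_graph r (Hypergraph V E)" and W: "W \<subseteq> V" and p: "\<And>v. v \<in> V \<Longrightarrow> p v < r"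
    and r: "0 < r" "r \<le> card V - card W"
  shows "real (card E) \<le> real (card V choose r) - real ((card V - card W) choose r) + turan_number r (card V - card W) +
    card {e\<in>E. e \<inter> W = {} \<and> \<not> inj_on p e}"
proof -
  note D = r_graphD[OF H]
  have fW: "finite W" using W D(1) finite_subset by blast
  let ?M = "{e. e \<subseteq> V \<and> card e = r \<and> e \<inter> W \<noteq> {}}"
  let ?R = "rainbow (V - W) p {..<r}"
  let ?B = "{e\<in>E. e \<inter> W = {} \<and> \<not> inj_on p e}"
  have "E \<subseteq> ?M \<union> ?R \<union> ?B"
  proof
    fix e assume e: "e \<in> E"
    have "e \<in> ?R" if "e \<inter> W = {}" "inj_on p e"
      using that D(2,3)[OF e] p by (intro rainbowI) auto
    then show "e \<in> ?M \<union> ?R \<union> ?B" using e D(2,3)[OF e] by blast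
  qed
  moreover have "finite ?M" "finite ?R" "finite ?B" using D(1,5) finite_rainbow[of "V - W"] by auto
  ultimately have "card E \<le> card (?M \<union> ?R \<union> ?B)" by (intro card_mono) auto
  also have "\<dots> \<le> card ?M + card ?R + card ?B" by (intro order_trans[OF card_Un_le] add_right_mono card_Un_le)
  also have "card ?R \<le> turan_number r (card V - card W)"
  proof -
    have "(\<Sum>j<r. card {v\<in>V - W. p v = j}) = card V - card W"
      using sum_colour_classes[of "V - W" p r] D(1) p fW W by (simp add: card_Diff_subset)
    then show ?thesis using prod_le_turan_number(1)[OF r] D(1) by (simp add: card_rainbow)
  qed
  finally have "card E \<le> card ?M + turan_number r (card V - card W) + card ?B" by simp
  moreover have "card ?M + ((card V - card W) choose r) = card V choose r" by (rule card_edges_meeting[OF D(1) W])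
  ultimately show ?thesis by linarith
qed

lemma ex_maximal_colouring:
  fixes p0 :: "'a \<Rightarrow> nat"
  assumes H: "r_graph r (Hypergraph V E)" and r: "2 \<le> r" and p0: "\<forall>v\<in>V. p0 v < r" and V: "V \<noteq> {}"
  shows "\<exists>p. coloured_graph r V E p \<and> coloured_graph.maximal r V E p \<and>
    card (E \<inter> rainbow V p0 {..<r}) \<le> card (E \<inter> rainbow V p {..<r})"
proof -
  let ?P = "\<lambda>q :: 'a \<Rightarrow> nat. \<forall>v\<in>V. q v < r"
  let ?f = "\<lambda>q. card (E \<inter> rainbow V q {..<r})"
  have "\<forall>q. ?P q \<longrightarrow> ?f q < Suc (card E)"
    using r_graphD(5)[OF H] by (auto intro!: le_imp_less_Suc card_mono)
  then obtain p where p: "?P p" "\<And>q. ?P q \<Longrightarrow> ?f q \<le> ?f p"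
    using ex_has_greatest_nat[of ?P p0 ?f "Suc (card E)"] p0 by blast
  interpret coloured_graph r V E p using H r p(1) V by unfold_locales auto
  have "coloured_graph r V E p" by unfold_locales
  moreover have maximal using p(2) by (simp add: maximal_def)
  ultimately show ?thesis using p(2)[of p0] p0 by blast
qed

section \<open>Feasibility of the parameters and typical vertices\<close>

context coloured_graph
begin

text \<open>Incoherent extensions and low vertices together use a quarter of
  \<open>\<delta> * n\<close>, the constants bounded by \<open>K\<close> another quarter.\<close>

lemma fitsI:
  fixes c \<alpha> \<delta> :: real
  assumes c: "0 < c" "c * n ^ r \<le> card (rainbow V p {..<r})" "4 * \<delta> \<le> c" and \<delta>: "0 < \<delta>"
    and \<alpha>: "0 < \<alpha>" "\<alpha> \<le> 1" "good \<alpha> {}" and A: "(2 ^ (t + t * r) * real r + real r / c) * \<alpha> \<le> \<delta> / 4"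
    and K: "K = t * (r * r) + t * r + r * r + 1" "4 * real K \<le> \<delta> * n"
  shows "fits t K \<delta> \<alpha>"
proof -
  have Kn: "real K \<le> \<delta> * n" using K(2) by simp
  have low: "card (low K \<delta>) \<le> real r * \<alpha> / c * n" by (rule card_low[OF Kn c(2,1,3) \<alpha>])
  have "(2 ^ (t + t * r) * real r + real r / c) * \<alpha> * n \<le> \<delta> / 4 * n" using A n_pos by (intro mult_right_mono) auto
  then have 1: "2 ^ (t + t * r) * (real r * \<alpha> * n) + real r * \<alpha> / c * n \<le> \<delta> * n / 4" by (simp add: algebra_simps)
  have "1 * r \<le> r * r" using r2 by (intro mult_le_mono1) simp
  then have "t * (r * r) + t * r + r \<le> K" using K(1) by linarith
  then have 2: "real (t * (r * r) + t * r + r) \<le> real K" by (simp only: of_nat_le_iff)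
  have "0 < \<delta> * n" using \<delta> n_pos by simp
  then have "2 ^ (t + t * r) * (real r * \<alpha> * n) + real (t * (r * r) + t * r + r) + card (low K \<delta>) < \<delta> * n"
    using low 1 2 K(2) by linarith
  then show ?thesis using \<alpha> K(1) by (simp add: fits_def algebra_simps)
qed

lemma good_empty:
  assumes e: "(n / r) ^ r - \<epsilon> * n ^ r \<le> card (E \<inter> rainbow V p {..<r})" and \<epsilon>: "\<epsilon> \<le> \<alpha> ^ r / 2"
  shows "good \<alpha> {}"
proof -
  have "missing {} = rainbow V p {..<r} - E \<inter> rainbow V p {..<r}" by (auto simp: missing_def)
  then have "card (missing {}) = card (rainbow V p {..<r}) - card (E \<inter> rainbow V p {..<r})"
    using D(5) by (simp add: card_Diff_subset)
  moreover have "card (E \<inter> rainbow V p {..<r}) \<le> card (rainbow V p {..<r})"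
    using finite_rainbow[OF D(1)] by (intro card_mono) auto
  ultimately have "real (card (missing {})) = real (card (rainbow V p {..<r})) - card (E \<inter> rainbow V p {..<r})"
    by (simp add: of_nat_diff)
  also have "\<dots> \<le> \<epsilon> * n ^ r"
    using e card_rainbow_le[OF D(1), of r p] r2 p_less by simp
  also have "\<dots> \<le> \<alpha> ^ r / 2 * n ^ r" using \<epsilon> n_pos by (intro mult_right_mono) auto
  finally show ?thesis by (simp add: good_def power_mult_distrib)
qed

lemma good_mono:
  assumes "good \<alpha> S" "0 < \<alpha>" "\<alpha> \<le> \<beta>"
  shows "good \<beta> S"
proof -
  have "(\<alpha> * n) ^ (r - card S) \<le> (\<beta> * n) ^ (r - card S)" using assms n_pos by (intro power_mono mult_right_mono) auto
  then show ?thesis using assms(1) by (simp add: good_def)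
qed

text \<open>A vertex not wild for \<open>\<delta>1\<close> lies in at least
  \<open>(1 / r ^ (r - 1) - 4 * \<delta>1) * n ^ (r - 1)\<close> rainbow edges, one
  \<open>\<delta>1\<close> being lost in the degree and three in the other edges. By
  \<open>colourful_upper\<close> it lies in hardly more rainbow sets, so few of these are missing:
  too few for a low vertex, and few enough on the scale of \<open>\<alpha>2\<close>.\<close>

lemma tame_vertices:
  fixes c \<delta>1 \<delta>2 \<alpha>1 \<alpha>2 :: real
  assumes free: "\<not> contains_copy (Hypergraph V E) (semi_blowup_fan r t)"
    and fit: "fits t K \<delta>1 \<alpha>1" and max: maximal and K: "K \<le> \<delta>1 * n" "\<delta>1 \<le> \<delta>2" "0 < \<delta>1"
    and deg: "\<And>v. v \<in> V \<Longrightarrow> (1 / real r ^ (r - 1) - \<delta>1) * n ^ (r - 1) \<le> card {e\<in>E. v \<in> e}"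
    and c: "0 < c" "c * n ^ r \<le> card (rainbow V p {..<r})" "4 * \<delta>2 \<le> c" "t \<le> c * n"
    and d1: "6 * \<delta>1 < 1 / real r ^ (r - 1)" "8 * \<delta>1 * real r ^ (r - 1) \<le> 1"
      "2 ^ (r + 3) * \<delta>1 \<le> \<alpha>2 ^ (r - 1) / 2" "2 ^ (r + 3) * \<delta>1 < c / 2"
    and v: "v \<in> V" "v \<notin> wild K \<delta>1"
  shows "v \<notin> low K \<delta>2 \<and> good \<alpha>2 {v}"
proof -
  have d: "5 * \<delta>1 < 1 / real r ^ (r - 1) - \<delta>1" using d1(1) by simp
  have nw: "(1 / real r ^ (r - 1) - 4 * \<delta>1) * n ^ (r - 1) \<le> card {e\<in>E. e \<in> colourful u}"
    if "u \<in> V" "u \<notin> wild K \<delta>1" for u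
    using nonwild_colourful[OF max that K(1) deg[OF that(1)] d] by simp
  have le: "card {e\<in>E. e \<in> colourful u} \<le> card (colourful u)" for u
    using finite_colourful by (intro card_mono) auto
  \<comment> \<open>Every class has linear size and there are fewer than \<open>t\<close> wild
    vertices, so every colour occurs at a vertex that is not wild.\<close>
  have lo: "\<exists>u\<in>V. p u = j \<and> (1 / real r ^ (r - 1) - 4 * \<delta>1) * n ^ (r - 1) \<le> card (colourful u)" if j: "j < r" for j
  proof -
    have "card (wild K \<delta>1) < t" by (rule card_wild_less[OF free fit])
    moreover have "c * n \<le> card {u\<in>V. p u = j}" by (rule class_lower[OF j c(2)])
    ultimately have "card (wild K \<delta>1) < card {u\<in>V. p u = j}" using c(4) by linarith
    then have "\<not> {u\<in>V. p u = j} \<subseteq> wild K \<delta>1" using D(1) card_mono[of "wild K \<delta>1" "{u\<in>V. p u = j}"]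
      by (auto simp: wild_def)
    then obtain u where u: "u \<in> V" "p u = j" "u \<notin> wild K \<delta>1" by blast
    then show ?thesis using nw[OF u(1,3)] le[of u] by (intro bexI[of _ u]) auto
  qed
  have up: "card (colourful v) \<le> (1 / real r ^ (r - 1) + 2 ^ (r + 2) * \<delta>1) * n ^ (r - 1)"
    by (rule colourful_upper[OF lo K(3) d1(2) v(1)])
  have "real (card (missing {v})) \<le> (2 ^ (r + 2) + 4) * \<delta>1 * n ^ (r - 1)"
  proof -
    have "real (card (missing {v})) = real (card (colourful v)) - card {e\<in>E. e \<in> colourful v}"
      using colourful_missing[of v] by linarith
    also have "\<dots> \<le> (1 / real r ^ (r - 1) + 2 ^ (r + 2) * \<delta>1) * n ^ (r - 1) - (1 / real r ^ (r - 1) - 4 * \<delta>1) * n ^ (r - 1)"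
      using up nw[OF v] by linarith
    also have "\<dots> = (2 ^ (r + 2) + 4) * \<delta>1 * n ^ (r - 1)" by (simp add: algebra_simps)
    finally show ?thesis .
  qed
  also have "\<dots> \<le> 2 ^ (r + 3) * \<delta>1 * n ^ (r - 1)"
  proof (intro mult_right_mono)
    have "(2 :: real) ^ 2 \<le> 2 ^ (r + 2)" by (intro power_increasing) auto
    then show "(2 :: real) ^ (r + 2) + 4 \<le> 2 ^ (r + 3)" by (simp add: power_add)
  qed (use K in auto)
  finally have m: "real (card (missing {v})) \<le> 2 ^ (r + 3) * \<delta>1 * n ^ (r - 1)" .
  have P: "0 < n ^ (r - 1)" using n_pos by simp
  have "v \<notin> low K \<delta>2"
  proof
    assume "v \<in> low K \<delta>2"
    moreover have "K \<le> \<delta>2 * n" using K(1) mult_right_mono[OF K(2), of n] n_pos by linarith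
    ultimately have "(c - 2 * \<delta>2) * n ^ (r - 1) \<le> card (missing {v})" by (intro low_missing c)
    then have "(c - 2 * \<delta>2) * n ^ (r - 1) \<le> (2 ^ (r + 3) * \<delta>1) * n ^ (r - 1)" using m by linarith
    then have "c - 2 * \<delta>2 \<le> 2 ^ (r + 3) * \<delta>1" using P by (simp only: mult_le_cancel_right_pos)
    then show False using c d1(4) by linarith
  qed
  moreover have "good \<alpha>2 {v}"
  proof -
    have "2 ^ (r + 3) * \<delta>1 * n ^ (r - 1) \<le> \<alpha>2 ^ (r - 1) / 2 * n ^ (r - 1)" using d1(3) P by (intro mult_right_mono) auto
    then show ?thesis using m by (simp add: good_def power_mult_distrib)
  qed
  ultimately show ?thesis by blast
qed

end

text \<open>The constants are chosen in the order \<open>g\<close>, \<open>\<delta>2\<close>,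
  \<open>\<alpha>2\<close>, \<open>\<delta>1\<close>, \<open>\<alpha>1\<close>,
  \<open>\<epsilon>\<close>, \<open>\<gamma>\<close>, each small in terms of the earlier ones. The
  minimum degree hypothesis is the one that deleting vertices will secure.\<close>

lemma structure_of_dense_graphs:
  assumes r: "2 \<le> r" and t: "1 \<le> t"
  shows "\<exists>N. \<forall>(V :: 'a set) E. r_graph r (Hypergraph V E) \<and> N \<le> card V \<and>
    \<not> contains_copy (Hypergraph V E) (semi_blowup_fan r t) \<and> jsize r (t - 1) (card V) \<le> card E \<and>
    (\<forall>v\<in>V. jsize r (t - 1) (card V) - jsize r (t - 1) (card V - 1) \<le> card {e\<in>E. v \<in> e}) \<longrightarrow>
    (\<exists>W (p :: 'a \<Rightarrow> nat). W \<subseteq> V \<and> card W = t - 1 \<and> (\<forall>v\<in>V. p v < r) \<and> (\<forall>e\<in>E. e \<inter> W \<noteq> {} \<or> inj_on p e))"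
proof -
  define R where "R = real r ^ (r - 1)"
  have R: "1 \<le> R" using r by (simp add: R_def one_le_power)
  have rR: "real r ^ r = r * R" using r by (simp add: R_def power_eq_if)
  \<comment> \<open>Half of the density \<open>1 / r ^ r\<close> of rainbow sets; the other half
    absorbs \<open>\<epsilon>\<close>.\<close>
  define c where "c = 1 / (2 * real r ^ r)"
  have c: "0 < c" "c \<le> 1 / (4 * R)"
  proof -
    show "0 < c" using r by (simp add: c_def)
    have "4 * R \<le> 2 * real r ^ r" unfolding rR using r R by (simp add: mult_right_mono)
    moreover have "0 < 2 * real r ^ r * (4 * R)" using r R by simp
    ultimately show "c \<le> 1 / (4 * R)" unfolding c_def by (intro divide_left_mono) auto
  qed
  obtain g Ng where g: "0 < g" and Ng: "\<And>n w. Ng \<le> n \<Longrightarrow> w \<le> t - 1 \<Longrightarrow>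
    real (n choose r) - real ((n - w) choose r) + turan_number r (n - w) + real (t - 1 - w) * (g * real n ^ (r - 1)) \<le> jsize r (t - 1) n"
    using jsize_gap[OF r, of "t - 1"] by blast
  define B where "B = 3 * real r * real r + 3"
  have B: "0 < B" by (simp add: B_def add_nonneg_pos)
  \<comment> \<open>The second bound gives \<open>B * \<delta>2 \<le> g / 2\<close>: per vertex
    lacking in \<open>W\<close>, the bad edges use up at most half of the gap
    \<open>g\<close>.\<close>
  define \<delta>2 where "\<delta>2 = min (c / 4) (g / (2 * B))"
  have \<delta>2: "0 < \<delta>2" "4 * \<delta>2 \<le> c" "B * \<delta>2 \<le> g / 2"
  proof -
    show "0 < \<delta>2" using c g B by (simp add: \<delta>2_def)
    show "4 * \<delta>2 \<le> c" by (simp add: \<delta>2_def)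
    have "\<delta>2 \<le> g / (2 * B)" by (simp add: \<delta>2_def)
    then have "B * \<delta>2 \<le> B * (g / (2 * B))" using B by (intro mult_left_mono) auto
    then show "B * \<delta>2 \<le> g / 2" using B by simp
  qed
  define K where "K = t * (r * r) + t * r + r * r + 1"
  define A where "A = 2 ^ (t + t * r) * real r + real r / c"
  have A: "0 < A" using r c by (simp add: A_def add_pos_pos)
  define \<alpha>2 where "\<alpha>2 = min 1 (\<delta>2 / (4 * A))"
  have \<alpha>2: "0 < \<alpha>2" "\<alpha>2 \<le> 1" "A * \<alpha>2 \<le> \<delta>2 / 4"
  proof -
    show "0 < \<alpha>2" "\<alpha>2 \<le> 1" using \<delta>2 A by (auto simp: \<alpha>2_def)
    have "\<alpha>2 \<le> \<delta>2 / (4 * A)" by (simp add: \<alpha>2_def)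
    then have "A * \<alpha>2 \<le> A * (\<delta>2 / (4 * A))" using A by (intro mult_left_mono) auto
    then show "A * \<alpha>2 \<le> \<delta>2 / 4" using A by simp
  qed
  define Q where "Q = (2 :: real) ^ (r + 3)"
  have Q: "0 < Q" by (simp add: Q_def)
  \<comment> \<open>Missing sets at a vertex not wild for \<open>\<delta>1\<close> are controlled by
    \<open>Q * \<delta>1\<close>, which must stay below the goodness threshold for
    \<open>\<alpha>2\<close> and below what a low vertex would miss.\<close>
  define \<delta>1 where "\<delta>1 = min \<delta>2 (min (\<alpha>2 ^ (r - 1) / 2 / Q) (c / 4 / Q))"
  have \<delta>1: "0 < \<delta>1" "\<delta>1 \<le> \<delta>2" "Q * \<delta>1 \<le> \<alpha>2 ^ (r - 1) / 2" "Q * \<delta>1 < c / 2"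
  proof -
    show "0 < \<delta>1" using \<delta>2 \<alpha>2 Q c by (simp add: \<delta>1_def)
    show "\<delta>1 \<le> \<delta>2" by (simp add: \<delta>1_def)
    have "\<delta>1 \<le> \<alpha>2 ^ (r - 1) / 2 / Q" "\<delta>1 \<le> c / 4 / Q" by (simp_all add: \<delta>1_def)
    then have "Q * \<delta>1 \<le> \<alpha>2 ^ (r - 1) / 2" "Q * \<delta>1 \<le> c / 4" using Q by (simp_all add: field_simps)
    then show "Q * \<delta>1 \<le> \<alpha>2 ^ (r - 1) / 2" "Q * \<delta>1 < c / 2" using c by auto
  qed
  have \<delta>R: "6 * \<delta>2 < 1 / R" "8 * \<delta>1 * R \<le> 1"
  proof -
    define u where "u = 1 / R"
    have u: "0 < u" "c \<le> u / 4" using R c(2) by (simp_all add: u_def)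
    then have "6 * \<delta>2 < u" "8 * \<delta>1 \<le> u" using \<delta>1(2) \<delta>2(2) by linarith+
    then show "6 * \<delta>2 < 1 / R" by (simp add: u_def)
    have "8 * \<delta>1 \<le> 1 / R" using \<open>8 * \<delta>1 \<le> u\<close> by (simp add: u_def)
    then have "8 * \<delta>1 * R \<le> 1 / R * R" using R by (intro mult_right_mono) auto
    then show "8 * \<delta>1 * R \<le> 1" using R by simp
  qed
  define \<alpha>1 where "\<alpha>1 = min \<alpha>2 (\<delta>1 / (4 * A))"
  have \<alpha>1: "0 < \<alpha>1" "\<alpha>1 \<le> 1" "\<alpha>1 \<le> \<alpha>2" "A * \<alpha>1 \<le> \<delta>1 / 4"
  proof -
    show "0 < \<alpha>1" "\<alpha>1 \<le> 1" "\<alpha>1 \<le> \<alpha>2" using \<delta>1 \<alpha>2 A by (auto simp: \<alpha>1_def)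
    have "\<alpha>1 \<le> \<delta>1 / (4 * A)" by (simp add: \<alpha>1_def)
    then have "A * \<alpha>1 \<le> A * (\<delta>1 / (4 * A))" using A by (intro mult_left_mono) auto
    then show "A * \<alpha>1 \<le> \<delta>1 / 4" using A by simp
  qed
  define \<epsilon> where "\<epsilon> = min (\<alpha>1 ^ r / 2) c"
  have \<epsilon>: "0 < \<epsilon>" "\<epsilon> \<le> \<alpha>1 ^ r / 2" "\<epsilon> \<le> c" using \<alpha>1 c by (auto simp: \<epsilon>_def)
  obtain \<gamma> N1 where \<gamma>: "0 < \<gamma>" and N1: "\<And>(V :: 'a set) E. r_graph r (Hypergraph V E) \<Longrightarrow> N1 \<le> card V \<Longrightarrow>
    \<not> contains_copy (Hypergraph V E) (semi_blowup_fan r t) \<Longrightarrow>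
    (card V / r) ^ r - \<gamma> * real (card V) ^ r \<le> card E \<Longrightarrow>
    (\<exists>p :: 'a \<Rightarrow> nat. (\<forall>v\<in>V. p v < r) \<and> (card V / r) ^ r - \<epsilon> * real (card V) ^ r \<le> card (E \<inter> rainbow V p {..<r}))"
    using near_extremal_colouring[OF r \<epsilon>(1), where 'a = 'a and t = t] by (elim exE conjE) (rule that, assumption, blast)
  obtain N2 where N2: "\<And>n. N2 \<le> n \<Longrightarrow> (n / r) ^ r - \<gamma> * real n ^ r \<le> jsize r (t - 1) n"
    using jsize_lower[OF r \<gamma>, of "t - 1"] by blast
  obtain N3 where N3: "\<And>n. N3 \<le> n \<Longrightarrow>
      (1 / real r ^ (r - 1) - \<delta>1) * real n ^ (r - 1) \<le> jsize r (t - 1) n - jsize r (t - 1) (n - 1)"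
    using jsize_increment[OF r \<delta>1(1), of "t - 1"] by blast
  define N where "N = Ng + N1 + N2 + N3 + nat \<lceil>4 * real K / \<delta>1\<rceil> + nat \<lceil>real t / c\<rceil> + t + r + 1"
  show ?thesis
  proof (rule exI[of _ N], intro allI impI, elim conjE)
    fix V :: "'a set" and E
    assume H: "r_graph r (Hypergraph V E)" and n: "N \<le> card V"
      and free: "\<not> contains_copy (Hypergraph V E) (semi_blowup_fan r t)"
      and big: "jsize r (t - 1) (card V) \<le> card E"
      and mindeg: "\<forall>v\<in>V. jsize r (t - 1) (card V) - jsize r (t - 1) (card V - 1) \<le> card {e\<in>E. v \<in> e}"
    have n1: "Ng \<le> card V" "N1 \<le> card V" "N2 \<le> card V" "N3 \<le> card V" "4 * real K / \<delta>1 \<le> card V" "real t / c \<le> card V"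
      "t + r \<le> card V" "0 < card V" using n unfolding N_def by linarith+
    have V: "V \<noteq> {}" using n1(8) by auto
    have "(card V / r) ^ r - \<gamma> * real (card V) ^ r \<le> card E" using N2[OF n1(3)] big by linarith
    from N1[OF H n1(2) free this] obtain p0 :: "'a \<Rightarrow> nat" where p0: "\<forall>v\<in>V. p0 v < r"
      "(card V / r) ^ r - \<epsilon> * real (card V) ^ r \<le> card (E \<inter> rainbow V p0 {..<r})" by blast
    from ex_maximal_colouring[OF H r p0(1) V] obtain p where p: "coloured_graph r V E p" "coloured_graph.maximal r V E p"
      "card (E \<inter> rainbow V p0 {..<r}) \<le> card (E \<inter> rainbow V p {..<r})" by blast
    interpret coloured_graph r V E p by (rule p(1))
    have max: maximal by (rule p(2))
    have dense: "(n / r) ^ r - \<epsilon> * n ^ r \<le> card (E \<inter> rainbow V p {..<r})" using p0(2) p(3) by linarith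
    have good1: "good \<alpha>1 {}" by (rule good_empty[OF dense \<epsilon>(2)])
    have good2: "good \<alpha>2 {}" by (rule good_mono[OF good1 \<alpha>1(1,3)])
    have cn: "c * n ^ r \<le> card (rainbow V p {..<r})"
    proof -
      have "card (E \<inter> rainbow V p {..<r}) \<le> card (rainbow V p {..<r})" using finite_rainbow[OF D(1)] by (intro card_mono) auto
      moreover have "(n / r) ^ r = 2 * c * n ^ r" by (simp add: c_def power_divide)
      moreover have "\<epsilon> * n ^ r \<le> c * n ^ r" using \<epsilon>(3) by (intro mult_right_mono) auto
      ultimately show ?thesis using dense by linarith
    qed
    have K1: "4 * real K \<le> \<delta>1 * n" using n1(5) \<delta>1(1) by (simp add: field_simps)
    have K2: "4 * real K \<le> \<delta>2 * n" using K1 mult_right_mono[OF \<delta>1(2), of n] by linarith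
    have Kn: "real K \<le> \<delta>1 * n" using K1 by simp
    have tc: "t \<le> c * n" using n1(6) c by (simp add: field_simps)
    have fit1: "fits t K \<delta>1 \<alpha>1"
      using \<delta>1(2) \<delta>2(2) by (intro fitsI[OF c(1) cn _ \<delta>1(1) \<alpha>1(1,2) good1 _ K_def K1] \<alpha>1(4)[unfolded A_def]) linarith
    have fit2: "fits t K \<delta>2 \<alpha>2"
      by (rule fitsI[OF c(1) cn \<delta>2(2) \<delta>2(1) \<alpha>2(1,2) good2 \<alpha>2(3)[unfolded A_def] K_def K2])
    have deg: "(1 / real r ^ (r - 1) - \<delta>1) * n ^ (r - 1) \<le> card {e\<in>E. v \<in> e}" if "v \<in> V" for v
      using N3[OF n1(4)] mindeg that by fastforce
    have tame: "v \<notin> low K \<delta>2 \<and> good \<alpha>2 {v}" if "v \<in> V" "v \<notin> wild K \<delta>1" for v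
      using \<delta>R \<delta>1 by (intro tame_vertices[OF free fit1 max Kn \<delta>1(2,1) deg c(1) cn \<delta>2(2) tc _ _ _ _ that])
        (simp_all add: R_def Q_def)
    define W where "W = wild K \<delta>2"
    have cW: "card W < t" unfolding W_def by (rule card_wild_less[OF free fit2])
    have WV: "W \<subseteq> V" by (auto simp: W_def wild_def)
    have d: "5 * \<delta>2 < 1 / real r ^ (r - 1) - \<delta>1" using \<delta>R(1) \<delta>1(2) unfolding R_def by linarith
    have bad: "real (card {e\<in>E. e \<inter> W = {} \<and> \<not> inj_on p e}) \<le> real (t - 1 - card W) * (B * \<delta>2 * n ^ (r - 1))"
      unfolding W_def B_def by (rule few_bad_edges[OF free fit1 fit2 max Kn \<delta>1(2,1) deg d tame])
    also have "\<dots> \<le> real (t - 1 - card W) * (g / 2 * n ^ (r - 1))"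
      using \<delta>2(3) by (intro mult_left_mono mult_right_mono) auto
    finally have bad': "real (card {e\<in>E. e \<inter> W = {} \<and> \<not> inj_on p e}) \<le> real (t - 1 - card W) * (g / 2 * n ^ (r - 1))" .
    have "r \<le> card V - card W" using n1(7) cW by linarith
    then have "real (card E) \<le> real (card V choose r) - real ((card V - card W) choose r) + turan_number r (card V - card W) +
      card {e\<in>E. e \<inter> W = {} \<and> \<not> inj_on p e}"
      using r p_less by (intro edges_upper_bound[OF H WV]) auto
    moreover have "real (card V choose r) - real ((card V - card W) choose r) + turan_number r (card V - card W) +
      real (t - 1 - card W) * (g * n ^ (r - 1)) \<le> jsize r (t - 1) (card V)"
      using cW by (intro Ng n1(1)) simp
    moreover have "real (t - 1 - card W) * (g * n ^ (r - 1)) = 2 * (real (t - 1 - card W) * (g / 2 * n ^ (r - 1)))" by simp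
    \<comment> \<open>The graph loses \<open>g\<close> per missing wild vertex against
      \<open>jsize\<close> and regains at most \<open>g / 2\<close> by bad edges. So no wild vertex
      is missing, and then \<open>bad'\<close> leaves no bad edge either.\<close>
    ultimately have "real (t - 1 - card W) * (g / 2 * n ^ (r - 1)) \<le> 0" using big bad' by linarith
    moreover have "0 < g / 2 * n ^ (r - 1)" using g n_pos by simp
    ultimately have "real (t - 1 - card W) \<le> 0" by (meson mult_pos_pos not_le)
    then have w: "card W = t - 1" using cW by simp
    then have "card {e\<in>E. e \<inter> W = {} \<and> \<not> inj_on p e} = 0" using bad' by simp
    then have "{e\<in>E. e \<inter> W = {} \<and> \<not> inj_on p e} = {}" using D(5) by simp
    then have "\<forall>e\<in>E. e \<inter> W \<noteq> {} \<or> inj_on p e" by blast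
    then show "\<exists>W (p :: 'a \<Rightarrow> nat). W \<subseteq> V \<and> card W = t - 1 \<and> (\<forall>v\<in>V. p v < r) \<and> (\<forall>e\<in>E. e \<inter> W \<noteq> {} \<or> inj_on p e)"
      using WV w p_less by blast
  qed
qed

section \<open>The extremal graph\<close>

lemma contains_copy_mono:
  assumes "contains_copy (Hypergraph V' E') F" "V' \<subseteq> V" "E' \<subseteq> E"
  shows "contains_copy (Hypergraph V E) F"
  using assms unfolding contains_copy_def by (simp, meson subset_trans subsetD)

text \<open>The transversal edge uses all \<open>r\<close> colours, so the centre shares its colour
  with some transversal vertex; but these two lie in a common petal.\<close>

lemma fan_not_rainbow:
  assumes r: "2 \<le> r" and inj: "inj_on g (verts (fan r))"
    and rb: "\<And>e. e \<in> edges (fan r) \<Longrightarrow> g ` e \<in> rainbow V p {..<r}"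
  shows False
proof -
  define e where "e i = insert Centre (insert (Transv i) (Petal i ` {..<r - 2}))" for i
  have T: "g ` Transv ` {..<r} \<in> rainbow V p {..<r}" and P: "\<And>i. i < r \<Longrightarrow> g ` e i \<in> rainbow V p {..<r}"
    by (rule rb; simp add: edges_fan e_def)+
  have "Centre \<in> e 0" by (simp add: e_def)
  then have "p (g Centre) \<in> p ` g ` e 0" by blast
  then have "p (g Centre) < r" using P[of 0] r by (auto simp: rainbow_def)
  then have "p (g Centre) \<in> p ` g ` Transv ` {..<r}" using T by (simp add: rainbow_def)
  then obtain i where i: "i < r" "p (g Centre) = p (g (Transv i))" by auto
  have "inj_on p (g ` e i)" using P[OF i(1)] by (simp add: rainbow_def)
  moreover have "g Centre \<in> g ` e i" "g (Transv i) \<in> g ` e i" by (simp_all add: e_def)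
  ultimately have "g Centre = g (Transv i)" using i(2) by (auto dest: inj_onD)
  moreover have "Centre \<in> verts (fan r)" "Transv i \<in> verts (fan r)" using i(1) by (auto simp: verts_fan)
  ultimately have "Centre = Transv i" using inj by (auto dest: inj_onD)
  then show False by simp
qed

lemma joined_turan_graph_edges:
  assumes "0 < r"
  shows "edges (joined_turan_graph r s n) = rainbow {..<n - s} (\<lambda>v. v mod r) {..<r} \<union>
    {e. e \<subseteq> {..<n} \<and> card e = r \<and> e \<inter> {n - s..<n} \<noteq> {}}"
  using edges_turan_graph[OF assms] by (simp add: joined_turan_graph_def)

lemma joined_turan_graph_verts: "verts (joined_turan_graph r s n) = {..<n}"
  by (simp add: joined_turan_graph_def)

lemma r_graph_joined_turan_graph:
  assumes "0 < r"
  shows "r_graph r (joined_turan_graph r s n)"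
proof -
  have "e \<subseteq> {..<n} \<and> card e = r" if "e \<in> edges (joined_turan_graph r s n)" for e
  proof -
    have "e \<in> rainbow {..<n - s} (\<lambda>v. v mod r) {..<r} \<or> e \<subseteq> {..<n} \<and> card e = r"
      using that unfolding joined_turan_graph_edges[OF assms] by blast
    then show ?thesis
    proof
      assume e: "e \<in> rainbow {..<n - s} (\<lambda>v. v mod r) {..<r}"
      then have "e \<subseteq> {..<n - s}" by (simp add: rainbow_def)
      moreover have "{..<n - s} \<subseteq> {..<n}" by auto
      ultimately show ?thesis using rainbow_card[OF e] by auto
    qed
  qed
  then show ?thesis by (simp add: r_graph_def joined_turan_graph_verts)
qed

text \<open>Each of the \<open>t\<close> disjoint fans of a copy would need its own vertex in the
  joined set, which has at most \<open>t - 1\<close> vertices.\<close>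

lemma joined_turan_graph_free:
  assumes r: "2 \<le> r" and t: "1 \<le> t"
  shows "\<not> contains_copy (joined_turan_graph r (t - 1) n) (semi_blowup_fan r t)"
proof
  let ?J = "joined_turan_graph r (t - 1) n"
  let ?S = "{n - (t - 1)..<n}"
  have r0: "0 < r" using r by simp
  assume "contains_copy ?J (semi_blowup_fan r t)"
  then obtain f where f: "inj_on f (verts (semi_blowup_fan r t))"
    "f ` verts (semi_blowup_fan r t) \<subseteq> {..<n}" "\<And>e. e \<in> edges (semi_blowup_fan r t) \<Longrightarrow> f ` e \<in> edges ?J"
    by (auto simp: contains_copy_def joined_turan_graph_verts)
  have vs: "verts (semi_blowup_fan r t) = {..<t} \<times> verts (fan r)" by (simp add: semi_blowup_fan_def)
  have "\<exists>v\<in>verts (fan r). f (i, v) \<in> ?S" if i: "i < t" for i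
  proof (rule ccontr)
    assume n: "\<not> ?thesis"
    show False
    proof (rule fan_not_rainbow[OF r])
      show "inj_on (\<lambda>v. f (i, v)) (verts (fan r))"
        using f(1) i by (auto simp: inj_on_def vs)
      fix e assume e: "e \<in> edges (fan r)"
      then have "Pair i ` e \<in> edges (semi_blowup_fan r t)" using i by (auto simp: semi_blowup_fan_def)
      then have "f ` Pair i ` e \<in> edges ?J" by (rule f(3))
      moreover have "e \<subseteq> verts (fan r)" using e by (auto simp: edges_fan verts_fan)
      then have "f ` Pair i ` e \<inter> ?S = {}" using n by blast
      ultimately have "f ` Pair i ` e \<in> rainbow {..<n - (t - 1)} (\<lambda>v. v mod r) {..<r}"
        unfolding joined_turan_graph_edges[OF r0] by blast
      then show "(\<lambda>v. f (i, v)) ` e \<in> rainbow {..<n - (t - 1)} (\<lambda>v. v mod r) {..<r}" by (simp add: image_image)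
    qed
  qed
  then obtain h where h: "\<And>i. i < t \<Longrightarrow> h i \<in> verts (fan r) \<and> f (i, h i) \<in> ?S" by metis
  have "inj_on (\<lambda>i. f (i, h i)) {..<t}"
  proof (rule inj_onI)
    fix i j assume ij: "i \<in> {..<t}" "j \<in> {..<t}" "f (i, h i) = f (j, h j)"
    then have "(i, h i) = (j, h j)" using h by (intro inj_onD[OF f(1)]) (auto simp: vs)
    then show "i = j" by simp
  qed
  then have "card {..<t} \<le> card ?S" using h by (intro card_inj_on_le[of "\<lambda>i. f (i, h i)"]) auto
  then show False using t by simp
qed

lemma card_edges_joined_turan_graph:
  assumes r: "0 < r" and s: "s \<le> n"
  shows "card (edges (joined_turan_graph r s n)) + ((n - s) choose r) = (n choose r) + turan_number r (n - s)"
proof -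
  let ?M = "{e. e \<subseteq> {..<n} \<and> card e = r \<and> e \<inter> {n - s..<n} \<noteq> {}}"
  let ?R = "rainbow {..<n - s} (\<lambda>v. v mod r) {..<r}"
  have "card ?M + ((card {..<n} - card {n - s..<n}) choose r) = card {..<n} choose r"
    by (intro card_edges_meeting) auto
  then have "card ?M + ((n - s) choose r) = n choose r" using s by simp
  moreover have "card ?R = turan_number r (n - s)"
    using edges_turan_graph[OF r] by (simp add: turan_number_def)
  moreover have "card (?R \<union> ?M) = card ?R + card ?M"
    by (intro card_Un_disjoint finite_rainbow) (auto simp: rainbow_def)
  ultimately show ?thesis unfolding joined_turan_graph_edges[OF r] by simp
qed

lemma jsize_eq:
  assumes "0 < r" "s \<le> n"
  shows "jsize r s n = card (edges (joined_turan_graph r s n))"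
  using card_edges_joined_turan_graph[OF assms] unfolding jsize_def by linarith

text \<open>Deleting a vertex of small degree raises the surplus over the conjectured maximum by at least one,
  so a surplus on many vertices would become impossible on \<open>N0\<close> vertices.\<close>

lemma extremal_bound:
  assumes r: "2 \<le> r" and t: "1 \<le> t"
  shows "\<exists>N. \<forall>(V :: 'a set) E. r_graph r (Hypergraph V E) \<and> N \<le> card V \<and>
    \<not> contains_copy (Hypergraph V E) (semi_blowup_fan r t) \<longrightarrow>
    real (card E) \<le> jsize r (t - 1) (card V) \<and>
    (real (card E) = jsize r (t - 1) (card V) \<longrightarrow>
      (\<exists>W (p :: 'a \<Rightarrow> nat). W \<subseteq> V \<and> card W = t - 1 \<and> (\<forall>v\<in>V. p v < r) \<and> (\<forall>e\<in>E. e \<inter> W \<noteq> {} \<or> inj_on p e)))"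
proof -
  let ?F = "semi_blowup_fan r t"
  define s where "s = t - 1"
  define struct where "struct V E \<longleftrightarrow> (\<exists>W (p :: 'a \<Rightarrow> nat). W \<subseteq> V \<and> card W = s \<and> (\<forall>v\<in>V. p v < r) \<and>
    (\<forall>e\<in>E. e \<inter> W \<noteq> {} \<or> inj_on p e))" for V E
  define free where "free V E \<longleftrightarrow> r_graph r (Hypergraph (V :: 'a set) E) \<and> \<not> contains_copy (Hypergraph V E) ?F" for V E
  define mindeg where "mindeg V E \<longleftrightarrow> (\<forall>v\<in>V. jsize r s (card V) - jsize r s (card V - 1) \<le> card {e\<in>E. v \<in> e})"
    for V :: "'a set" and E
  from structure_of_dense_graphs[OF r t, where 'a = 'a] obtain N1 where
    N1': "\<forall>(V :: 'a set) E. r_graph r (Hypergraph V E) \<and> N1 \<le> card V \<and>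
    \<not> contains_copy (Hypergraph V E) ?F \<and> jsize r (t - 1) (card V) \<le> card E \<and>
    (\<forall>v\<in>V. jsize r (t - 1) (card V) - jsize r (t - 1) (card V - 1) \<le> card {e\<in>E. v \<in> e}) \<longrightarrow>
    (\<exists>W (p :: 'a \<Rightarrow> nat). W \<subseteq> V \<and> card W = t - 1 \<and> (\<forall>v\<in>V. p v < r) \<and> (\<forall>e\<in>E. e \<inter> W \<noteq> {} \<or> inj_on p e))"
    by (rule exE)
  have N1: "struct V E" if "free V E" "N1 \<le> card V" "jsize r s (card V) \<le> card E" "mindeg V E" for V E
    using N1'[THEN spec, THEN spec, THEN mp, of V E] that
    unfolding free_def struct_def mindeg_def s_def by (simp only: simp_thms)
  define N0 where "N0 = N1 + s + r + 1"
  have upper: "real (card E) \<le> jsize r s (card V)" if VE: "free V E" "N0 \<le> card V" "struct V E" for V :: "'a set" and E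
  proof -
    obtain W and p :: "'a \<Rightarrow> nat" where W: "W \<subseteq> V" "card W = s" "\<And>v. v \<in> V \<Longrightarrow> p v < r" "\<forall>e\<in>E. e \<inter> W \<noteq> {} \<or> inj_on p e"
      using VE(3) unfolding struct_def by blast
    have H: "r_graph r (Hypergraph V E)" using VE(1) by (simp add: free_def)
    have "{e\<in>E. e \<inter> W = {} \<and> \<not> inj_on p e} = {}" using W(4) by blast
    then have "card {e\<in>E. e \<inter> W = {} \<and> \<not> inj_on p e} = 0" by (simp only: card.empty)
    then show ?thesis
      using edges_upper_bound[OF H W(1), of p, OF W(3)] r VE(2) W(2) unfolding jsize_def N0_def by simp
  qed
  have del: "free (V - {v}) {e\<in>E. v \<notin> e} \<and> card E = card {e\<in>E. v \<notin> e} + card {e\<in>E. v \<in> e}"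
    if "free V E" for V :: "'a set" and E and v
  proof -
    have H: "r_graph r (Hypergraph V E)" and nc: "\<not> contains_copy (Hypergraph V E) ?F"
      using that by (simp_all add: free_def)
    have "r_graph r (Hypergraph (V - {v}) {e\<in>E. v \<notin> e})" using H by (auto simp: r_graph_def)
    moreover have "\<not> contains_copy (Hypergraph (V - {v}) {e\<in>E. v \<notin> e}) ?F"
      using nc contains_copy_mono[of "V - {v}" "{e\<in>E. v \<notin> e}" ?F V E] by blast
    moreover have "card ({e\<in>E. v \<notin> e} \<union> {e\<in>E. v \<in> e}) = card {e\<in>E. v \<notin> e} + card {e\<in>E. v \<in> e}"
      using r_graphD(5)[OF H] by (intro card_Un_disjoint) auto
    moreover have "{e\<in>E. v \<notin> e} \<union> {e\<in>E. v \<in> e} = E" by blast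
    ultimately show ?thesis by (simp add: free_def)
  qed
  define C where "C = N0 ^ r"
  define j where "j m = card (edges (joined_turan_graph r s m))" for m
  have j: "jsize r s m = j m" if "N0 \<le> m" for m unfolding j_def using that r by (intro jsize_eq) (auto simp: N0_def)
  \<comment> \<open>On \<open>N0\<close> vertices the surplus is trivially at most \<open>C\<close>.
    It falls with every added vertex, and by truncated subtraction the bound on it is zero from
    \<open>N0 + C\<close> vertices on.\<close>
  have bound: "card E \<le> j m + (C - (m - N0))" if "N0 \<le> m" "free V E" "card V = m" for V :: "'a set" and E m
    using that
  proof (induction m arbitrary: V E rule: dec_induct)
    case base
    then have H: "r_graph r (Hypergraph V E)" by (simp add: free_def)
    have "card E \<le> card {e. e \<subseteq> V \<and> card e = r}" using r_graphD[OF H] by (intro card_mono) auto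
    also have "\<dots> \<le> C" using card_subsets_le[OF r_graphD(1)[OF H], of r] base by (simp add: C_def)
    finally show ?case by simp
  next
    case (step m)
    show ?case
    proof (cases "card E \<le> j (Suc m)")
      case False
      have n: "N0 \<le> card V" "N1 \<le> card V" using step by (auto simp: N0_def)
      \<comment> \<open>With large minimum degree the graph would have the extremal structure, and
        \<open>upper\<close> would exclude the surplus.\<close>
      have "\<not> mindeg V E"
      proof
        assume "mindeg V E"
        then have "struct V E" using False step n j[of "Suc m"] by (intro N1) auto
        then show False using upper[of V E] step n j[of "Suc m"] False by simp
      qed
      then obtain v where v: "v \<in> V" "real (card {e\<in>E. v \<in> e}) < jsize r s (card V) - jsize r s (card V - 1)"
        by (auto simp: mindeg_def not_le)
      have "finite V" using step(4) r_graphD(1) by (auto simp: free_def)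
      then have "card (V - {v}) = m" using v(1) step by simp
      then have "card {e\<in>E. v \<notin> e} \<le> j m + (C - (m - N0))" using step del by blast
      moreover have "real (card {e\<in>E. v \<in> e}) < real (j (Suc m)) - real (j m)"
        using v(2) step j[of m] j[of "Suc m"] by simp
      moreover have "card E = card {e\<in>E. v \<notin> e} + card {e\<in>E. v \<in> e}" using del step by blast
      ultimately have "card E < j (Suc m) + (C - (m - N0))" by linarith
      \<comment> \<open>\<open>j\<close> takes natural values, so the strict inequality is a
        decrease by one; the positive surplus ensures that the subtraction does not truncate
        here.\<close>
      then show ?thesis using False step(1) by linarith
    qed simp
  qed
  have bound': "real (card E) \<le> jsize r s (card V)" if "free V E" "N0 + C \<le> card V" for V :: "'a set" and E
    using bound[OF _ that(1) refl] j[of "card V"] that(2) by simp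
  have "real (card E) \<le> jsize r s (card V) \<and> (real (card E) = jsize r s (card V) \<longrightarrow> struct V E)"
    \<comment> \<open>The additional 1 keeps \<open>bound'\<close> available after one vertex has
      been deleted.\<close>
    if V: "free V E" "N0 + C + 1 \<le> card V" for V :: "'a set" and E
  proof (intro conjI impI)
    show "real (card E) \<le> jsize r s (card V)" using V by (intro bound') auto
    assume eq: "real (card E) = jsize r s (card V)"
    have "mindeg V E"
    proof (rule ccontr)
      assume "\<not> mindeg V E"
      then obtain v where v: "v \<in> V" "real (card {e\<in>E. v \<in> e}) < jsize r s (card V) - jsize r s (card V - 1)"
        by (auto simp: mindeg_def not_le)
      have "finite V" using V(1) r_graphD(1) by (auto simp: free_def)
      then have c: "card (V - {v}) = card V - 1" using v(1) by simp
      then have "real (card {e\<in>E. v \<notin> e}) \<le> jsize r s (card V - 1)"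
        using bound'[OF conjunct1[OF del[OF V(1)]], of v] V(2) by simp
      then show False using conjunct2[OF del[OF V(1)], of v] eq v(2) by simp
    qed
    then show "struct V E" using V eq by (intro N1) (auto simp: N0_def)
  qed
  note final = this[unfolded free_def struct_def s_def]
  show ?thesis
  proof (rule exI[of _ "N0 + C + 1"], intro allI impI, elim conjE)
    fix V :: "'a set" and E
    assume "r_graph r (Hypergraph V E)" "N0 + C + 1 \<le> card V" "\<not> contains_copy (Hypergraph V E) ?F"
    from final[OF conjI[OF this(1,3)] this(2)] show "real (card E) \<le> jsize r (t - 1) (card V) \<and>
    (real (card E) = jsize r (t - 1) (card V) \<longrightarrow>
      (\<exists>W (p :: 'a \<Rightarrow> nat). W \<subseteq> V \<and> card W = t - 1 \<and> (\<forall>v\<in>V. p v < r) \<and> (\<forall>e\<in>E. e \<inter> W \<noteq> {} \<or> inj_on p e)))" .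
  qed
qed

section \<open>Uniqueness\<close>

text \<open>Equal sums force equally many values \<open>q + 1\<close>, so large indices can be
  matched with large ones and small with small ones.\<close>

lemma ex_class_matching:
  fixes a b :: "nat \<Rightarrow> nat"
  assumes a: "\<And>i. i < r \<Longrightarrow> a i = q \<or> a i = q + 1" and b: "\<And>i. i < r \<Longrightarrow> b i = q \<or> b i = q + 1"
    and sum: "sum a {..<r} = sum b {..<r}"
  shows "\<exists>\<sigma>. bij_betw \<sigma> {..<r} {..<r} \<and> (\<forall>i<r. b (\<sigma> i) = a i)"
proof -
  have count: "sum f {..<r} = r * q + card {i. i < r \<and> f i = q + 1}" if "\<And>i. i < r \<Longrightarrow> f i = q \<or> f i = q + 1"
    for f :: "nat \<Rightarrow> nat"
  proof -
    have "sum f {..<r} = (\<Sum>i<r. q + (if f i = q + 1 then 1 else 0))" using that by (intro sum.cong) auto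
    also have "\<dots> = r * q + card {i\<in>{..<r}. f i = q + 1}" by (simp only: sum.distrib sum_if_card finite_lessThan) simp
    finally show ?thesis by simp
  qed
  define A where "A = {i. i < r \<and> a i = q + 1}"
  define B where "B = {i. i < r \<and> b i = q + 1}"
  have fin: "finite A" "finite B" "A \<subseteq> {..<r}" "B \<subseteq> {..<r}" by (auto simp: A_def B_def)
  have cAB: "card A = card B" using count[of a] count[of b] a b sum by (simp add: A_def B_def)
  obtain f where f: "bij_betw f A B" using finite_same_card_bij[OF fin(1,2) cAB] by blast
  have "card ({..<r} - A) = card ({..<r} - B)" using cAB fin by (simp add: card_Diff_subset)
  then obtain g where g: "bij_betw g ({..<r} - A) ({..<r} - B)" using finite_same_card_bij by (metis finite_Diff finite_lessThan)
  define \<sigma> where "\<sigma> i = (if i \<in> A then f i else g i)" for i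
  have "bij_betw \<sigma> (A \<union> ({..<r} - A)) (B \<union> ({..<r} - B))"
    unfolding \<sigma>_def using f g by (intro bij_betw_disjoint_Un) auto
  then have "bij_betw \<sigma> {..<r} {..<r}" using fin by (simp add: Un_absorb1)
  moreover have "b (\<sigma> i) = a i" if i: "i < r" for i
  proof (cases "i \<in> A")
    case True
    then have "\<sigma> i \<in> B" using f by (auto simp: \<sigma>_def bij_betw_def)
    then show ?thesis using True by (simp add: A_def B_def)
  next
    case False
    then have "\<sigma> i \<in> {..<r} - B" using g i by (auto simp: \<sigma>_def bij_betw_def)
    then have "b (\<sigma> i) = q" using b[of "\<sigma> i"] by (auto simp: B_def)
    then show ?thesis using False a[OF i] i by (auto simp: A_def)
  qed
  ultimately show ?thesis by blast
qed

text \<open>Equality in the count leaves no freedom: all edges meeting \<open>W\<close> and all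
  rainbow sets outside \<open>W\<close> are present, and the class sizes are balanced. The
  isomorphism sends \<open>W\<close> to the joined set and each class to a part of the same
  size.\<close>

lemma iso_joined_turan_graph:
  fixes p :: "'a \<Rightarrow> nat"
  assumes H: "r_graph r (Hypergraph V E)" and r: "0 < r" "r + s \<le> card V" and W: "W \<subseteq> V" "card W = s"
    and p: "\<And>v. v \<in> V \<Longrightarrow> p v < r" and E: "\<And>e. e \<in> E \<Longrightarrow> e \<inter> W \<noteq> {} \<or> inj_on p e"
    and cE: "card E = card (edges (joined_turan_graph r s (card V)))"
  shows "hg_iso (Hypergraph V E) (joined_turan_graph r s (card V))"
proof -
  note D = r_graphD[OF H]
  define n where "n = card V"
  define m where "m = n - s"
  have fW: "finite W" using W(1) D(1) finite_subset by blast
  let ?M = "{e. e \<subseteq> V \<and> card e = r \<and> e \<inter> W \<noteq> {}}"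
  let ?R = "rainbow (V - W) p {..<r}"
  let ?a = "\<lambda>j. card {v\<in>V - W. p v = j}"
  have EMR: "E \<subseteq> ?M \<union> ?R"
  proof
    fix e assume e: "e \<in> E"
    have "e \<in> ?R" if "e \<inter> W = {}" using that D(2,3)[OF e] p E[OF e] by (intro rainbowI) auto
    then show "e \<in> ?M \<union> ?R" using e D(2,3)[OF e] by blast
  qed
  have fin: "finite ?M" "finite ?R" using D(1) finite_rainbow[of "V - W"] by auto
  have cM: "card ?M + (m choose r) = n choose r"
    using card_edges_meeting[OF D(1) W(1), of r] W(2) by (simp add: m_def n_def)
  have suma: "sum ?a {..<r} = m"
    using sum_colour_classes[of "V - W" p r] D(1) p fW W by (simp add: card_Diff_subset m_def n_def)
  have rm: "r \<le> m" using r by (simp add: m_def n_def)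
  have cR: "card ?R = prod ?a {..<r}" using D(1) by (simp add: card_rainbow)
  have "card ?R \<le> turan_number r m" unfolding cR by (rule prod_le_turan_number(1)[OF r(1) rm suma])
  moreover have "card E + (m choose r) = (n choose r) + turan_number r m"
    using card_edges_joined_turan_graph[OF r(1), of s n] r(2) cE by (simp add: m_def n_def)
  moreover have "card E \<le> card (?M \<union> ?R)" using EMR fin by (intro card_mono) auto
  moreover have "card (?M \<union> ?R) \<le> card ?M + card ?R" by (rule card_Un_le)
  \<comment> \<open>\<open>card E\<close> equals \<open>card ?M\<close> plus the Turan number, the
    maximum possible for \<open>?M \<union> ?R\<close>; every estimate in between is tight.\<close>
  ultimately have eq: "card ?R = turan_number r m" "card (?M \<union> ?R) = card E" using cM by linarith+
  have E_eq: "E = ?M \<union> ?R" using EMR fin eq(2) by (intro card_subset_eq) auto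
  have bal: "?a j = m div r \<or> ?a j = m div r + 1" if "j < r" for j
    using prod_le_turan_number(2)[OF r(1) rm suma _ that] eq(1) cR by simp
  \<comment> \<open>The larger parts of the Turan graph are the first residues, while the larger
    colour classes may carry any colours; \<open>\<sigma>\<close> corrects this.\<close>
  obtain \<sigma> where \<sigma>: "bij_betw \<sigma> {..<r} {..<r}" "\<And>j. j < r \<Longrightarrow> card (part r m (\<sigma> j)) = ?a j"
    using ex_class_matching[of r ?a "m div r" "\<lambda>i. card (part r m i)"] bal part_values suma sum_card_part[OF r(1), of m]
    by auto
  have "\<exists>h. j < r \<longrightarrow> bij_betw h {v\<in>V - W. p v = j} (part r m (\<sigma> j))" for j
  proof (cases "j < r")
    case True
    have "finite {v\<in>V - W. p v = j}" using D(1) by simp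
    then show ?thesis using finite_same_card_bij[OF _ finite_part \<sigma>(2)[OF True, symmetric]] by blast
  qed simp
  then obtain h where h: "\<And>j. j < r \<Longrightarrow> bij_betw (h j) {v\<in>V - W. p v = j} (part r m (\<sigma> j))" by metis
  have "card W = card {m..<n}" using W(2) r(2) by (simp add: m_def n_def)
  then obtain g where g: "bij_betw g W {m..<n}" using finite_same_card_bij[OF fW] by blast
  define f where "f v = (if v \<in> W then g v else h (p v) v)" for v
  have fh: "f v \<in> part r m (\<sigma> (p v))" if "v \<in> V" "v \<notin> W" for v
    using h[OF p[OF that(1)]] that by (auto simp: f_def bij_betw_def)
  have f_small: "f v < m" "f v mod r = \<sigma> (p v)" if "v \<in> V" "v \<notin> W" for v
    using fh[OF that] by (auto simp: part_def)
  have f_big: "m \<le> f v" "f v < n" if "v \<in> W" for v using g that by (auto simp: f_def bij_betw_def)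
  have \<sigma>inj: "i = j" if "\<sigma> i = \<sigma> j" "i < r" "j < r" for i j using \<sigma>(1) that by (auto simp: bij_betw_def dest: inj_onD)
  have finj: "inj_on f V"
  proof (rule inj_onI)
    fix x y assume xy: "x \<in> V" "y \<in> V" "f x = f y"
    consider "x \<in> W" "y \<in> W" | "x \<notin> W" "y \<notin> W" | "x \<in> W" "y \<notin> W" | "x \<notin> W" "y \<in> W" by blast
    then show "x = y"
    proof cases
      case 1
      then show ?thesis using g xy by (auto simp: f_def bij_betw_def dest: inj_onD)
    next
      case 2
      have "\<sigma> (p x) = \<sigma> (p y)"
        using f_small(2)[OF xy(1) 2(1)] f_small(2)[OF xy(2) 2(2)] xy(3) by simp
      then have pxy: "p x = p y" by (rule \<sigma>inj[OF _ p[OF xy(1)] p[OF xy(2)]])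
      have "inj_on (h (p x)) {v\<in>V - W. p v = p x}" using h[OF p[OF xy(1)]] by (rule bij_betw_imp_inj_on)
      moreover have "h (p x) x = h (p x) y" using xy(3) 2 pxy by (simp add: f_def)
      ultimately show ?thesis by (rule inj_onD) (use xy 2 pxy in simp_all)
    next
      case 3
      then show ?thesis using f_big[of x] f_small[of y] xy by simp
    next
      case 4
      then show ?thesis using f_big[of y] f_small[of x] xy by simp
    qed
  qed
  have "f ` V \<subseteq> {..<n}" using f_small(1) f_big(2) by (force simp: m_def)
  moreover have "card (f ` V) = n" using finj by (simp add: card_image n_def)
  ultimately have fV: "f ` V = {..<n}" by (intro card_subset_eq) auto
  have S: "f ` e \<inter> {m..<n} \<noteq> {} \<longleftrightarrow> e \<inter> W \<noteq> {}" if "e \<subseteq> V" for e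
  proof
    assume "f ` e \<inter> {m..<n} \<noteq> {}"
    then obtain v where "v \<in> e" "m \<le> f v" by auto
    then show "e \<inter> W \<noteq> {}" using f_small(1)[of v] that by fastforce
  next
    assume "e \<inter> W \<noteq> {}"
    then show "f ` e \<inter> {m..<n} \<noteq> {}" using f_big by fastforce
  qed
  have Rb: "f ` e \<in> rainbow {..<m} (\<lambda>v. v mod r) {..<r} \<longleftrightarrow> e \<in> ?R" if e: "e \<subseteq> V" "e \<inter> W = {}" for e
  proof -
    have m: "f v mod r = \<sigma> (p v)" "f v < m" "p v < r" if "v \<in> e" for v using f_small that e p by auto
    have i: "inj_on (\<lambda>v. v mod r) (f ` e) \<longleftrightarrow> inj_on p e"
    proof
      assume a: "inj_on (\<lambda>v. v mod r) (f ` e)"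
      show "inj_on p e"
      proof (rule inj_onI)
        fix x y assume xy: "x \<in> e" "y \<in> e" "p x = p y"
        then have "f x mod r = f y mod r" using m(1) by simp
        then have "f x = f y" using xy by (rule_tac inj_onD[OF a]) auto
        then show "x = y" using xy e by (rule_tac inj_onD[OF finj]) auto
      qed
    next
      assume a: "inj_on p e"
      show "inj_on (\<lambda>v. v mod r) (f ` e)"
      proof (rule inj_onI)
        fix x y assume xy: "x \<in> f ` e" "y \<in> f ` e" "x mod r = y mod r"
        then obtain u v where uv: "u \<in> e" "v \<in> e" "x = f u" "y = f v" by blast
        have "\<sigma> (p u) = \<sigma> (p v)" using xy(3) m(1)[OF uv(1)] m(1)[OF uv(2)] uv by simp
        then have "p u = p v" by (rule \<sigma>inj[OF _ m(3)[OF uv(1)] m(3)[OF uv(2)]])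
        then show "x = y" using a uv by (auto dest: inj_onD)
      qed
    qed
    have ce: "card (f ` e) = card e" using finj e by (intro card_image) (rule inj_on_subset)
    show ?thesis
    proof
      assume a: "f ` e \<in> rainbow {..<m} (\<lambda>v. v mod r) {..<r}"
      then have "inj_on p e" "card e = r" using i rainbow_card[OF a] ce by (auto simp: rainbow_def)
      then show "e \<in> ?R" using e m by (intro rainbowI) auto
    next
      assume a: "e \<in> ?R"
      then have "inj_on p e" "card e = r" using rainbow_card[OF a] by (auto simp: rainbow_def)
      moreover have "f ` e \<subseteq> {..<m}" using m(2) by auto
      moreover have "(\<lambda>v. v mod r) ` f ` e \<subseteq> {..<r}" using r(1) by auto
      ultimately show "f ` e \<in> rainbow {..<m} (\<lambda>v. v mod r) {..<r}"
        using i ce by (intro rainbowI) simp_all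
    qed
  qed
  let ?J = "joined_turan_graph r s n"
  have J: "edges ?J = rainbow {..<m} (\<lambda>v. v mod r) {..<r} \<union> {e. e \<subseteq> {..<n} \<and> card e = r \<and> e \<inter> {m..<n} \<noteq> {}}"
    unfolding m_def by (rule joined_turan_graph_edges[OF r(1)])
  have key: "f ` e \<in> edges ?J \<longleftrightarrow> e \<in> E" if e: "e \<subseteq> V" for e
  proof -
    have ce: "card (f ` e) = card e" using finj e by (intro card_image) (rule inj_on_subset)
    have fe: "f ` e \<subseteq> {..<n}" using e fV by blast
    show ?thesis
    proof (cases "e \<inter> W = {}")
      case True
      then have "f ` e \<inter> {m..<n} = {}" using S[OF e] by blast
      then have "f ` e \<in> edges ?J \<longleftrightarrow> f ` e \<in> rainbow {..<m} (\<lambda>v. v mod r) {..<r}" unfolding J by blast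
      also have "\<dots> \<longleftrightarrow> e \<in> ?R" by (rule Rb[OF e True])
      also have "\<dots> \<longleftrightarrow> e \<in> E" unfolding E_eq using True by blast
      finally show ?thesis .
    next
      case False
      then have 1: "f ` e \<inter> {m..<n} \<noteq> {}" using S[OF e] by blast
      then have "f ` e \<notin> rainbow {..<m} (\<lambda>v. v mod r) {..<r}" by (fastforce simp: rainbow_def)
      then have "f ` e \<in> edges ?J \<longleftrightarrow> card e = r" unfolding J using fe ce 1 by simp
      moreover have "e \<notin> ?R" using False by (auto simp: rainbow_def)
      then have "e \<in> E \<longleftrightarrow> card e = r" unfolding E_eq using e False by simp
      ultimately show ?thesis by simp
    qed
  qed
  have "(\<lambda>e. f ` e) ` E = edges ?J"
  proof
    show "(\<lambda>e. f ` e) ` E \<subseteq> edges ?J" using key D(2) by blast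
    show "edges ?J \<subseteq> (\<lambda>e. f ` e) ` E"
    proof
      fix e' assume e': "e' \<in> edges ?J"
      then have "e' \<subseteq> {..<n}" using r_graph_joined_turan_graph[OF r(1), of s n]
        by (auto simp: r_graph_def joined_turan_graph_verts)
      then obtain e where "e \<subseteq> V" "e' = f ` e" using fV subset_imageE by metis
      then show "e' \<in> (\<lambda>e. f ` e) ` E" using key e' by blast
    qed
  qed
  moreover have "bij_betw f V {..<n}" using finj fV by (simp add: bij_betw_def)
  ultimately show ?thesis unfolding hg_iso_def n_def[symmetric] by (auto simp: joined_turan_graph_verts intro!: exI[of _ f])
qed

theorem theorem1p3:
  fixes r t :: nat
  assumes "r \<ge> 2" and "t \<ge> r"
  shows "\<exists>N. \<forall>n\<ge>N.
    extremal r n (semi_blowup_fan r t) (joined_turan_graph r (t - 1) n) \<and>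
    (\<forall>H :: 'a hypergraph. extremal r n (semi_blowup_fan r t) H \<longrightarrow>
       hg_iso H (joined_turan_graph r (t - 1) n)) \<and>
    ex_number r n (semi_blowup_fan r t) = card (edges (joined_turan_graph r (t - 1) n)) \<and>
    int (card (edges (joined_turan_graph r (t - 1) n))) =
      int (n choose r) - int ((n - t + 1) choose r) + int (turan_number r (n - t + 1))"
proof -
  let ?F = "semi_blowup_fan r t"
  let ?J = "joined_turan_graph r (t - 1)"
  have r: "2 \<le> r" "0 < r" and t: "1 \<le> t" using assms by auto
  \<comment> \<open>Two instances of the bound: \<open>ex_number\<close> ranges over graphs on
    natural numbers, uniqueness over graphs on an arbitrary type.\<close>
  from extremal_bound[OF r(1) t, where 'a = nat] obtain N1 where
    N1': "\<forall>(V :: nat set) E. r_graph r (Hypergraph V E) \<and> N1 \<le> card V \<and>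
    \<not> contains_copy (Hypergraph V E) ?F \<longrightarrow>
    real (card E) \<le> jsize r (t - 1) (card V) \<and>
    (real (card E) = jsize r (t - 1) (card V) \<longrightarrow>
      (\<exists>W (p :: nat \<Rightarrow> nat). W \<subseteq> V \<and> card W = t - 1 \<and> (\<forall>v\<in>V. p v < r) \<and> (\<forall>e\<in>E. e \<inter> W \<noteq> {} \<or> inj_on p e)))" by (rule exE)
  from extremal_bound[OF r(1) t, where 'a = 'a] obtain N2 where
    N2': "\<forall>(V :: 'a set) E. r_graph r (Hypergraph V E) \<and> N2 \<le> card V \<and>
    \<not> contains_copy (Hypergraph V E) ?F \<longrightarrow>
    real (card E) \<le> jsize r (t - 1) (card V) \<and>
    (real (card E) = jsize r (t - 1) (card V) \<longrightarrow>
      (\<exists>W (p :: 'a \<Rightarrow> nat). W \<subseteq> V \<and> card W = t - 1 \<and> (\<forall>v\<in>V. p v < r) \<and> (\<forall>e\<in>E. e \<inter> W \<noteq> {} \<or> inj_on p e)))" by (rule exE)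
  have N1: "real (card E) \<le> jsize r (t - 1) (card V)"
    if "r_graph r (Hypergraph V E)" "N1 \<le> card V" "\<not> contains_copy (Hypergraph V E) ?F" for V :: "nat set" and E
    using N1'[THEN spec, THEN spec, THEN mp, of V E] that by (simp only: simp_thms)
  have N2: "\<exists>W (p :: 'a \<Rightarrow> nat). W \<subseteq> V \<and> card W = t - 1 \<and> (\<forall>v\<in>V. p v < r) \<and> (\<forall>e\<in>E. e \<inter> W \<noteq> {} \<or> inj_on p e)"
    if "r_graph r (Hypergraph V E)" "N2 \<le> card V" "\<not> contains_copy (Hypergraph V E) ?F"
      "real (card E) = jsize r (t - 1) (card V)" for V :: "'a set" and E
    using N2'[THEN spec, THEN spec, THEN mp, of V E] that by (simp only: simp_thms)
  show ?thesis
  proof (rule exI[of _ "N1 + N2 + r + t"], intro allI impI)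
    fix n assume n: "N1 + N2 + r + t \<le> n"
    \<comment> \<open>The two forms of the number of remaining vertices agree because
      \<open>t \<le> n\<close>.\<close>
    have nt: "n - (t - 1) = n - t + 1" "t - 1 \<le> n" using n t by auto
    have js: "jsize r (t - 1) n = card (edges (?J n))" by (rule jsize_eq[OF r(2) nt(2)])
    have Jfree: "free_graph r n ?F (?J n)"
      using r_graph_joined_turan_graph[OF r(2)] joined_turan_graph_free[OF r(1) t]
      by (simp add: free_graph_def joined_turan_graph_verts)
    have ex: "ex_number r n ?F = card (edges (?J n))"
    proof -
      let ?X = "{card (edges H) | H :: nat hypergraph. free_graph r n ?F H}"
      have le: "x \<le> card (edges (?J n))" if x: "x \<in> ?X" for x
      proof -
        obtain H :: "nat hypergraph" where H: "x = card (edges H)" "free_graph r n ?F H" using x by blast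
        have "r_graph r (Hypergraph (verts H) (edges H))" "\<not> contains_copy (Hypergraph (verts H) (edges H)) ?F" "card (verts H) = n"
          using H(2) by (simp_all add: free_graph_def)
        then show ?thesis using N1[of "verts H" "edges H"] n js H(1) by simp
      qed
      have "finite ?X" by (rule finite_subset[of _ "{..card (edges (?J n))}"]) (use le in auto)
      then show ?thesis unfolding ex_number_def using le Jfree by (intro Max_eqI) auto
    qed
    have "hg_iso H (?J n)" if H: "extremal r n ?F H" for H :: "'a hypergraph"
    proof -
      have c: "card (verts H) = n" "card (edges H) = card (edges (?J n))"
        and H': "r_graph r (Hypergraph (verts H) (edges H))" "\<not> contains_copy (Hypergraph (verts H) (edges H)) ?F"
        using H ex by (simp_all add: extremal_def free_graph_def)
      obtain W and p :: "'a \<Rightarrow> nat" where "W \<subseteq> verts H" "card W = t - 1" "\<forall>v\<in>verts H. p v < r"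
        "\<forall>e\<in>edges H. e \<inter> W \<noteq> {} \<or> inj_on p e"
        using N2[OF H'(1) _ H'(2)] n c js by auto
      then have "hg_iso (Hypergraph (verts H) (edges H)) (?J (card (verts H)))"
        using n c t by (intro iso_joined_turan_graph[OF H'(1) r(2)]) auto
      then show ?thesis using c by simp
    qed
    moreover have "int (card (edges (?J n))) = int (n choose r) - int ((n - t + 1) choose r) + int (turan_number r (n - t + 1))"
      using card_edges_joined_turan_graph[OF r(2) nt(2)] unfolding nt(1) by linarith
    ultimately show "extremal r n ?F (?J n) \<and> (\<forall>H :: 'a hypergraph. extremal r n ?F H \<longrightarrow> hg_iso H (?J n)) \<and>
      ex_number r n ?F = card (edges (?J n)) \<and>
      int (card (edges (?J n))) = int (n choose r) - int ((n - t + 1) choose r) + int (turan_number r (n - t + 1))"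
      using ex Jfree by (simp add: extremal_def)
  qed
qed

end
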